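(* Let $A$ and $B$ be $n\times n$ Hermitian matrices with $B$ positive semidefinite. Then there exists a unique positive Borel measure $\mu_{A,B}$ on $[0,\infty)$ such that \[ \operatorname{Tr} e^{A-tB}=\int_{[0,\infty)} e^{-ts}\,d\mu_{A,B}(s)\qquad\text{for all } t\ge 0 . \] (That is, the BMV conjecture holds: $t\mapsto \operatorname{Tr}e^{A-tB}$ is the Laplace transform of a positive measure on $[0,\infty)$.)
   Context: $\operatorname{Tr}$ denotes the trace and $e^{M}$ the matrix exponential. *)

theory Defs
  imports "HOL-Analysis.Analysis" "HOL-Probability.Probability"
begin

definition hermitian_mat :: "complex ^'n ^'n \<Rightarrow> bool" where
  "hermitian_mat A \<longleftrightarrow> (\<forall>i j. A $ i $ j = cnj (A $ j $ i))"

definition psd_mat :: "complex ^'n ^'n \<Rightarrow> bool" where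
  "psd_mat B \<longleftrightarrow> hermitian_mat B \<and>
     (\<forall>x :: complex ^'n. 0 \<le> Re (\<Sum>i\<in>UNIV. \<Sum>j\<in>UNIV. cnj (x $ i) * B $ i $ j * x $ j))"

fun mat_pow :: "complex ^'n ^'n \<Rightarrow> nat \<Rightarrow> complex ^'n ^'n" where
  "mat_pow M 0 = mat 1"
| "mat_pow M (Suc k) = M ** mat_pow M k"

definition mat_exp :: "complex ^'n ^'n \<Rightarrow> complex ^'n ^'n" where
  "mat_exp M = (\<chi> i j. \<Sum>k. mat_pow M k $ i $ j / of_nat (fact k))"

definition mat_trace :: "complex ^'n ^'n \<Rightarrow> complex" where
  "mat_trace M = (\<Sum>i\<in>UNIV. M $ i $ i)"

end

theory Submission
  imports Defs "HOL-Real_Asymp.Real_Asymp" "HOL-Computational_Algebra.Fundamental_Theorem_Algebra"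
begin

text \<open>
  Take \<open>B = diag b\<close> with distinct entries. For real \<open>c\<close>, \<open>s\<close> let
  \<open>g(c,s)\<close> be the integral over \<open>x \<in> \<real>\<close> of
  \<open>ln |det (A - c - x (s - B))| - \<Sum>\<^sub>i ln |a\<^sub>i\<^sub>i - c - x (s - b\<^sub>i)|\<close>.
  For fixed \<open>c\<close>, \<open>s\<close> the determinant is a polynomial in \<open>x\<close>, and a Jensen-type formula shows that
  \<open>g(c,s)\<close> is \<open>\<pi>\<close> times the sum of \<open>|Im z|\<close> over its zeros \<open>z\<close>; in particular
  \<open>g \<ge> 0\<close>, and \<open>g(c,s) = 0\<close> if \<open>s - B\<close> is definite.
  For fixed real \<open>x\<close>, on the other hand, all zeros in \<open>s\<close> are real. Integrating over \<open>s\<close> first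
  therefore leaves only boundary contributions, and Fubini gives, with \<open>\<alpha>\<^sub>i\<close> the eigenvalues of \<open>A\<close>
  and a constant \<open>\<kappa> > 0\<close>,
  \<open>\<integral> g(c,s) ds = \<kappa> (\<Sum>\<^sub>i |\<alpha>\<^sub>i - c| - \<Sum>\<^sub>i |a\<^sub>i\<^sub>i - c|)\<close>.
  Integrating against \<open>e\<^sup>c\<close> (twice by parts) yields
  \<open>Tr e\<^sup>A = \<Sum>\<^sub>i exp a\<^sub>i\<^sub>i + (1/2\<kappa>) \<integral>\<integral> e\<^sup>c g(c,s) dc ds\<close>.
  Replacing \<open>A\<close> by \<open>A - t B\<close> only shears \<open>g\<close>, sending \<open>g(c,s)\<close> to \<open>g(c + t s, s)\<close>, so that
  \<open>Tr exp (A - t B)\<close> is the Laplace transform of the positive measure with atoms \<open>exp a\<^sub>i\<^sub>i\<close> at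
  \<open>b\<^sub>i\<close> and density \<open>(1/2\<kappa>) \<integral> e\<^sup>c g(c,s) dc\<close>.
  Multiple eigenvalues of \<open>B\<close> are handled by perturbation and Helly's selection theorem; uniqueness
  follows from the Weierstrass theorem applied to polynomials in \<open>e\<^sup>-\<^sup>s\<close>.
\<close>

section \<open>Spectral theorem for Hermitian matrices\<close>

text \<open>The difficulty is the exchange of the \<open>x\<close>- and \<open>s\<close>-integrals.
  After rescaling, \<open>s\<close> is confined to \<open>{-1..1}\<close>: outside this window the
  \<open>x\<close>-integral vanishes, and inside it the \<open>s\<close>-integral is an explicit
  function \<open>lnavg\<close> of the eigenvalues and the diagonal entries of
  \<open>A/x + B\<close>. Fubini needs an absolute bound that is integrable at large
  \<open>x\<close>. It comes from pairing every eigenvalue with a diagonal entry up to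
  \<open>O(1/x\<^sup>2)\<close>, and this uses the gaps between the \<open>b\<^sub>i\<close>; hence
  the distinct entries. The constant in this pairing depends on the gaps, while the mass of
  \<open>g\<close> is computed by shrinking \<open>b\<close> to 0, where the gaps close. A second
  bound, for the signed \<open>s\<close>-integral only, is therefore proved without gaps: diagonal
  entries are averages of eigenvalues with doubly stochastic weights, so the first-order Taylor term
  cancels and only the off-diagonal part of \<open>A/x\<close> remains, whatever \<open>b\<close>
  is. Positivity of \<open>g\<close> has an elementary source: moving a zero to its real part lowers
  \<open>ln \<bar>x - z\<bar>\<close>, and for real zeros the integral is 0 because both products
  have the same degree and leading coefficient.\<close>

definition adj :: "complex^'n^'n \<Rightarrow> complex^'n^'n" where
  "adj M = (\<chi> i j. cnj (M $ j $ i))"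

definition dg :: "('n \<Rightarrow> real) \<Rightarrow> complex^'n^'n" where
  "dg l = (\<chi> i j. if i = j then complex_of_real (l i) else 0)"

definition cin :: "complex^'n \<Rightarrow> complex^'n \<Rightarrow> complex" where
  "cin x y = (\<Sum>i\<in>UNIV. cnj (x $ i) * y $ i)"

lemma adj_nth [simp]: "adj M $ i $ j = cnj (M $ j $ i)"
  by (simp add: adj_def)

lemma dg_nth: "dg l $ i $ j = (if i = j then complex_of_real (l i) else 0)"
  by (simp add: dg_def)

lemma adj_mult: "adj (M ** N) = adj N ** adj M"
  by (simp add: vec_eq_iff matrix_matrix_mult_def mult.commute)

lemma adj_adj [simp]: "adj (adj M) = M"
  by (simp add: vec_eq_iff)

lemma adj_dg [simp]: "adj (dg l) = dg l"
  by (simp add: vec_eq_iff dg_nth)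

lemma hermitian_mat_iff_adj: "hermitian_mat M \<longleftrightarrow> adj M = M"
proof
  assume h: "hermitian_mat M"
  have "adj M $ i $ j = M $ i $ j" for i j
    using h[unfolded hermitian_mat_def, rule_format, of i j] by simp
  then show "adj M = M" by (simp only: vec_eq_iff) blast
next
  assume h: "adj M = M"
  have "M $ i $ j = cnj (M $ j $ i)" for i j
    using arg_cong[OF h, of "\<lambda>X. X $ i $ j"] by simp
  then show "hermitian_mat M" unfolding hermitian_mat_def by blast
qed

lemma hermitian_mat_diag:
  assumes "hermitian_mat M" shows "M $ i $ i = complex_of_real (Re (M $ i $ i))"
proof -
  have "M $ i $ i = cnj (M $ i $ i)" using assms unfolding hermitian_mat_def by blast
  then have "Im (M $ i $ i) = - Im (M $ i $ i)" by (metis cnj.sel(2))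
  then show ?thesis by (simp add: complex_eq_iff)
qed

lemma cin_add_right: "cin x (y + z) = cin x y + cin x z"
  by (simp add: cin_def distrib_left sum.distrib)
lemma cin_scale_right: "cin x (c *s y) = c * cin x y"
  by (simp add: cin_def sum_distrib_left algebra_simps)
lemma cin_cnj: "cnj (cin x y) = cin y x"
  by (simp add: cin_def mult.commute)
lemma Re_cin: "Re (cin x y) = x \<bullet> y"
  by (simp add: cin_def inner_vec_def inner_complex_def)
lemma cin_self: "cin x x = complex_of_real ((norm x)\<^sup>2)"
proof -
  have "Im (cin x x) = 0" by (simp add: cin_def mult.commute)
  moreover have "Re (cin x x) = (norm x)\<^sup>2" by (simp add: Re_cin power2_norm_eq_inner)
  ultimately show ?thesis by (simp add: complex_eq_iff)
qed

lemma cin_mult_right: "cin x (M *v y) = cin (adj M *v x) y"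
proof -
  have "cin x (M *v y) = (\<Sum>i\<in>UNIV. \<Sum>j\<in>UNIV. cnj (x$i) * (M$i$j * y$j))"
    by (simp add: cin_def matrix_vector_mult_def sum_distrib_left)
  also have "\<dots> = (\<Sum>j\<in>UNIV. \<Sum>i\<in>UNIV. cnj (x$i) * (M$i$j * y$j))"
    by (rule sum.swap)
  also have "\<dots> = cin (adj M *v x) y"
    by (simp add: cin_def matrix_vector_mult_def sum_distrib_left algebra_simps)
  finally show ?thesis .
qed

lemma Re_cin_hermitian:
  assumes "hermitian_mat M" shows "x \<bullet> (M *v y) = (M *v x) \<bullet> y"
  using assms cin_mult_right[of x M y] by (metis Re_cin hermitian_mat_iff_adj)

text \<open>Rayleigh quotient: a maximiser of \<open>x \<bullet> (M *v x)\<close> on the unit sphere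
  of the orthogonal complement \<open>W\<close> of the earlier eigenvectors is an eigenvector by
  stationarity. The inner product used is the real one, which is the real part of
  \<open>cin\<close>.\<close>

lemma hermitian_eigenvector_extend:
  fixes M :: "complex^'n^'n" and v :: "'n \<Rightarrow> complex^'n"
  assumes M: "hermitian_mat M"
    and ev: "\<And>i. i \<in> S \<Longrightarrow> M *v v i = complex_of_real (l i) *s v i"
    and i0: "i0 \<notin> S"
  shows "\<exists>x a. norm x = 1 \<and> (\<forall>i\<in>S. cin (v i) x = 0) \<and> M *v x = complex_of_real a *s x"
proof -
  define W where "W = {x. \<forall>i\<in>S. cin (v i) x = 0}"
  \<comment> \<open>Row \<open>i0\<close> of \<open>N\<close> is zero, so \<open>N\<close> is
    singular; a kernel vector shows that \<open>W\<close> is nontrivial without counting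
    dimensions.\<close>
  define N :: "complex^'n^'n" where "N = (\<chi> i j. if i \<in> S then cnj (v i $ j) else 0)"
  have "row i0 N = 0" using i0 by (simp add: row_def N_def vec_eq_iff)
  then have "det N = 0" by (rule det_zero_row)
  then have "\<not> invertible N" by (simp add: invertible_det_nz)
  then obtain x0 where x0: "N *v x0 = 0" "x0 \<noteq> 0"
    using matrix_left_invertible_ker invertible_left_inverse by blast
  have x0W: "x0 \<in> W"
  proof -
    have "(N *v x0) $ i = 0" for i using x0 by simp
    then have *: "(\<Sum>j\<in>UNIV. (if i \<in> S then cnj (v i $ j) else 0) * x0 $ j) = 0" for i
      by (simp add: N_def matrix_vector_mult_def)
    have "cin (v i) x0 = 0" if "i \<in> S" for i
      using *[of i] that by (simp add: cin_def)
    then show ?thesis by (simp add: W_def)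
  qed
  have W_scale: "x \<in> W \<Longrightarrow> r *\<^sub>R x \<in> W" for x and r :: real
    by (auto simp: W_def cin_def simp flip: scaleR_sum_right)
  have W_add: "x \<in> W \<Longrightarrow> y \<in> W \<Longrightarrow> x + y \<in> W" for x y
    by (auto simp: W_def cin_add_right)
  have W_cscale: "x \<in> W \<Longrightarrow> c *s x \<in> W" for x c
    by (auto simp: W_def cin_scale_right)
  have W_M: "M *v x \<in> W" if "x \<in> W" for x
  proof -
    have "cin (v i) (M *v x) = 0" if "i \<in> S" for i
    proof -
      have "cin (v i) (M *v x) = cin (M *v v i) x"
        using M by (metis cin_mult_right hermitian_mat_iff_adj)
      also have "\<dots> = cnj (cin x (complex_of_real (l i) *s v i))"
        by (simp add: ev that cin_cnj)
      also have "\<dots> = complex_of_real (l i) * cin (v i) x"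
        by (simp add: cin_scale_right cin_cnj)
      finally show ?thesis using \<open>x \<in> W\<close> that by (simp add: W_def)
    qed
    then show ?thesis by (simp add: W_def)
  qed
  have clW: "closed W"
  proof -
    have "W = (\<Inter>i\<in>S. {x. cin (v i) x = 0})" by (auto simp: W_def)
    moreover have "closed {x. cin (v i) x = 0}" for i
      unfolding cin_def by (intro closed_Collect_eq continuous_intros)
    ultimately show ?thesis by auto
  qed
  let ?K = "sphere 0 1 \<inter> W"
  have "compact ?K" using clW by (simp add: compact_Int_closed)
  moreover have "(1 / norm x0) *\<^sub>R x0 \<in> ?K" using x0 x0W W_scale by auto
  moreover have "continuous_on ?K (\<lambda>x. x \<bullet> (M *v x))"
    unfolding inner_vec_def matrix_vector_mult_def vec_lambda_beta by (intro continuous_intros)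
  ultimately obtain x where x: "x \<in> ?K" "\<And>y. y \<in> ?K \<Longrightarrow> y \<bullet> (M *v y) \<le> x \<bullet> (M *v x)"
    using continuous_attains_sup[of ?K "\<lambda>x. x \<bullet> (M *v x)"] by blast
  define a where "a = x \<bullet> (M *v x)"
  have nx: "norm x = 1" "x \<in> W" using x by auto
  then have xx: "x \<bullet> x = 1" by (simp add: norm_eq_1)
  have Mlin: "M *v (r *\<^sub>R y) = r *\<^sub>R (M *v y)" for r :: real and y
    by (simp add: vec_eq_iff matrix_vector_mult_def scaleR_sum_right)
  have q: "y \<bullet> (M *v y) \<le> a * (y \<bullet> y)" if "y \<in> W" for y
  proof (cases "y = 0")
    case False
    have "(1 / norm y) *\<^sub>R y \<in> ?K" using False that W_scale by auto
    from x(2)[OF this] have "(1/norm y) * ((1/norm y) * (y \<bullet> (M *v y))) \<le> a"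
      by (simp add: Mlin a_def)
    then show ?thesis using False
      by (simp add: field_simps power2_norm_eq_inner[symmetric] power2_eq_square)
  qed simp
  have key: "w \<bullet> (a *\<^sub>R x - M *v x) = 0" if w: "w \<in> W" for w
  proof (rule ccontr)
    define d where "d = w \<bullet> (a *\<^sub>R x - M *v x)"
    define e where "e = a * (w \<bullet> w) - w \<bullet> (M *v w)"
    assume "w \<bullet> (a *\<^sub>R x - M *v x) \<noteq> 0"
    then have d0: "d \<noteq> 0" by (simp add: d_def)
    \<comment> \<open>The maximality bound \<open>q\<close> at the perturbed vector
      \<open>x + t w\<close>. Holding for \<open>t\<close> of both signs, it forces the linear
      coefficient \<open>d\<close> to vanish.\<close>
    have ineq: "0 \<le> 2 * t * d + t\<^sup>2 * e" for t :: real
    proof -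
      have "x + t *\<^sub>R w \<in> W" using nx w W_add W_scale by blast
      from q[OF this]
      have "a + t * (x \<bullet> (M *v w)) + t * (w \<bullet> (M *v x)) + t\<^sup>2 * (w \<bullet> (M *v w))
        \<le> a * (1 + 2 * t * (x \<bullet> w) + t\<^sup>2 * (w \<bullet> w))"
        by (simp add: matrix_vector_right_distrib Mlin inner_add_left inner_add_right a_def
            algebra_simps power2_eq_square inner_commute xx)
      moreover have "x \<bullet> (M *v w) = w \<bullet> (M *v x)"
        using Re_cin_hermitian[OF M] by (simp add: inner_commute)
      ultimately show ?thesis
        by (simp add: d_def e_def inner_diff_right algebra_simps inner_commute)
    qed
    have e0: "e \<ge> 0" using q[OF w] by (simp add: e_def)
    \<comment> \<open>Close to the minimiser \<open>- d / e\<close> of the quadratic, but also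
      defined for \<open>e = 0\<close>.\<close>
    have "0 \<le> 2 * (- d / (e + 1)) * d + (- d / (e + 1))\<^sup>2 * e" by (rule ineq)
    also have "\<dots> = (d\<^sup>2 / (e+1)\<^sup>2) * (e - 2 * (e + 1))"
    proof -
      have "e + 1 \<noteq> 0" using e0 by simp
      then show ?thesis by (simp add: divide_simps power2_eq_square) (simp add: algebra_simps)
    qed
    also have "\<dots> < 0" using e0 d0 by (intro mult_pos_neg) auto
    finally show False by simp
  qed
  \<comment> \<open>Since \<open>W\<close> is invariant under \<open>M\<close>, the residual lies in
    \<open>W\<close> and is by \<open>key\<close> orthogonal to itself.\<close>
  have "a *\<^sub>R x - M *v x \<in> W"
    using W_add[OF W_scale[OF nx(2), of a] W_scale[OF W_M[OF nx(2)], of "-1"]] by simp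
  from key[OF this] have "M *v x = a *\<^sub>R x" by simp
  then have "M *v x = complex_of_real a *s x"
    by (simp add: vec_eq_iff) (simp add: scaleR_conv_of_real)
  then show ?thesis using nx by (auto simp: W_def)
qed

definition unitary_mat :: "complex^'n^'n \<Rightarrow> bool" where
  "unitary_mat U \<longleftrightarrow> adj U ** U = mat 1"

lemma unitary_mat_right: "unitary_mat U \<Longrightarrow> U ** adj U = mat 1"
  unfolding unitary_mat_def by (simp add: matrix_left_right_inverse)

definition spectral_decomp :: "complex^'n^'n \<Rightarrow> complex^'n^'n \<Rightarrow> ('n \<Rightarrow> real) \<Rightarrow> bool" where
  "spectral_decomp M U l \<longleftrightarrow> unitary_mat U \<and> M = U ** dg l ** adj U"

lemma hermitian_orthonormal_eigenvectors:
  fixes M :: "complex^'n^'n" and S :: "'n set"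
  assumes M: "hermitian_mat M"
  shows "\<exists>v l. (\<forall>i\<in>S. \<forall>j\<in>S. cin (v i) (v j) = (if i = j then 1 else 0)) \<and>
     (\<forall>i\<in>S. M *v v i = complex_of_real (l i) *s v i)"
proof -
  have "finite S" by simp
  then show ?thesis
  proof (induction S)
    case empty
    then show ?case by simp
  next
    case (insert i0 S)
    then obtain v l where v: "\<forall>i\<in>S. \<forall>j\<in>S. cin (v i) (v j) = (if i = j then 1 else 0)"
      "\<forall>i\<in>S. M *v v i = complex_of_real (l i) *s v i" by blast
    obtain x a where x: "norm x = 1" "\<forall>i\<in>S. cin (v i) x = 0" "M *v x = complex_of_real a *s x"
      using hermitian_eigenvector_extend[OF M, of S v l i0] v insert by blast
    have "\<forall>i\<in>S. cin x (v i) = 0" using x(2) by (metis cin_cnj complex_cnj_zero)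
    then show ?case using v x insert.hyps
      by (intro exI[of _ "v(i0 := x)"] exI[of _ "l(i0 := a)"]) (auto simp: cin_self[of x])
  qed
qed

theorem hermitian_spectral_decomp:
  fixes M :: "complex^'n^'n"
  assumes M: "hermitian_mat M"
  shows "\<exists>U l. spectral_decomp M U l"
proof -
  obtain v :: "'n \<Rightarrow> complex^'n" and l where v: "\<And>i j. cin (v i) (v j) = (if i = j then 1 else 0)"
    "\<And>i. M *v v i = complex_of_real (l i) *s v i"
    using hermitian_orthonormal_eigenvectors[OF M, of UNIV] by auto
  define U :: "complex^'n^'n" where "U = (\<chi> i j. v j $ i)"
  have U: "unitary_mat U"
    using v(1) by (auto simp: unitary_mat_def vec_eq_iff matrix_matrix_mult_def mat_def U_def cin_def)
  have "M ** U = U ** dg l"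
  proof -
    have "(M ** U) $ i $ j = (U ** dg l) $ i $ j" for i j
    proof -
      have "(M ** U) $ i $ j = (M *v v j) $ i"
        by (simp add: matrix_matrix_mult_def matrix_vector_mult_def U_def)
      also have "\<dots> = (U ** dg l) $ i $ j"
        by (simp add: v matrix_matrix_mult_def dg_nth U_def mult_delta_right)
      finally show ?thesis .
    qed
    then show ?thesis by (simp add: vec_eq_iff)
  qed
  then have "M ** U ** adj U = U ** dg l ** adj U" by simp
  then have "M = U ** dg l ** adj U"
    by (metis U unitary_mat_right matrix_mul_assoc matrix_mul_rid)
  then show ?thesis using U by (auto simp: spectral_decomp_def)
qed


section \<open>Shifts, determinant, exponential and trace through a spectral decomposition\<close>

lemma adj_mat_1 [simp]: "adj (mat 1) = mat 1"
  by (simp add: vec_eq_iff mat_def)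

lemma dg_mult_nth: "(dg l ** M) $ i $ j = complex_of_real (l i) * M $ i $ j"
  "(M ** dg l) $ i $ j = M $ i $ j * complex_of_real (l j)"
  by (simp_all add: matrix_matrix_mult_def dg_nth mult_delta_left mult_delta_right)

lemma spectral_decomp_dg: "spectral_decomp (dg k) (mat 1) k"
  by (simp add: spectral_decomp_def unitary_mat_def)

lemma dg_mult: "dg k ** dg l = dg (\<lambda>i. k i * l i)"
  by (simp add: vec_eq_iff dg_mult_nth dg_nth)

lemma dg_const: "dg (\<lambda>_. r) ** M = (M :: complex^'n^'n) ** dg (\<lambda>_. r)"
  by (simp add: vec_eq_iff dg_mult_nth)

lemma dg_add: "dg k + dg l = dg (\<lambda>i. k i + l i)"
  by (simp add: vec_eq_iff dg_nth)

lemma spectral_nth: "(U ** dg l ** adj U) $ i $ j = (\<Sum>m\<in>UNIV. U$i$m * complex_of_real (l m) * cnj (U$j$m))"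
  unfolding matrix_matrix_mult_def[of _ "adj U"] by (simp add: dg_mult_nth)

lemma spectral_decomp_shift:
  assumes "spectral_decomp M U l"
  shows "spectral_decomp (M + dg (\<lambda>_. r)) U (\<lambda>i. l i + r)"
proof -
  have U: "unitary_mat U" "M = U ** dg l ** adj U" using assms by (auto simp: spectral_decomp_def)
  have "dg (\<lambda>_. r) = U ** dg (\<lambda>_. r) ** adj U"
    by (metis U(1) dg_const matrix_mul_assoc matrix_mul_rid unitary_mat_right)
  then have "M + dg (\<lambda>_. r) = U ** dg l ** adj U + U ** dg (\<lambda>_. r) ** adj U" using U by simp
  also have "\<dots> = U ** dg (\<lambda>i. l i + r) ** adj U"
    by (simp add: vec_eq_iff spectral_nth distrib_left distrib_right sum.distrib)
  finally show ?thesis using U by (simp add: spectral_decomp_def)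
qed

lemma det_spectral_decomp:
  assumes "spectral_decomp M U l"
  shows "det M = (\<Prod>i\<in>UNIV. complex_of_real (l i))"
proof -
  have U: "unitary_mat U" "M = U ** dg l ** adj U" using assms by (auto simp: spectral_decomp_def)
  have "det (adj U) * det U = 1"
    using U(1) by (metis unitary_mat_def det_mul det_I)
  moreover have "det (dg l) = (\<Prod>i\<in>UNIV. complex_of_real (l i))"
    by (subst det_diagonal) (auto simp: dg_nth)
  ultimately show ?thesis
    by (simp add: U(2) det_mul algebra_simps)
qed

lemma mat_pow_spectral_decomp:
  assumes "spectral_decomp M U l"
  shows "mat_pow M k = U ** dg (\<lambda>i. l i ^ k) ** adj U"
proof (induction k)
  have U: "unitary_mat U" "M = U ** dg l ** adj U" using assms by (auto simp: spectral_decomp_def)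
  case 0
  have "dg (\<lambda>_. 1) = (mat 1 :: complex^'a^'a)" by (simp add: vec_eq_iff dg_nth mat_def)
  then show ?case using U(1) by (simp add: unitary_mat_right)
next
  have U: "adj U ** U = mat 1" "M = U ** dg l ** adj U"
    using assms by (auto simp: spectral_decomp_def unitary_mat_def)
  case (Suc k)
  have "mat_pow M (Suc k) = U ** dg l ** (adj U ** U) ** dg (\<lambda>i. l i ^ k) ** adj U"
    by (simp only: mat_pow.simps Suc) (simp only: U(2) matrix_mul_assoc)
  also have "\<dots> = U ** (dg l ** dg (\<lambda>i. l i ^ k)) ** adj U"
    by (simp only: U(1) matrix_mul_rid) (simp add: matrix_mul_assoc)
  finally show ?case by (simp add: dg_mult)
qed

lemma mat_exp_spectral_decomp:
  assumes "spectral_decomp M U l"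
  shows "mat_exp M = U ** dg (\<lambda>i. exp (l i)) ** adj U"
proof -
  have "(\<lambda>k. mat_pow M k $ i $ j / of_nat (fact k)) sums
        (\<Sum>m\<in>UNIV. U$i$m * complex_of_real (exp (l m)) * cnj (U$j$m))" for i j
  proof -
    have "(\<lambda>k. complex_of_real (l m ^ k / fact k)) sums complex_of_real (exp (l m))" for m
      unfolding sums_of_real_iff using exp_converges[of "l m"] by (simp add: divide_inverse mult.commute)
    then have "(\<lambda>k. \<Sum>m\<in>UNIV. U$i$m * complex_of_real (l m ^ k / fact k) * cnj (U$j$m)) sums
        (\<Sum>m\<in>UNIV. U$i$m * complex_of_real (exp (l m)) * cnj (U$j$m))"
      by (intro sums_sum sums_mult sums_mult2)
    moreover have "mat_pow M k $ i $ j / of_nat (fact k) =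
       (\<Sum>m\<in>UNIV. U$i$m * complex_of_real (l m ^ k / fact k) * cnj (U$j$m))" for k
      unfolding mat_pow_spectral_decomp[OF assms] spectral_nth by (simp add: sum_divide_distrib)
    ultimately show ?thesis by simp
  qed
  then show ?thesis unfolding mat_exp_def vec_eq_iff spectral_nth by (simp add: sums_iff)
qed

lemma mat_trace_mult: "mat_trace (M ** N) = mat_trace (N ** M)"
  unfolding mat_trace_def matrix_matrix_mult_def by (simp add: mult.commute) (rule sum.swap)

lemma mat_trace_spectral:
  assumes "unitary_mat U" shows "mat_trace (U ** dg l ** adj U) = complex_of_real (\<Sum>i\<in>UNIV. l i)"
proof -
  have "mat_trace (U ** dg l ** adj U) = mat_trace (dg l)"
    using assms unfolding unitary_mat_def by (metis mat_trace_mult matrix_mul_assoc matrix_mul_lid)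
  then show ?thesis by (simp add: mat_trace_def dg_nth)
qed

lemma mat_trace_exp_spectral_decomp:
  assumes "spectral_decomp M U l"
  shows "mat_trace (mat_exp M) = complex_of_real (\<Sum>i\<in>UNIV. exp (l i))"
  unfolding mat_exp_spectral_decomp[OF assms]
  using assms mat_trace_spectral unfolding spectral_decomp_def by blast

lemma norm_mat_sq: "(norm (M :: complex^'n^'m))\<^sup>2 = (\<Sum>i\<in>UNIV. \<Sum>j\<in>UNIV. (cmod (M$i$j))\<^sup>2)"
  by (simp add: norm_vec_def L2_set_def sum_nonneg real_sqrt_pow2)

lemma mat_trace_adj_mult: "mat_trace (adj M ** M) = complex_of_real ((norm M)\<^sup>2)"
proof -
  have "mat_trace (adj M ** M) = (\<Sum>j\<in>UNIV. \<Sum>i\<in>UNIV. complex_of_real ((cmod (M$i$j))\<^sup>2))"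
    by (simp add: mat_trace_def matrix_matrix_mult_def complex_norm_square mult.commute del: of_real_power)
  then show ?thesis by (subst (asm) sum.swap) (simp add: norm_mat_sq)
qed

lemma norm_adj: "norm (adj M) = norm M"
proof -
  have "(norm (adj M))\<^sup>2 = (norm M)\<^sup>2"
    unfolding norm_mat_sq by (subst sum.swap) simp
  then show ?thesis by simp
qed

lemma norm_unitary_mult:
  assumes "unitary_mat U" shows "norm (U ** M) = norm M" "norm (M ** U) = norm M"
proof -
  have *: "norm (U ** M) = norm M" if "adj U ** U = mat 1" for U M :: "complex^'a^'a"
  proof -
    have "complex_of_real ((norm (U ** M))\<^sup>2) = mat_trace (adj M ** (adj U ** U) ** M)"
      by (simp only: mat_trace_adj_mult[symmetric] adj_mult matrix_mul_assoc)
    also have "\<dots> = complex_of_real ((norm M)\<^sup>2)" by (simp add: that mat_trace_adj_mult)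
    finally have "(norm (U ** M))\<^sup>2 = (norm M)\<^sup>2" using of_real_eq_iff by blast
    then show ?thesis by simp
  qed
  show "norm (U ** M) = norm M" using assms * by (simp add: unitary_mat_def)
  have "norm (M ** U) = norm (adj U ** adj M)" by (simp add: norm_adj flip: adj_mult)
  also have "\<dots> = norm M" using * [of "adj U"] assms unitary_mat_right norm_adj by (metis adj_adj)
  finally show "norm (M ** U) = norm M" .
qed

text \<open>Squared overlaps of two orthonormal eigenbases: a doubly stochastic matrix that transports one
  spectrum to the other at quadratic cost the squared Frobenius distance.\<close>

definition overlap :: "complex^'n^'n \<Rightarrow> complex^'n^'n \<Rightarrow> 'n \<Rightarrow> 'n \<Rightarrow> real" where
  "overlap U V i j = (cmod ((adj U ** V) $ i $ j))\<^sup>2"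

lemma overlap_nonneg [simp]: "overlap U V i j \<ge> 0"
  by (simp add: overlap_def)

lemma overlap_sum_right:
  assumes "unitary_mat U" "unitary_mat V"
  shows "(\<Sum>j\<in>UNIV. overlap U V i j) = 1"
proof -
  define W where "W = adj U ** V"
  have "W ** adj W = adj U ** (V ** adj V) ** U" by (simp add: W_def adj_mult matrix_mul_assoc)
  also have "\<dots> = mat 1" using assms by (simp add: unitary_mat_right[of V] unitary_mat_def)
  finally have "(W ** adj W) $ i $ i = 1" by (simp add: mat_def)
  then have "complex_of_real (\<Sum>j\<in>UNIV. (cmod (W $ i $ j))\<^sup>2) = 1"
    by (simp add: matrix_matrix_mult_def complex_norm_square del: of_real_power)
  then show ?thesis unfolding overlap_def W_def by (metis of_real_eq_1_iff)
qed

lemma overlap_commute: "overlap U V i j = overlap V U j i"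
proof -
  have "(adj U ** V) $ i $ j = cnj ((adj V ** U) $ j $ i)"
    by (metis adj_adj adj_mult adj_nth)
  then show ?thesis by (simp add: overlap_def)
qed

lemma overlap_sum_left:
  assumes "unitary_mat U" "unitary_mat V"
  shows "(\<Sum>i\<in>UNIV. overlap U V i j) = 1"
  using overlap_sum_right[OF assms(2,1), of j] by (simp add: overlap_commute[of U V])

text \<open>Written in the two eigenbases, \<open>M - N\<close> has entries
  \<open>(l i - k j)\<close> times those of \<open>adj U ** V\<close>, and the Frobenius norm is
  unitarily invariant.\<close>

lemma overlap_cost:
  assumes "spectral_decomp M U l" "spectral_decomp N V k"
  shows "(\<Sum>i\<in>UNIV. \<Sum>j\<in>UNIV. overlap U V i j * (l i - k j)\<^sup>2) = (norm (M - N))\<^sup>2"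
proof -
  have U: "unitary_mat U" "M = U ** dg l ** adj U" and V: "unitary_mat V" "N = V ** dg k ** adj V"
    using assms by (auto simp: spectral_decomp_def)
  define W where "W = adj U ** V"
  have aU: "unitary_mat (adj U)" using U(1) by (simp add: unitary_mat_def unitary_mat_right)
  have 1: "adj U ** M ** V = dg l ** W"
    using U by (simp add: W_def matrix_mul_assoc unitary_mat_def)
  have 2: "adj U ** N ** V = W ** dg k"
    using V unfolding W_def unitary_mat_def by (metis matrix_mul_assoc matrix_mul_rid)
  have "norm (M - N) = norm (adj U ** (M - N) ** V)"
    using norm_unitary_mult[OF aU] norm_unitary_mult[OF V(1)] by simp
  also have "adj U ** (M - N) ** V = dg l ** W - W ** dg k"
    unfolding 1[symmetric] 2[symmetric]
    by (simp add: vec_eq_iff matrix_matrix_mult_def right_diff_distrib left_diff_distrib sum_subtractf)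
  finally have "(norm (M - N))\<^sup>2 = (\<Sum>i\<in>UNIV. \<Sum>j\<in>UNIV. (cmod ((dg l ** W - W ** dg k) $ i $ j))\<^sup>2)"
    by (simp only: norm_mat_sq)
  moreover have "(dg l ** W - W ** dg k) $ i $ j = complex_of_real (l i - k j) * W $ i $ j" for i j
    by (simp add: dg_mult_nth algebra_simps)
  ultimately show ?thesis
    by (simp only: norm_mult norm_of_real overlap_def W_def power_mult_distrib power2_abs mult.commute)
qed

text \<open>Against the standard basis the overlaps exhibit each diagonal entry as a weighted mean
  of the eigenvalues. This barycentre property later cancels first-order terms and yields a
  convexity inequality.\<close>

lemma overlap_diag:
  assumes "spectral_decomp M U l"
  shows "(\<Sum>i\<in>UNIV. overlap U (mat 1) i j * l i) = Re (M $ j $ j)"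
proof -
  have "M $ j $ j = (\<Sum>m\<in>UNIV. U$j$m * complex_of_real (l m) * cnj (U$j$m))"
    using assms spectral_nth[of U l j j] by (simp add: spectral_decomp_def)
  also have "\<dots> = complex_of_real (\<Sum>m\<in>UNIV. (cmod (U$j$m))\<^sup>2 * l m)"
    unfolding of_real_sum of_real_mult complex_norm_square by (simp add: mult.commute mult.left_commute)
  finally show ?thesis by (simp add: overlap_def)
qed

lemma norm_unitary_vec:
  assumes "unitary_mat U" shows "norm (U *v x) = norm x"
proof -
  have "complex_of_real ((norm (U *v x))\<^sup>2) = cin (U *v x) (U *v x)" by (simp add: cin_self)
  also have "\<dots> = cin (adj U *v (U *v x)) x" by (metis adj_adj cin_cnj cin_mult_right)
  also have "\<dots> = complex_of_real ((norm x)\<^sup>2)"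
    using assms by (simp add: matrix_vector_mul_assoc unitary_mat_def cin_self)
  finally have "(norm (U *v x))\<^sup>2 = (norm x)\<^sup>2" using of_real_eq_iff by blast
  then show ?thesis by simp
qed

text \<open>In the eigenbasis \<open>M - r\<close> multiplies coordinate \<open>j\<close> by
  \<open>l j - r\<close>, so the smallest of these factors bounds the residual from below. It
  converts approximate eigenvectors into nearby eigenvalues.\<close>

lemma spectral_residual:
  fixes M :: "complex^'n^'n"
  assumes "spectral_decomp M U l"
  shows "\<exists>i. \<bar>l i - r\<bar> * norm v \<le> norm (M *v v - complex_of_real r *s v)"
proof -
  have U: "unitary_mat U" using assms by (auto simp: spectral_decomp_def)
  have aU: "unitary_mat (adj U)" using U(1) by (simp add: unitary_mat_def unitary_mat_right)
  define y where "y = adj U *v v"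
  have ny: "norm y = norm v" using norm_unitary_vec[OF aU] by (simp add: y_def)
  have "M *v v - complex_of_real r *s v = (M + dg (\<lambda>_. - r)) *v v"
    by (simp add: vec_eq_iff matrix_vector_mult_def dg_nth distrib_right sum.distrib mult_delta_left)
  also have "\<dots> = U *v (dg (\<lambda>i. l i + - r) *v y)"
    using spectral_decomp_shift[OF assms, of "-r"] unfolding y_def spectral_decomp_def
    by (simp add: matrix_vector_mul_assoc matrix_mul_assoc)
  finally have *: "norm (M *v v - complex_of_real r *s v) = norm (dg (\<lambda>i. l i + - r) *v y)"
    using norm_unitary_vec[OF U] by simp
  have "Min (range (\<lambda>i. \<bar>l i - r\<bar>)) \<in> range (\<lambda>i. \<bar>l i - r\<bar>)"
    by (rule Min_in) auto
  then obtain i where i: "Min (range (\<lambda>i. \<bar>l i - r\<bar>)) = \<bar>l i - r\<bar>" by (rule rangeE)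
  have min: "\<bar>l i - r\<bar> \<le> \<bar>l j - r\<bar>" for j unfolding i[symmetric] by simp
  have "(\<bar>l i - r\<bar> * norm y)\<^sup>2 = (\<Sum>j\<in>UNIV. (\<bar>l i - r\<bar> * cmod (y $ j))\<^sup>2)"
    by (simp add: power_mult_distrib norm_vec_def L2_set_def sum_nonneg sum_distrib_left)
  also have "\<dots> \<le> (\<Sum>j\<in>UNIV. (\<bar>l j - r\<bar> * cmod (y $ j))\<^sup>2)"
    by (intro sum_mono power_mono mult_right_mono min) auto
  also have "\<dots> = (norm (dg (\<lambda>i. l i + - r) *v y))\<^sup>2"
  proof -
    have "(dg (\<lambda>i. l i + - r) *v y) $ j = complex_of_real (l j - r) * y $ j" for j
      by (simp add: matrix_vector_mult_def dg_nth mult_delta_left)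
    then show ?thesis
      by (simp only: norm_vec_def[of "dg _ *v y"] L2_set_def norm_mult norm_of_real real_sqrt_pow2 sum_nonneg zero_le_power2)
  qed
  finally have "\<bar>l i - r\<bar> * norm y \<le> norm (dg (\<lambda>i. l i + - r) *v y)"
    by (rule power2_le_imp_le) simp
  then show ?thesis using * ny by auto
qed

section \<open>Logarithmic integrals\<close>

text \<open>An antiderivative of \<open>ln \<bar>r\<bar>\<close> on either side of 0 that is
  continuous at 0, so that integrals across the singularity are plain differences.\<close>

definition xlnx :: "real \<Rightarrow> real" where "xlnx r = r * ln \<bar>r\<bar> - r"

lemma xlnx_minus: "xlnx (- r) = - xlnx r"
  by (simp add: xlnx_def)

lemma xlnx_deriv: "r \<noteq> 0 \<Longrightarrow> (xlnx has_real_derivative ln \<bar>r\<bar>) (at r)"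
proof -
  assume r: "r \<noteq> 0"
  have ln: "((\<lambda>r. ln \<bar>r\<bar>) has_real_derivative 1 / r) (at r)"
  proof (cases "r > 0")
    case True
    have "((\<lambda>r. ln r) has_real_derivative 1 / r) (at r)"
      using True by (auto intro!: derivative_eq_intros)
    moreover have "\<forall>\<^sub>F x in nhds r. ln \<bar>x\<bar> = ln x"
      using eventually_nhds_in_open[of "{0<..}" r] True by (auto elim!: eventually_mono)
    ultimately show ?thesis by (simp add: DERIV_cong_ev)
  next
    case False
    have "((\<lambda>r. ln (- r)) has_real_derivative 1 / r) (at r)"
      using False r by (auto intro!: derivative_eq_intros simp: field_simps)
    moreover have "\<forall>\<^sub>F x in nhds r. ln \<bar>x\<bar> = ln (-x)"
      using eventually_nhds_in_open[of "{..<0}" r] False r by (auto elim!: eventually_mono)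
    ultimately show ?thesis by (simp add: DERIV_cong_ev)
  qed
  show ?thesis unfolding xlnx_def
    by (rule derivative_eq_intros ln refl)+ (use r in \<open>simp add: field_simps\<close>)
qed

lemma continuous_xlnx: "continuous_on A xlnx"
proof -
  have "isCont xlnx r" for r
  proof (cases "r = 0")
    case True
    have "((\<lambda>r::real. r * ln \<bar>r\<bar> - r) \<longlongrightarrow> 0) (at_left 0)" by real_asymp
    moreover have "((\<lambda>r::real. r * ln \<bar>r\<bar> - r) \<longlongrightarrow> 0) (at_right 0)" by real_asymp
    ultimately have "((\<lambda>r::real. r * ln \<bar>r\<bar> - r) \<longlongrightarrow> 0) (at 0)"
      by (rule filterlim_split_at)
    then show ?thesis using True by (simp add: isCont_def xlnx_def[abs_def])
  next
    case False
    then show ?thesis using xlnx_deriv DERIV_isCont by blast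
  qed
  then show ?thesis by (simp add: continuous_at_imp_continuous_on)
qed

lemma continuous_xlnx_compose [continuous_intros]:
  "continuous_on A f \<Longrightarrow> continuous_on A (\<lambda>x. xlnx (f x))"
  using continuous_on_compose2[OF continuous_xlnx[of UNIV]] by auto

lemma ln_abs_has_integral:
  fixes a b r :: real assumes "a \<le> b"
  shows "((\<lambda>s. ln \<bar>s - r\<bar>) has_integral (xlnx (b - r) - xlnx (a - r))) {a..b}"
proof (rule fundamental_theorem_of_calculus_interior_strong[of "{r}"])
  show "continuous_on {a..b} (\<lambda>s. xlnx (s - r))" by (intro continuous_intros)
  fix x assume "x \<in> {a<..<b} - {r}"
  then have "(xlnx has_real_derivative ln \<bar>x - r\<bar>) (at (x - r))" by (intro xlnx_deriv) auto
  from DERIV_chain2[where f = xlnx and g = "\<lambda>s. s - r", OF this, of 1 UNIV]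
  have "((\<lambda>s. xlnx (s - r)) has_real_derivative ln \<bar>x - r\<bar>) (at x)"
    by (simp add: DERIV_diff[OF DERIV_ident DERIV_const, simplified])
  then show "((\<lambda>s. xlnx (s - r)) has_vector_derivative ln \<bar>x - r\<bar>) (at x)"
    by (simp add: has_real_derivative_iff_has_vector_derivative)
qed (use assms in auto)

lemma ln_abs_set_integrable:
  fixes a b r :: real
  shows "set_integrable lborel {a..b} (\<lambda>s. ln \<bar>s - r\<bar>)"
proof (cases "a \<le> b")
  case True
  define C where "C = \<bar>a\<bar> + \<bar>b\<bar> + \<bar>r\<bar>"
  have int: "(\<lambda>s. ln \<bar>s - r\<bar>) integrable_on {a..b}" using ln_abs_has_integral[OF True] by blast
  have C0: "C \<ge> 0" by (simp add: C_def)
  \<comment> \<open>The logarithm is bounded above by \<open>C\<close> on the interval; subtracting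
    it from \<open>C\<close> gives a nonnegative function, for which integrability is
    absolute.\<close>
  have "(\<lambda>s. C - ln \<bar>s - r\<bar>) absolutely_integrable_on {a..b}"
  proof (rule nonnegative_absolutely_integrable_1)
    show "(\<lambda>s. C - ln \<bar>s - r\<bar>) integrable_on {a..b}"
      using int by (intro integrable_diff) auto
    fix s assume s: "s \<in> {a..b}"
    have "ln \<bar>s - r\<bar> \<le> C"
    proof (cases "s = r")
      case False
      then have "ln \<bar>s - r\<bar> \<le> \<bar>s - r\<bar> - 1" by (intro ln_le_minus_one) auto
      also have "\<dots> \<le> C" using s by (auto simp: C_def)
      finally show ?thesis .
    qed (use C0 in simp)
    then show "0 \<le> C - ln \<bar>s - r\<bar>" by simp
  qed
  then have "(\<lambda>s. C - (C - ln \<bar>s - r\<bar>)) absolutely_integrable_on {a..b}"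
    using set_integral_diff(1)[OF absolutely_integrable_on_const[of "{a..b}" C]] by blast
  then have "set_integrable lebesgue {a..b} (\<lambda>s. ln \<bar>s - r\<bar>)" by simp
  then show ?thesis
    unfolding set_integrable_def by (subst (asm) integrable_completion) auto
qed simp

lemma ln_abs_set_integral:
  fixes a b r :: real assumes "a \<le> b"
  shows "(LINT s:{a..b}|lborel. ln \<bar>s - r\<bar>) = xlnx (b - r) - xlnx (a - r)"
  using set_borel_integral_eq_integral(2)[OF ln_abs_set_integrable[of a b r]] ln_abs_has_integral[OF assms, of r]
  by (simp add: integral_unique)

text \<open>The logarithmic potential at \<open>r\<close> of the interval \<open>{-1..1}\<close>, in
  closed form. It is even and attains its minimum \<open>- 2\<close> at 0.\<close>

definition lnavg :: "real \<Rightarrow> real" where "lnavg r = xlnx (1 - r) + xlnx (1 + r)"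

lemma lnavg_integral: "(LINT s:{-1..1}|lborel. ln \<bar>s - r\<bar>) = lnavg r"
  using xlnx_minus[of "1 + r"] by (simp add: ln_abs_set_integral lnavg_def)

lemma lnavg_minus [simp]: "lnavg (- r) = lnavg r" by (simp add: lnavg_def)
lemma lnavg_abs [simp]: "lnavg \<bar>r\<bar> = lnavg r" by (simp add: abs_if)
lemma lnavg_0 [simp]: "lnavg 0 = - 2" by (simp add: lnavg_def xlnx_def)

lemma continuous_lnavg [continuous_intros]: "continuous_on A f \<Longrightarrow> continuous_on A (\<lambda>x. lnavg (f x))"
  unfolding lnavg_def by (intro continuous_intros)

lemma lnavg_measurable [measurable]: "lnavg \<in> borel_measurable borel"
  by (intro borel_measurable_continuous_onI continuous_intros)

lemma lnavg_gt: assumes "r > 1" shows "lnavg r > - 2"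
proof -
  have "(r - 1) * ln (r - 1) \<le> (r - 1) * ln (r + 1)" using assms by (intro mult_left_mono) auto
  also have "\<dots> < (r + 1) * ln (r + 1)" using assms by (intro mult_strict_right_mono) auto
  finally have "(r - 1) * ln (r - 1) < (r + 1) * ln (r + 1)" .
  then show ?thesis using assms by (simp add: lnavg_def xlnx_def algebra_simps)
qed

lemma lnavg_ge: "lnavg r \<ge> - 2"
proof -
  have "lnavg r \<ge> - 2" if r: "0 \<le> r" for r
  proof -
    consider "r < 1" | "r = 1" | "r > 1" by linarith
    then show ?thesis
    proof cases
      case 1
      have *: "u * ln u \<ge> u - 1" if "u > 0" for u :: real
      proof -
        have "ln (1 / u) \<le> 1 / u - 1" using that by (intro ln_le_minus_one) auto
        then have "u * ln (1 / u) \<le> u * (1 / u - 1)" using that by (intro mult_left_mono) auto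
        then show ?thesis using that by (simp add: ln_div algebra_simps)
      qed
      from *[of "1 - r"] *[of "1 + r"] 1 r show ?thesis
        by (simp add: lnavg_def xlnx_def)
    next
      case 2
      then show ?thesis by (simp add: lnavg_def xlnx_def)
    next
      case 3
      then show ?thesis using lnavg_gt by (simp add: less_imp_le)
    qed
  qed
  from this[of "\<bar>r\<bar>"] show ?thesis by simp
qed

text \<open>If \<open>u \<le> L\<close> and \<open>L \<ge> 0\<close>, then
  \<open>\<bar>u\<bar> \<le> 2 * L - u\<close>. With \<open>L = ln (2 + \<bar>r\<bar>)\<close> this
  reduces the absolute integral to the signed one, which is at least \<open>- 2\<close>.\<close>

lemma ln_abs_L1_bound:
  fixes r :: real
  shows "(LINT s:{-1..1}|lborel. \<bar>ln \<bar>s - r\<bar>\<bar>) \<le> 2 + 4 * ln (2 + \<bar>r\<bar>)"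
proof -
  let ?L = "ln (2 + \<bar>r\<bar>)"
  have i1: "set_integrable lborel {-1..1} (\<lambda>s. \<bar>ln \<bar>s - r\<bar>\<bar>)"
    using set_integrable_abs[OF ln_abs_set_integrable] .
  have i2: "set_integrable lborel {-1..1} (\<lambda>s. 2 * ?L - ln \<bar>s - r\<bar>)"
    using ln_abs_set_integrable by (intro set_integral_diff) (auto simp: set_integrable_def)
  have "(LINT s:{-1..1}|lborel. \<bar>ln \<bar>s - r\<bar>\<bar>) \<le> (LINT s:{-1..1}|lborel. 2 * ?L - ln \<bar>s - r\<bar>)"
  proof (rule set_integral_mono[OF i1 i2])
    fix s :: real assume s: "s \<in> {-1..1}"
    have L0: "?L \<ge> 0" by simp
    have "ln \<bar>s - r\<bar> \<le> ?L"
    proof (cases "s = r")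
      case False
      then show ?thesis using s by (subst ln_le_cancel_iff) auto
    qed (use L0 in simp)
    then show "\<bar>ln \<bar>s - r\<bar>\<bar> \<le> 2 * ?L - ln \<bar>s - r\<bar>" using L0 by linarith
  qed
  also have "\<dots> = (LINT s:{-1..1::real}|lborel. 2 * ?L) - lnavg r"
    by (subst set_integral_diff(2)[OF _ ln_abs_set_integrable]) (auto simp: lnavg_integral set_integrable_def)
  also have "(LINT s:{-1..1::real}|lborel. 2 * ?L) = 4 * ?L"
    by (simp add: set_lebesgue_integral_def)
  finally show ?thesis using lnavg_ge[of r] by simp
qed

lemma abs_lnavg_le: "\<bar>lnavg r\<bar> \<le> 2 + 4 * ln (2 + \<bar>r\<bar>)"
proof -
  have "\<bar>LINT s:{-1..1}|lborel. ln \<bar>s - r\<bar>\<bar> \<le> (LINT s:{-1..1}|lborel. \<bar>ln \<bar>s - r\<bar>\<bar>)"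
    using set_integral_norm_bound[OF ln_abs_set_integrable[of "-1" 1 r]] by simp
  then show ?thesis using ln_abs_L1_bound[of r] by (simp add: lnavg_integral)
qed

text \<open>A crude trade of logarithmic growth for a square root, which becomes the exponent
  \<open>-1/2\<close> of \<open>tailweight\<close> when \<open>x\<close> is of order
  \<open>1 / \<bar>y\<bar>\<close>.\<close>

lemma ln_le_sqrt:
  fixes x :: real assumes "x \<ge> 0" shows "2 + 4 * ln (2 + x) \<le> 10 * (1 + sqrt x)"
proof -
  have "(1 + x) \<le> (1 + sqrt x)\<^sup>2" using assms by (simp add: power2_eq_square algebra_simps)
  then have "ln (1 + x) \<le> ln ((1 + sqrt x)\<^sup>2)" using assms by (subst ln_le_cancel_iff) (auto intro: add_pos_nonneg zero_less_power)
  also have "\<dots> = 2 * ln (1 + sqrt x)" using assms by (subst ln_realpow) (auto intro: add_pos_nonneg)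
  also have "\<dots> \<le> 2 * sqrt x" using ln_add_one_self_le_self[of "sqrt x"] assms by simp
  finally have 1: "ln (1 + x) \<le> 2 * sqrt x" .
  have "ln (2 + x) \<le> ln (2 * (1 + x))" using assms by (subst ln_le_cancel_iff) auto
  also have "\<dots> = ln 2 + ln (1 + x)" using assms by (subst ln_mult) auto
  also have "\<dots> \<le> 1 + 2 * sqrt x" using 1 ln_le_minus_one[of 2] by simp
  finally have "ln (2 + x) \<le> 1 + 2 * sqrt x" .
  moreover have "sqrt x \<ge> 0" using assms by simp
  ultimately show ?thesis unfolding distrib_left by linarith
qed

text \<open>The integrand changes sign only at the midpoint \<open>m\<close>, so the integral is an
  explicit combination of \<open>xlnx\<close> values whose main term is of order
  \<open>d * ln (1 / d)\<close>. The exponent \<open>3/4\<close> absorbs the logarithm and is still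
  large enough to turn a distance of order \<open>1 / y\<^sup>2\<close> into the integrable
  \<open>\<bar>y\<bar> powr (-3/2)\<close>.\<close>

lemma ln_abs_diff_L1_bound_aux:
  fixes r q :: real
  assumes "r \<le> q" "\<bar>r\<bar> \<le> 1/2" "\<bar>q\<bar> \<le> 1/2"
  shows "(LINT s:{-1..1}|lborel. \<bar>ln \<bar>s - r\<bar> - ln \<bar>s - q\<bar>\<bar>) \<le> 20 * \<bar>r - q\<bar> powr (3/4)"
proof (cases "r = q")
  case True
  then show ?thesis by simp
next
  case False
  define d where "d = q - r"
  have d: "0 < d" "d \<le> 1" using assms False by (auto simp: d_def)
  define m where "m = (r + q) / 2"
  have m: "-1 \<le> m" "m \<le> 1" using assms by (auto simp: m_def)
  let ?f = "\<lambda>s. ln \<bar>s - r\<bar> - ln \<bar>s - q\<bar>"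
  have f: "set_integrable lborel {a..b} ?f" for a b
    by (intro set_integral_diff ln_abs_set_integrable)
  have af: "set_integrable lborel {a..b} (\<lambda>s. \<bar>?f s\<bar>)" for a b
    using set_integrable_abs[OF f] .
  have fi: "(LINT s:{a..b}|lborel. ?f s) = (xlnx (b - r) - xlnx (a - r)) - (xlnx (b - q) - xlnx (a - q))" if "a \<le> b" for a b
    using that by (subst set_integral_diff) (auto simp: ln_abs_set_integrable ln_abs_set_integral)
  have AEne: "AE s in lborel. s \<noteq> r \<and> s \<noteq> q \<and> s \<noteq> m"
    using AE_lborel_singleton[of r] AE_lborel_singleton[of q] AE_lborel_singleton[of m] by eventually_elim simp
  have "{-1..1} = {-1..m} \<union> {m..1}" using m by auto
  moreover have "(LINT s:{-1..m}\<union>{m..1}|lborel. \<bar>?f s\<bar>) = (LINT s:{-1..m}|lborel. \<bar>?f s\<bar>) + (LINT s:{m..1}|lborel. \<bar>?f s\<bar>)"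
  proof (rule set_integral_Un_AE)
    show "AE x in lborel. \<not> (x \<in> {-1..m} \<and> x \<in> {m..1})"
      using AEne by eventually_elim auto
  qed (auto simp: af)
  moreover have "(LINT s:{-1..m}|lborel. \<bar>?f s\<bar>) = (LINT s:{-1..m}|lborel. - ?f s)"
  proof (rule set_lebesgue_integral_cong_AE)
    show "AE x\<in>{-1..m} in lborel. \<bar>?f x\<bar> = - ?f x" using AEne
    proof eventually_elim
      case (elim s)
      have "s \<in> {-1..m} \<Longrightarrow> ln \<bar>s - r\<bar> \<le> ln \<bar>s - q\<bar>"
        using elim assms by (subst ln_le_cancel_iff) (auto simp: m_def abs_if field_simps)
      then show ?case by auto
    qed
  qed auto
  moreover have "(LINT s:{-1..m}|lborel. - ?f s) = - (LINT s:{-1..m}|lborel. ?f s)"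
    by (rule set_integral_uminus[OF f])
  moreover have "(LINT s:{m..1}|lborel. \<bar>?f s\<bar>) = (LINT s:{m..1}|lborel. ?f s)"
  proof (rule set_lebesgue_integral_cong_AE)
    show "AE x\<in>{m..1} in lborel. \<bar>?f x\<bar> = ?f x" using AEne
    proof eventually_elim
      case (elim s)
      have "s \<in> {m..1} \<Longrightarrow> ln \<bar>s - q\<bar> \<le> ln \<bar>s - r\<bar>"
        using elim assms by (subst ln_le_cancel_iff) (auto simp: m_def abs_if field_simps)
      then show ?case by auto
    qed
  qed auto
  ultimately have "(LINT s:{-1..1}|lborel. \<bar>?f s\<bar>) =
     (xlnx (1 - r) - xlnx (m - r) - (xlnx (1 - q) - xlnx (m - q))) -
     (xlnx (m - r) - xlnx (-1 - r) - (xlnx (m - q) - xlnx (-1 - q)))"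
    using fi[OF m(1)] fi[OF m(2)] by simp
  also have "m - r = d / 2" by (simp add: m_def d_def field_simps)
  also have "m - q = - (d / 2)" by (simp add: m_def d_def field_simps)
  also have "- 1 - r = - (1 + r)" by simp
  also have "- 1 - q = - (1 + q)" by simp
  finally have eq: "(LINT s:{-1..1}|lborel. \<bar>?f s\<bar>) =
     - 4 * xlnx (d / 2) + (xlnx (1 - r) - xlnx (1 - q)) + (xlnx (1 + q) - xlnx (1 + r))"
    by (simp only: xlnx_minus)
  have lip: "xlnx y - xlnx x \<le> d" if "1/2 \<le> x" "x \<le> y" "y \<le> 3/2" "y - x = d" for x y
  proof -
    have "\<exists>z. x < z \<and> z < y \<and> xlnx y - xlnx x = (y - x) * ln \<bar>z\<bar>"
      using that d by (intro MVT2 xlnx_deriv) auto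
    then obtain z where z: "x < z" "z < y" "xlnx y - xlnx x = (y - x) * ln \<bar>z\<bar>" by blast
    have "ln \<bar>z\<bar> \<le> 1" using ln_le_minus_one[of z] z that by auto
    then show ?thesis using z that d mult_left_mono[of "ln \<bar>z\<bar>" 1 d] by simp
  qed
  have "xlnx (1 - r) - xlnx (1 - q) \<le> d" using assms by (intro lip) (auto simp: d_def abs_le_iff)
  moreover have "xlnx (1 + q) - xlnx (1 + r) \<le> d" using assms by (intro lip) (auto simp: d_def abs_le_iff)
  moreover have "- 4 * xlnx (d / 2) \<le> 2 * d + 16 * d powr (3/4)"
  proof -
    have "- ln d = 4 * ln (d powr (-1/4))" using d by (simp add: ln_powr)
    also have "\<dots> \<le> 4 * d powr (-1/4)" using ln_bound[of "d powr (-1/4)"] d by simp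
    finally have "- ln d \<le> 4 * d powr (-1/4)" .
    moreover have "d powr (-1/4) \<ge> 1"
      using powr_mono2'[of "-(1/4)" d 1] d by simp
    moreover have "ln 2 \<le> (1::real)" using ln_le_minus_one[of 2] by simp
    ultimately have "- ln (d / 2) \<le> 8 * d powr (-1/4)" using d by (simp add: ln_div)
    then have "d * (- ln (d / 2)) \<le> d * (8 * d powr (-1/4))" using d by (intro mult_left_mono) auto
    also have "\<dots> = 8 * (d powr 1 * d powr (-1/4))" using d by simp
    also have "\<dots> = 8 * d powr (3/4)" by (simp only: powr_add[symmetric]) simp
    finally show ?thesis using d by (simp add: xlnx_def algebra_simps)
  qed
  moreover have "d \<le> d powr (3/4)" using powr_mono'[of "3/4" 1 d] d by simp
  ultimately have "(LINT s:{-1..1}|lborel. \<bar>?f s\<bar>) \<le> 20 * d powr (3/4)" using eq by linarith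
  moreover have "\<bar>r - q\<bar> = d" using d by (simp add: d_def)
  ultimately show ?thesis by simp
qed

lemma ln_abs_diff_L1_bound:
  fixes r q :: real
  assumes "\<bar>r\<bar> \<le> 1/2" "\<bar>q\<bar> \<le> 1/2"
  shows "(LINT s:{-1..1}|lborel. \<bar>ln \<bar>s - r\<bar> - ln \<bar>s - q\<bar>\<bar>) \<le> 20 * \<bar>r - q\<bar> powr (3/4)"
proof (cases "r \<le> q")
  case False
  then show ?thesis using ln_abs_diff_L1_bound_aux[of q r] assms
    by (simp add: abs_minus_commute[of r q] abs_minus_commute[of "ln \<bar>_ - r\<bar>"])
qed (use ln_abs_diff_L1_bound_aux assms in auto)

text \<open>The second derivative \<open>1 / (1 + z) + 1 / (1 - z)\<close> is at most 4 for
  \<open>\<bar>z\<bar> \<le> 1/2\<close>. The linear term stays explicit because it is the one that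
  cancels on averaging over overlaps.\<close>

lemma lnavg_taylor:
  fixes x y :: real
  assumes "\<bar>x\<bar> \<le> 1/2" "\<bar>y\<bar> \<le> 1/2"
  shows "\<bar>lnavg x - lnavg y - (ln (1 + y) - ln (1 - y)) * (x - y)\<bar> \<le> 4 * (x - y)\<^sup>2"
proof -
  define D where "D = (\<lambda>y::real. ln (1 + y) - ln (1 - y))"
  have der: "(lnavg has_real_derivative D z) (at z)" if "\<bar>z\<bar> \<le> 1/2" for z
  proof -
    have "(xlnx has_real_derivative ln (1 - z)) (at (1 - z))" "(xlnx has_real_derivative ln (1 + z)) (at (1 + z))"
      using xlnx_deriv[of "1 - z"] xlnx_deriv[of "1 + z"] that by auto
    note d = DERIV_chain2[where f = xlnx and g = "\<lambda>z. 1 - z", OF this(1), of "-1"]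
      DERIV_chain2[where f = xlnx and g = "\<lambda>z. 1 + z", OF this(2), of 1]
    have "((\<lambda>z. xlnx (1 - z) + xlnx (1 + z)) has_real_derivative ln (1 - z) * (- 1) + ln (1 + z) * 1) (at z)"
      by (intro DERIV_add d) (auto intro!: derivative_eq_intros)
    then show ?thesis by (simp add: lnavg_def[abs_def] D_def)
  qed
  have derD: "(D has_real_derivative (1 / (1 + z) + 1 / (1 - z))) (at z)" if "\<bar>z\<bar> \<le> 1/2" for z
    unfolding D_def using that by (auto intro!: derivative_eq_intros)
  have lipD: "\<bar>D u - D v\<bar> \<le> 4 * \<bar>u - v\<bar>" if "u < v" "\<bar>u\<bar> \<le> 1/2" "\<bar>v\<bar> \<le> 1/2" for u v
  proof -
    have "\<exists>z. u < z \<and> z < v \<and> D v - D u = (v - u) * (1 / (1 + z) + 1 / (1 - z))"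
      using that by (intro MVT2 derD) (auto simp: abs_le_iff)
    then obtain z where z: "u < z" "z < v" "D v - D u = (v - u) * (1 / (1 + z) + 1 / (1 - z))" by blast
    have z2: "\<bar>z\<bar> \<le> 1/2" using z that by (auto simp: abs_le_iff)
    have "1 / (1 + z) \<le> 2" "1 / (1 - z) \<le> 2" using z2 by (auto simp: field_simps abs_le_iff)
    moreover have "1 / (1 + z) \<ge> 0" "1 / (1 - z) \<ge> 0" using z2 by auto
    ultimately have "\<bar>1 / (1 + z) + 1 / (1 - z)\<bar> \<le> 4" by linarith
    then have "\<bar>D v - D u\<bar> \<le> \<bar>v - u\<bar> * 4" unfolding z(3) abs_mult by (intro mult_left_mono) auto
    then show ?thesis by (simp add: abs_minus_commute)
  qed
  have lipD': "\<bar>D u - D v\<bar> \<le> 4 * \<bar>u - v\<bar>" if "\<bar>u\<bar> \<le> 1/2" "\<bar>v\<bar> \<le> 1/2" for u v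
    using that lipD[of u v] lipD[of v u] by (cases u v rule: linorder_cases) (auto simp: abs_minus_commute)
  have step: "\<exists>z. \<bar>z\<bar> \<le> 1/2 \<and> \<bar>z - y\<bar> \<le> \<bar>x - y\<bar> \<and> lnavg x - lnavg y = (x - y) * D z"
  proof (cases x y rule: linorder_cases)
    case less
    have "\<exists>z. x < z \<and> z < y \<and> lnavg y - lnavg x = (y - x) * D z"
      using less assms by (intro MVT2 der) (auto simp: abs_le_iff)
    then obtain z where "x < z" "z < y" "lnavg y - lnavg x = (y - x) * D z" by blast
    then show ?thesis using assms by (intro exI[of _ z]) (auto simp: abs_le_iff algebra_simps)
  next
    case equal
    then show ?thesis using assms by auto
  next
    case greater
    have "\<exists>z. y < z \<and> z < x \<and> lnavg x - lnavg y = (x - y) * D z"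
      using greater assms by (intro MVT2 der) (auto simp: abs_le_iff)
    then obtain z where "y < z" "z < x" "lnavg x - lnavg y = (x - y) * D z" by blast
    then show ?thesis using assms by (intro exI[of _ z]) (auto simp: abs_le_iff algebra_simps)
  qed
  then obtain z where z: "\<bar>z\<bar> \<le> 1/2" "\<bar>z - y\<bar> \<le> \<bar>x - y\<bar>" "lnavg x - lnavg y = (x - y) * D z" by blast
  have "lnavg x - lnavg y - D y * (x - y) = (D z - D y) * (x - y)" using z by (simp add: algebra_simps)
  then have "\<bar>lnavg x - lnavg y - D y * (x - y)\<bar> \<le> (4 * \<bar>x - y\<bar>) * \<bar>x - y\<bar>"
    using lipD'[OF z(1) assms(2)] z(2) by (simp add: abs_mult mult_right_mono)
  then show ?thesis by (simp add: D_def power2_eq_square abs_mult_self_eq mult.assoc)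
qed

text \<open>A common integrable majorant in the pencil parameter: the first branch dominates the
  logarithmic growth at 0, where the eigenvalues of \<open>A/y + e\<close> may blow up, and the
  second is the decay \<open>(1 / y\<^sup>2) powr (3/4)\<close> at infinity.\<close>

definition tailweight :: "real \<Rightarrow> real" where
  "tailweight y = (if \<bar>y\<bar> \<le> 1 then \<bar>y\<bar> powr (-1/2) else \<bar>y\<bar> powr (-3/2))"

lemma tailweight_nonneg [simp]: "tailweight y \<ge> 0"
  by (simp add: tailweight_def)

lemma tailweight_measurable [measurable]: "tailweight \<in> borel_measurable borel"
  unfolding tailweight_def[abs_def] by measurable

lemma set_integrable_lborelI:
  fixes f :: "real \<Rightarrow> real"
  assumes "f integrable_on S" "\<And>x. x \<in> S \<Longrightarrow> 0 \<le> f x" "f \<in> borel_measurable borel" "S \<in> sets borel"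
  shows "set_integrable lborel S f"
proof -
  have "set_integrable lebesgue S f" using nonnegative_absolutely_integrable_1[OF assms(1,2)] by simp
  moreover have "(\<lambda>x. indicat_real S x *\<^sub>R f x) \<in> borel_measurable lborel" using assms(3,4) by measurable
  ultimately show ?thesis
    unfolding set_integrable_def by (subst (asm) integrable_completion) auto
qed

lemma tailweight_integrable: "integrable lborel tailweight"
proof -
  have p1: "set_integrable lborel {0..1} (\<lambda>y::real. y powr (-1/2))"
    using has_integral_powr_from_0[of "-1/2" 1] by (intro set_integrable_lborelI) auto
  have p2: "set_integrable lborel {1..} (\<lambda>y::real. y powr (-3/2))"
    using has_integral_powr_to_inf[of "-3/2" 1] by (intro set_integrable_lborelI) auto
  have i1: "integrable lborel (\<lambda>y. indicator {0..1} y * (y powr (-1/2)) + indicator {1..} y * (y powr (-3/2)) :: real)"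
    using p1 p2 by (intro Bochner_Integration.integrable_add) (auto simp: set_integrable_def)
  have i2: "integrable lborel (\<lambda>y. indicator {0..1} (-y) * ((-y) powr (-1/2)) + indicator {1..} (-y) * ((-y) powr (-3/2)) :: real)"
    using lborel_integrable_real_affine[OF i1, of "-1" 0] by simp
  show ?thesis
    by (rule Bochner_Integration.integrable_bound[OF Bochner_Integration.integrable_add[OF i1 i2]])
       (auto simp: tailweight_def indicator_def abs_if)
qed

text \<open>Glues an estimate near 0 to one that holds from \<open>Y\<close> on. The factor
  \<open>Y\<^sup>2\<close> pays for the range \<open>1 < \<bar>y\<bar> \<le> Y\<close>, where
  \<open>\<bar>y\<bar> powr (3/2) \<le> Y\<^sup>2\<close>.\<close>

lemma le_tailweight:
  assumes "Y \<ge> 1"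
    and "\<bar>y\<bar> \<le> Y \<Longrightarrow> f \<le> C * (1 + 1 / sqrt \<bar>y\<bar>)"
    and "\<bar>y\<bar> \<ge> Y \<Longrightarrow> f \<le> C * \<bar>y\<bar> powr (-3/2)"
    and "C \<ge> 0" and y0: "y \<noteq> 0"
  shows "f \<le> 2 * C * Y\<^sup>2 * tailweight y"
proof -
  have Y2: "1 \<le> Y\<^sup>2" using assms(1) by simp
  have sq: "1 / sqrt \<bar>y\<bar> = \<bar>y\<bar> powr (-1/2)" using y0 by (simp add: powr_minus powr_half_sqrt field_simps)
  consider "\<bar>y\<bar> \<le> 1" | "1 < \<bar>y\<bar>" "\<bar>y\<bar> \<le> Y" | "1 < \<bar>y\<bar>" "Y < \<bar>y\<bar>" by linarith
  then show ?thesis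
  proof cases
    case 1
    then have "1 \<le> \<bar>y\<bar> powr (-1/2)" using powr_mono2'[of "-(1/2)" "\<bar>y\<bar>" 1] y0 by simp
    moreover have "f \<le> C * (1 + \<bar>y\<bar> powr (-1/2))" using assms(2) 1 assms(1) sq by simp
    moreover have "C * (1 + \<bar>y\<bar> powr (-1/2)) \<le> C * (2 * \<bar>y\<bar> powr (-1/2))" if "1 \<le> \<bar>y\<bar> powr (-1/2)"
      using assms(4) that by (intro mult_left_mono) auto
    ultimately have "f \<le> C * (2 * \<bar>y\<bar> powr (-1/2))" by linarith
    also have "\<dots> = (2 * C * \<bar>y\<bar> powr (-1/2)) * 1" by simp
    also have "\<dots> \<le> (2 * C * \<bar>y\<bar> powr (-1/2)) * Y\<^sup>2"
      using Y2 assms(4) by (intro mult_left_mono) auto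
    finally show ?thesis using 1 by (simp add: tailweight_def mult_ac)
  next
    case 2
    have "f \<le> C * (1 + 1 / sqrt \<bar>y\<bar>)" using assms(2) 2 by simp
    also have "\<dots> \<le> C * 2" using 2 assms(4) by (intro mult_left_mono) auto
    also have "\<dots> \<le> C * 2 * (Y\<^sup>2 * \<bar>y\<bar> powr (-3/2))"
    proof -
      have "1 = \<bar>y\<bar> powr (3/2) * \<bar>y\<bar> powr (-3/2)" using 2 by (simp flip: powr_add)
      also have "\<dots> \<le> \<bar>y\<bar> powr 2 * \<bar>y\<bar> powr (-3/2)" using 2 by (intro mult_right_mono powr_mono) auto
      also have "\<dots> \<le> Y\<^sup>2 * \<bar>y\<bar> powr (-3/2)" using 2 by (intro mult_right_mono) (auto simp: powr_numeral intro: abs_le_square_iff[THEN iffD1])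
      finally show ?thesis using assms(4) by (subst mult_le_cancel_left1) auto
    qed
    finally show ?thesis using 2 by (simp add: tailweight_def mult_ac)
  next
    case 3
    have "f \<le> C * \<bar>y\<bar> powr (-3/2)" using assms(3) 3 by simp
    also have "\<dots> = (C * \<bar>y\<bar> powr (-3/2)) * 1" by simp
    also have "\<dots> \<le> (C * \<bar>y\<bar> powr (-3/2)) * (2 * Y\<^sup>2)"
      using Y2 assms(4) by (intro mult_left_mono) auto
    finally show ?thesis using 3 by (simp add: tailweight_def mult_ac)
  qed
qed

lemma set_integrable_finite_sum:
  fixes f :: "'i \<Rightarrow> 'a \<Rightarrow> real"
  assumes "\<And>i. i \<in> I \<Longrightarrow> set_integrable M A (f i)"
  shows "set_integrable M A (\<lambda>x. \<Sum>i\<in>I. f i x)"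
  using assms unfolding set_integrable_def by (simp add: sum_distrib_left)

lemma set_integral_finite_sum:
  fixes f :: "'i \<Rightarrow> 'a \<Rightarrow> real"
  assumes "\<And>i. i \<in> I \<Longrightarrow> set_integrable M A (f i)"
  shows "(LINT x:A|M. \<Sum>i\<in>I. f i x) = (\<Sum>i\<in>I. LINT x:A|M. f i x)"
  using assms unfolding set_integrable_def set_lebesgue_integral_def by (simp add: sum_distrib_left)

section \<open>The constant of the mass formula and its homogeneity\<close>

lemma lnavg_add_2_nonneg [simp]: "0 \<le> lnavg r + 2"
  using lnavg_ge[of r] by simp

text \<open>The value is \<open>\<pi>\<^sup>2\<close>, but only positivity matters.\<close>

definition kappa :: real where "kappa = (LINT y|lborel. lnavg (1 / y) + 2)"

text \<open>Adding 2 removes the limit \<open>lnavg 0\<close> at infinity. As the derivative of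
  \<open>lnavg\<close> vanishes at 0, the rest decays like \<open>1 / y\<^sup>2\<close>; at
  \<open>y = 0\<close> the singularity is only logarithmic.\<close>

lemma lnavg_integrable_1: "integrable lborel (\<lambda>y. lnavg (1 / y) + 2)"
proof (rule Bochner_Integration.integrable_bound[OF integrable_mult_right[OF tailweight_integrable, of "2 * 12 * 2\<^sup>2"]])
  have "norm (lnavg (1 / y) + 2) \<le> norm (2 * 12 * 2\<^sup>2 * tailweight y)" if "y \<noteq> 0" for y
  proof -
    have "lnavg (1 / y) + 2 \<le> 2 * 12 * 2\<^sup>2 * tailweight y"
    proof (rule le_tailweight)
      show "lnavg (1 / y) + 2 \<le> 12 * (1 + 1 / sqrt \<bar>y\<bar>)"
      proof -
        have "lnavg (1 / y) + 2 \<le> 10 * (1 + sqrt \<bar>1/y\<bar>) + 2"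
          using abs_lnavg_le[of "1/y"] ln_le_sqrt[of "\<bar>1/y\<bar>"] by linarith
        also have "\<dots> \<le> 12 * (1 + sqrt \<bar>1/y\<bar>)" by simp
        finally show ?thesis by (simp add: real_sqrt_divide abs_divide)
      qed
      assume y: "2 \<le> \<bar>y\<bar>"
      have "\<bar>1/y\<bar> \<le> 1/2" using y by (simp add: field_simps)
      from lnavg_taylor[OF this, of 0] have "lnavg (1/y) + 2 \<le> 4 * (1/y)\<^sup>2" by simp
      also have "(1/y)\<^sup>2 = \<bar>y\<bar> powr (-2)" using y by (simp add: powr_minus power_divide divide_inverse power_inverse)
      also have "4 * \<bar>y\<bar> powr (-2) \<le> 12 * \<bar>y\<bar> powr (-3/2)"
        using y by (intro mult_mono powr_mono) auto
      finally show "lnavg (1 / y) + 2 \<le> 12 * \<bar>y\<bar> powr (-3/2)" by simp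
    qed (use that in auto)
    then show ?thesis using lnavg_ge[of "1/y"] by simp
  qed
  then show "AE y in lborel. norm (lnavg (1 / y) + 2) \<le> norm (2 * 12 * 2\<^sup>2 * tailweight y)"
    using AE_lborel_singleton[of 0] by auto
qed measurable

lemma lnavg_scaled:
  "integrable lborel (\<lambda>y. lnavg (a / y) + 2)" "(LINT y|lborel. lnavg (a / y) + 2) = \<bar>a\<bar> * kappa"
proof -
  have "integrable lborel (\<lambda>y. lnavg (a / y) + 2) \<and> (LINT y|lborel. lnavg (a / y) + 2) = \<bar>a\<bar> * kappa"
  proof (cases "a = 0")
    case False
    have 1: "integrable lborel (\<lambda>y. lnavg (1 / (0 + (1/a) * y)) + 2)"
      using lborel_integrable_real_affine[OF lnavg_integrable_1, of "1/a" 0] False by simp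
    have 2: "kappa = \<bar>1/a\<bar> *\<^sub>R (LINT y|lborel. lnavg (1 / (0 + (1/a) * y)) + 2)"
      unfolding kappa_def using lborel_integral_real_affine[of "1/a" "\<lambda>y. lnavg (1 / y) + 2" 0] False by simp
    have "1 / (0 + (1/a) * y) = a / y" for y using False by simp
    with 1 2 False show ?thesis by (simp add: abs_divide) (simp add: field_simps)
  qed simp
  then show "integrable lborel (\<lambda>y. lnavg (a / y) + 2)" "(LINT y|lborel. lnavg (a / y) + 2) = \<bar>a\<bar> * kappa" by auto
qed

lemma kappa_pos: "kappa > 0"
proof (rule ccontr)
  assume "\<not> kappa > 0"
  moreover have "kappa \<ge> 0" unfolding kappa_def by (intro integral_nonneg_AE) simp
  ultimately have "kappa = 0" by simp
  then have "AE y in lborel. lnavg (1 / y) + 2 = 0"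
    unfolding kappa_def
    by (subst (asm) integral_nonneg_eq_0_iff_AE[OF lnavg_integrable_1]) auto
  moreover have "lnavg (1 / y) + 2 \<noteq> 0" if "y \<in> {0<..<1}" for y
    using lnavg_gt[of "1/y"] that by (auto simp: field_simps)
  ultimately have "AE y in lborel. y \<notin> {0<..<1::real}" by (auto elim!: eventually_mono)
  then have "emeasure lborel {0<..<1::real} = 0"
    by (subst (asm) AE_iff_measurable[of "{0<..<1}"]) auto
  then show False by simp
qed

text \<open>On symmetric windows the terms linear in \<open>r\<close> cancel, so every real point
  contributes the same divergent amount \<open>2 * xlnx (real n)\<close> in the limit.\<close>

lemma xlnx_symmetric_tendsto: "(\<lambda>n. xlnx (real n - r) + xlnx (real n + r) - 2 * xlnx (real n)) \<longlonglongrightarrow> 0"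
proof -
  have "((\<lambda>x::real. ((x - r) * ln (x - r) - (x - r)) + ((x + r) * ln (x + r) - (x + r)) - 2 * (x * ln x - x)) \<longlongrightarrow> 0) at_top"
    by real_asymp
  moreover have "\<forall>\<^sub>F x::real in at_top. ((x - r) * ln (x - r) - (x - r)) + ((x + r) * ln (x + r) - (x + r)) - 2 * (x * ln x - x)
      = xlnx (x - r) + xlnx (x + r) - 2 * xlnx x"
    using eventually_gt_at_top[of "\<bar>r\<bar> + 1"] by eventually_elim (auto simp: xlnx_def)
  ultimately have "((\<lambda>x. xlnx (x - r) + xlnx (x + r) - 2 * xlnx x) \<longlongrightarrow> 0) at_top"
    by (rule Lim_transform_eventually)
  then show ?thesis by (rule filterlim_compose) (rule filterlim_real_sequentially)
qed

text \<open>Replacing each \<open>z i\<close> by its real part lowers the integrand to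
  \<open>g\<close>. The integrals of \<open>g\<close> over \<open>{- real n..real n}\<close> tend to
  0, because both sums run over equally many real points.\<close>

lemma ln_roots_integral_nonneg:
  fixes f :: "real \<Rightarrow> real" and z :: "'n::finite \<Rightarrow> complex" and d :: "'n \<Rightarrow> real"
  assumes f: "integrable lborel f"
    and eq: "AE x in lborel. f x = (\<Sum>i\<in>UNIV. ln (cmod (complex_of_real x - z i))) - (\<Sum>i\<in>UNIV. ln \<bar>x - d i\<bar>)"
  shows "(LINT x|lborel. f x) \<ge> 0" and "(\<And>i. z i \<in> \<real>) \<Longrightarrow> (LINT x|lborel. f x) = 0"
proof -
  define g where "g = (\<lambda>x. (\<Sum>i\<in>UNIV. ln \<bar>x - Re (z i)\<bar>) - (\<Sum>i\<in>UNIV. ln \<bar>x - d i\<bar>))"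
  have gi: "set_integrable lborel {a..b} g" for a b
    unfolding g_def by (intro set_integral_diff set_integrable_finite_sum ln_abs_set_integrable)
  have gv: "(LINT x:{- real n..real n}|lborel. g x) =
     (\<Sum>i\<in>UNIV. xlnx (real n - Re (z i)) + xlnx (real n + Re (z i)) - 2 * xlnx (real n)) -
     (\<Sum>i\<in>UNIV. xlnx (real n - d i) + xlnx (real n + d i) - 2 * xlnx (real n))" for n
  proof -
    have *: "(LINT x:{- real n..real n}|lborel. \<Sum>i\<in>UNIV. ln \<bar>x - r i\<bar>) = (\<Sum>i\<in>UNIV. xlnx (real n - r i) + xlnx (real n + r i))"
      for r :: "'n \<Rightarrow> real"
    proof -
      have "(LINT x:{- real n..real n}|lborel. \<Sum>i\<in>UNIV. ln \<bar>x - r i\<bar>) = (\<Sum>i\<in>UNIV. LINT x:{- real n..real n}|lborel. ln \<bar>x - r i\<bar>)"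
        by (rule set_integral_finite_sum) (auto simp: ln_abs_set_integrable)
      also have "\<dots> = (\<Sum>i\<in>UNIV. xlnx (real n - r i) + xlnx (real n + r i))"
        using xlnx_minus[of "real n + r _"] by (intro sum.cong) (auto simp: ln_abs_set_integral)
      finally show ?thesis .
    qed
    show ?thesis unfolding g_def
      by (subst set_integral_diff(2)) (auto intro!: set_integrable_finite_sum simp: ln_abs_set_integrable * sum_subtractf)
  qed
  have g0: "(\<lambda>n. LINT x:{- real n..real n}|lborel. g x) \<longlonglongrightarrow> 0"
    unfolding gv
    using tendsto_diff[OF tendsto_sum[OF xlnx_symmetric_tendsto, of "\<lambda>i. Re (z i)" UNIV]
        tendsto_sum[OF xlnx_symmetric_tendsto, of d UNIV]] by simp
  have fi: "set_integrable lborel {a..b} f" for a b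
    using f unfolding set_integrable_def by (rule integrable_mult_indicator[rotated]) auto
  have f1: "(\<lambda>n. LINT x:{- real n..real n}|lborel. f x) \<longlonglongrightarrow> (LINT x|lborel. f x)"
    unfolding set_lebesgue_integral_def
  proof (rule integral_dominated_convergence[where w = "\<lambda>x. \<bar>f x\<bar>"])
    show "AE x in lborel. (\<lambda>n. indicat_real {- real n..real n} x *\<^sub>R f x) \<longlonglongrightarrow> f x"
    proof (rule AE_I2, rule tendsto_eventually)
      fix x :: real
      show "\<forall>\<^sub>F n in sequentially. indicat_real {- real n..real n} x *\<^sub>R f x = f x"
        using eventually_ge_at_top[of "nat \<lceil>\<bar>x\<bar>\<rceil>"]
      proof eventually_elim
        case (elim n)
        then have "\<bar>x\<bar> \<le> real n" by linarith
        then show ?case by (simp add: abs_le_iff)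
      qed
    qed
    show "AE x in lborel. norm (indicat_real {- real n..real n} x *\<^sub>R f x) \<le> \<bar>f x\<bar>" for n
      by (auto simp: indicator_def)
  qed (use f in auto)
  \<comment> \<open>At \<open>x = Re (z i)\<close> the default \<open>ln 0 = 0\<close> may exceed
    \<open>ln (cmod (complex_of_real x - z i))\<close>; this happens on a null set only.\<close>
  have AEne: "AE x in lborel. \<forall>i. x \<noteq> Re (z i)"
    by (simp add: AE_all_countable AE_lborel_singleton)
  have le: "(LINT x:{a..b}|lborel. g x) \<le> (LINT x:{a..b}|lborel. f x)" for a b
  proof (rule set_integral_mono_AE[OF gi fi])
    show "AE x\<in>{a..b} in lborel. g x \<le> f x"
      using eq AEne
    proof eventually_elim
      case (elim x)
      have "(\<Sum>i\<in>UNIV. ln \<bar>x - Re (z i)\<bar>) \<le> (\<Sum>i\<in>UNIV. ln (cmod (complex_of_real x - z i)))"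
      proof (rule sum_mono)
        fix i
        have "\<bar>x - Re (z i)\<bar> \<le> cmod (complex_of_real x - z i)"
          using abs_Re_le_cmod[of "complex_of_real x - z i"] by simp
        moreover have "\<bar>x - Re (z i)\<bar> > 0" using elim by auto
        ultimately show "ln \<bar>x - Re (z i)\<bar> \<le> ln (cmod (complex_of_real x - z i))"
          by (subst ln_le_cancel_iff) auto
      qed
      then show ?case by (simp add: elim g_def)
    qed
  qed
  show "(LINT x|lborel. f x) \<ge> 0"
    using LIMSEQ_le[OF g0 f1] le by blast
  assume z: "\<And>i. z i \<in> \<real>"
  have "(LINT x:{a..b}|lborel. g x) = (LINT x:{a..b}|lborel. f x)" for a b
  proof (rule set_lebesgue_integral_cong_AE)
    have *: "cmod (complex_of_real x - z i) = \<bar>x - Re (z i)\<bar>" for x i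
    proof -
      have "complex_of_real x - z i = complex_of_real (x - Re (z i))" using z[of i] by simp
      then show ?thesis by (metis norm_of_real)
    qed
    show "AE x\<in>{a..b} in lborel. g x = f x"
      using eq by eventually_elim (simp add: g_def *)
    show "g \<in> borel_measurable lborel" unfolding g_def by measurable
  qed (use f in auto)
  then show "(LINT x|lborel. f x) = 0" using LIMSEQ_unique[OF g0] f1 by simp
qed

text \<open>The second derivative of \<open>\<bar>a - c\<bar>\<close> in \<open>c\<close> is twice
  the point mass at \<open>a\<close>, hence \<open>2 * exp a\<close>. The boundary terms are affine
  in \<open>a\<close> and cancel between two families with equal sums.\<close>

lemma exp_abs_has_integral:
  fixes a R :: real assumes "\<bar>a\<bar> \<le> R"
  shows "((\<lambda>c. exp c * \<bar>a - c\<bar>) has_integral (2 * exp a + (exp R * (R - 1) - exp (-R) * (R + 1)) - a * (exp R + exp (-R)))) {-R..R}"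
proof -
  have "((\<lambda>c. exp c * \<bar>a - c\<bar>) has_integral (exp a * (a - a + 1) - exp (-R) * (a - (-R) + 1))) {-R..a}"
  proof (rule fundamental_theorem_of_calculus[of "-R" a "\<lambda>c. exp c * (a - c + 1)"])
    show "- R \<le> a" using assms by auto
    fix x assume "x \<in> {-R..a}"
    then have "((\<lambda>c. exp c * (a - c + 1)) has_real_derivative exp x * \<bar>a - x\<bar>) (at x within {-R..a})"
      by (auto intro!: derivative_eq_intros simp: algebra_simps)
    then show "((\<lambda>c. exp c * (a - c + 1)) has_vector_derivative exp x * \<bar>a - x\<bar>) (at x within {-R..a})"
      by (simp add: has_real_derivative_iff_has_vector_derivative)
  qed
  moreover have "((\<lambda>c. exp c * \<bar>a - c\<bar>) has_integral (exp R * (R - a - 1) - exp a * (a - a - 1))) {a..R}"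
  proof (rule fundamental_theorem_of_calculus[of a R "\<lambda>c. exp c * (c - a - 1)"])
    show "a \<le> R" using assms by auto
    fix x assume "x \<in> {a..R}"
    then have "((\<lambda>c. exp c * (c - a - 1)) has_real_derivative exp x * \<bar>a - x\<bar>) (at x within {a..R})"
      by (auto intro!: derivative_eq_intros simp: algebra_simps)
    then show "((\<lambda>c. exp c * (c - a - 1)) has_vector_derivative exp x * \<bar>a - x\<bar>) (at x within {a..R})"
      by (simp add: has_real_derivative_iff_has_vector_derivative)
  qed
  ultimately have "((\<lambda>c. exp c * \<bar>a - c\<bar>) has_integral
     ((exp a * (a - a + 1) - exp (-R) * (a - (-R) + 1)) + (exp R * (R - a - 1) - exp a * (a - a - 1)))) {-R..R}"
    using assms by (intro has_integral_combine[of "-R" a R]) auto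
  then show ?thesis by (simp add: algebra_simps)
qed

lemma exp_abs_sum_has_integral:
  fixes a d :: "'n::finite \<Rightarrow> real"
  assumes "\<And>i. \<bar>a i\<bar> \<le> R" "\<And>i. \<bar>d i\<bar> \<le> R" and sum: "(\<Sum>i\<in>UNIV. a i) = (\<Sum>i\<in>UNIV. d i)"
  shows "((\<lambda>c. exp c * ((\<Sum>i\<in>UNIV. \<bar>a i - c\<bar>) - (\<Sum>i\<in>UNIV. \<bar>d i - c\<bar>))) has_integral
     (2 * ((\<Sum>i\<in>UNIV. exp (a i)) - (\<Sum>i\<in>UNIV. exp (d i))))) {-R..R}"
proof -
  have *: "((\<lambda>c. \<Sum>i\<in>UNIV. exp c * \<bar>a i - c\<bar>) has_integral
      (\<Sum>i\<in>UNIV. 2 * exp (a i) + (exp R * (R - 1) - exp (-R) * (R + 1)) - a i * (exp R + exp (-R)))) {-R..R}"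
    if "\<And>i. \<bar>a i\<bar> \<le> R" for a :: "'n \<Rightarrow> real"
    by (rule has_integral_sum) (use that exp_abs_has_integral in auto)
  from has_integral_diff[OF *[of a] *[of d]] assms show ?thesis
    by (simp add: sum_distrib_left sum_subtractf right_diff_distrib sum.distrib flip: sum_distrib_right)
qed

section \<open>The logarithmic excess of a pencil over its diagonal\<close>

text \<open>Only the identity permutation reaches degree \<open>CARD('n)\<close>, so the determinant
  is monic of that degree. Indexing the roots by the matrix index type lets them be summed alongside
  the diagonal entries.\<close>

lemma complex_charpoly_factor:
  fixes N :: "complex^'n^'n"
  shows "\<exists>w :: 'n \<Rightarrow> complex. \<forall>z. det (mat z - N) = (\<Prod>i\<in>UNIV. z - w i)"
proof -
  define Q :: "complex poly^'n^'n" where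
    "Q = (\<chi> i j. if i = j then [:- (N $ i $ j), 1:] else [:- (N $ i $ j):])"
  have pQ: "poly (Q $ i $ j) z = (mat z - N) $ i $ j" for i j z
    by (simp add: Q_def mat_def)
  have poly_det: "poly (det Q) z = det (mat z - N)" for z
    unfolding det_def poly_sum poly_mult poly_prod pQ by simp
  define D where "D = (\<Prod>i\<in>UNIV. Q $ i $ i)"
  have degD: "degree D = CARD('n)" and lcD: "lead_coeff D = 1"
    unfolding D_def by (subst degree_prod_eq_sum_degree, auto simp: Q_def) (subst lead_coeff_prod, auto simp: Q_def)
  have "degree (\<Sum>p\<in>{p. p permutes UNIV} - {id}. of_int (sign p) * (\<Prod>i\<in>UNIV. Q $ i $ p i)) < CARD('n)"
  proof (rule degree_sum_less)
    fix p assume p: "p \<in> {p. p permutes (UNIV::'n set)} - {id}"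
    then obtain i0 where i0: "p i0 \<noteq> i0" by fastforce
    have "degree (of_int (sign p) * (\<Prod>i\<in>UNIV. Q $ i $ p i)) \<le> 0 + degree (\<Prod>i\<in>UNIV. Q $ i $ p i)"
      by (rule order_trans[OF degree_mult_le]) simp
    also have "\<dots> \<le> (\<Sum>i\<in>UNIV. degree (Q $ i $ p i))"
      using degree_prod_sum_le[of UNIV "\<lambda>i. Q $ i $ p i"] by (simp add: o_def)
    also have "\<dots> < (\<Sum>i\<in>(UNIV::'n set). 1)"
      by (rule sum_strict_mono_ex1) (use i0 in \<open>auto simp: Q_def intro!: exI[of _ i0]\<close>)
    finally show "degree (of_int (sign p) * (\<Prod>i\<in>UNIV. Q $ i $ p i)) < CARD('n)" by simp
  qed simp
  then have degR: "degree (\<Sum>p\<in>{p. p permutes UNIV} - {id}. of_int (sign p) * (\<Prod>i\<in>UNIV. Q $ i $ p i)) < degree D"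
    by (simp add: degD)
  have detQ: "det Q = (\<Sum>p\<in>{p. p permutes UNIV} - {id}. of_int (sign p) * (\<Prod>i\<in>UNIV. Q $ i $ p i)) + D"
    unfolding det_def by (subst sum.remove[of _ id]) (auto simp: permutes_id finite_permutations D_def sign_id)
  have deg: "degree (det Q) = CARD('n)" and lc: "lead_coeff (det Q) = 1"
    using degR lcD unfolding detQ by (simp_all add: degree_add_eq_right lead_coeff_add_le degD coeff_eq_0)
  obtain root where root: "smult (lead_coeff (det Q)) (\<Prod>i<degree (det Q). [:- root i, 1:]) = det Q"
    using complex_poly_decompose' by blast
  obtain h where h: "bij_betw h (UNIV :: 'n set) {..<CARD('n)}"
    using ex_bij_betw_finite_nat[of "UNIV :: 'n set"] by (auto simp: atLeast0LessThan)
  have "det (mat z - N) = (\<Prod>i\<in>UNIV. z - root (h i))" for z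
  proof -
    have "det (mat z - N) = poly (\<Prod>i<CARD('n). [:- root i, 1:]) z"
      using root lc by (simp add: poly_det[symmetric] deg)
    also have "\<dots> = (\<Prod>i<CARD('n). z - root i)" by (simp add: poly_prod)
    also have "\<dots> = (\<Prod>i\<in>UNIV. z - root (h i))" by (rule prod.reindex_bij_betw[OF h, symmetric])
    finally show ?thesis .
  qed
  then show ?thesis by (intro exI[of _ "\<lambda>i. root (h i)"]) auto
qed

text \<open>Both terms have the same leading behaviour at infinity, in \<open>x\<close> as well as in \<open>s\<close>, so their
  difference is integrable in either variable. The zeros, where \<open>ln 0 = 0\<close> is a junk value, form a
  null set.\<close>

definition log_excess :: "complex^'n^'n \<Rightarrow> ('n \<Rightarrow> real) \<Rightarrow> real \<Rightarrow> real \<Rightarrow> real" where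
  "log_excess A b x s = ln (cmod (det (A + dg (\<lambda>i. x * (b i - s)))))
     - (\<Sum>i\<in>UNIV. ln \<bar>Re (A $ i $ i) + x * (b i - s)\<bar>)"

lemma det_dg_measurable:
  assumes [measurable]: "\<And>i. f i \<in> borel_measurable M"
  shows "(\<lambda>p. det (A + dg (\<lambda>i. f i p))) \<in> borel_measurable M"
proof -
  have "(\<lambda>p. (A + dg (\<lambda>i. f i p)) $ i $ j) \<in> borel_measurable M" for i j
    unfolding vector_add_component dg_nth by measurable
  then show ?thesis unfolding det_def by measurable
qed

lemma log_excess_measurable:
  assumes [measurable]: "f \<in> borel_measurable M" "g \<in> borel_measurable M" "h \<in> borel_measurable M"
  shows "(\<lambda>p. log_excess (A + dg (\<lambda>_. f p)) b (g p) (h p)) \<in> borel_measurable M"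
proof -
  have [measurable]: "(\<lambda>p. det (A + dg (\<lambda>i. f p + g p * (b i - h p)))) \<in> borel_measurable M"
    by (rule det_dg_measurable) measurable
  show ?thesis unfolding log_excess_def add.assoc dg_add vector_add_component dg_nth by measurable
qed

lemma dg_0 [simp]: "dg (\<lambda>_. 0) = 0" by (simp add: vec_eq_iff dg_nth)

lemma log_excess_measurable':
  assumes [measurable]: "g \<in> borel_measurable M" "h \<in> borel_measurable M"
  shows "(\<lambda>p. log_excess A b (g p) (h p)) \<in> borel_measurable M"
  using log_excess_measurable[of "\<lambda>_. 0" M g h A b] by simp

lemma hermitian_cin_real:
  assumes "hermitian_mat A" shows "cin v (A *v v) \<in> \<real>"
proof -
  have "cnj (cin v (A *v v)) = cin v (A *v v)"
    using assms by (metis cin_cnj cin_mult_right hermitian_mat_iff_adj)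
  then show ?thesis by (simp add: Reals_cnj_iff)
qed

text \<open>Dividing row \<open>i\<close> by \<open>b i - s\<close> leaves a characteristic
  polynomial in \<open>x\<close>, and the scaling factors cancel against those of the diagonal
  product. If \<open>b - s\<close> is definite, a kernel vector \<open>v\<close> at a zero
  \<open>z\<close> satisfies \<open>v\<^sup>*A v + z v\<^sup>*(b - s)v = 0\<close>, where both forms
  are real and the second is nonzero; so \<open>z\<close> is real.\<close>

lemma log_excess_factor:
  fixes A :: "complex^'n^'n"
  assumes A: "hermitian_mat A" and s: "s \<notin> range b"
  shows "\<exists>(z :: 'n \<Rightarrow> complex) (d :: 'n \<Rightarrow> real).
     (AE x in lborel. log_excess A b x s = (\<Sum>i\<in>UNIV. ln (cmod (complex_of_real x - z i))) - (\<Sum>i\<in>UNIV. ln \<bar>x - d i\<bar>)) \<and>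
     (((\<forall>i. s < b i) \<or> (\<forall>i. b i < s)) \<longrightarrow> (\<forall>i. z i \<in> \<real>))"
proof -
  define c where "c = (\<lambda>i. b i - s)"
  have c0: "c i \<noteq> 0" for i using s by (auto simp: c_def)
  define N where "N = - (dg (\<lambda>i. 1 / c i) ** A)"
  obtain z :: "'n \<Rightarrow> complex" where z: "\<And>w. det (mat w - N) = (\<Prod>i\<in>UNIV. w - z i)"
    using complex_charpoly_factor[of N] by blast
  define d where "d = (\<lambda>i. - Re (A $ i $ i) / c i)"
  have fac: "dg c ** (mat w - N) = (\<chi> i j. A $ i $ j + (if i = j then w * complex_of_real (c i) else 0))" for w
    using c0 by (simp add: vec_eq_iff dg_mult_nth N_def mat_def algebra_simps)
  have detc: "det (dg c) = (\<Prod>i\<in>UNIV. complex_of_real (c i))"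
    by (rule det_spectral_decomp[OF spectral_decomp_dg])
  have det: "det (\<chi> i j. A $ i $ j + (if i = j then w * complex_of_real (c i) else 0)) = (\<Prod>i\<in>UNIV. complex_of_real (c i) * (w - z i))" for w
    unfolding fac[symmetric] det_mul detc z prod.distrib ..
  have eq: "log_excess A b x s = (\<Sum>i\<in>UNIV. ln (cmod (complex_of_real x - z i))) - (\<Sum>i\<in>UNIV. ln \<bar>x - d i\<bar>)"
    if x: "\<forall>i. complex_of_real x \<noteq> z i" "\<forall>i. x \<noteq> d i" for x
  proof -
    have "A + dg (\<lambda>i. x * (b i - s)) = (\<chi> i j. A $ i $ j + (if i = j then complex_of_real x * complex_of_real (c i) else 0))"
      by (simp add: vec_eq_iff dg_nth c_def)
    then have "cmod (det (A + dg (\<lambda>i. x * (b i - s)))) = (\<Prod>i\<in>UNIV. \<bar>c i\<bar> * cmod (complex_of_real x - z i))"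
      by (simp add: det norm_mult flip: prod_norm)
    then have 1: "ln (cmod (det (A + dg (\<lambda>i. x * (b i - s))))) = (\<Sum>i\<in>UNIV. ln \<bar>c i\<bar> + ln (cmod (complex_of_real x - z i)))"
      using x c0 by (simp add: ln_prod ln_mult)
    have "Re (A $ i $ i) + x * (b i - s) = c i * (x - d i)" for i
      using c0[of i] by (simp add: d_def c_def field_simps)
    then have "ln \<bar>Re (A $ i $ i) + x * (b i - s)\<bar> = ln \<bar>c i\<bar> + ln \<bar>x - d i\<bar>" for i
      using x c0[of i] by (simp add: abs_mult ln_mult)
    with 1 show ?thesis unfolding log_excess_def by (simp add: sum.distrib)
  qed
  have "AE x in lborel. (\<forall>i. complex_of_real x \<noteq> z i) \<and> (\<forall>i. x \<noteq> d i)"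
  proof -
    have "AE x in lborel. (\<forall>i. x \<noteq> Re (z i)) \<and> (\<forall>i. x \<noteq> d i)"
      by (simp add: AE_all_countable AE_lborel_singleton)
    then show ?thesis by eventually_elim (metis Re_complex_of_real)
  qed
  then have AE: "AE x in lborel. log_excess A b x s = (\<Sum>i\<in>UNIV. ln (cmod (complex_of_real x - z i))) - (\<Sum>i\<in>UNIV. ln \<bar>x - d i\<bar>)"
    by eventually_elim (rule eq; blast)
  have "z k \<in> \<real>" if def: "(\<forall>i. s < b i) \<or> (\<forall>i. b i < s)" for k
  proof -
    define P where "P = (\<chi> i j. A $ i $ j + (if i = j then z k * complex_of_real (c i) else 0))"
    have "det P = 0" unfolding P_def det by (simp add: prod_zero_iff) blast
    then have "\<not> invertible P" by (simp add: invertible_det_nz)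
    then obtain v where v: "P *v v = 0" "v \<noteq> 0"
      using matrix_left_invertible_ker invertible_left_inverse by blast
    have Pv: "P *v v = A *v v + z k *s (dg c *v v)"
      by (simp add: P_def vec_eq_iff matrix_vector_mult_def dg_nth distrib_right sum.distrib mult_delta_left sum_distrib_left)
    define q where "q = (\<Sum>i\<in>UNIV. c i * (cmod (v $ i))\<^sup>2)"
    have cq: "cin v (dg c *v v) = complex_of_real q"
      unfolding q_def of_real_sum of_real_mult complex_norm_square
      by (simp add: cin_def matrix_vector_mult_def dg_nth mult_delta_left mult_delta_right mult_ac)
    have q0: "q \<noteq> 0"
    proof -
      obtain i0 where i0: "v $ i0 \<noteq> 0" using v(2) by (auto simp: vec_eq_iff)
      from def show ?thesis
      proof
        assume "\<forall>i. s < b i"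
        then have "\<And>i. c i > 0" by (simp add: c_def)
        then have "0 < (\<Sum>i\<in>UNIV. c i * (cmod (v $ i))\<^sup>2)"
          using i0 by (intro sum_pos2[of _ i0]) (auto simp: zero_le_mult_iff less_imp_le)
        then show ?thesis by (simp add: q_def)
      next
        assume "\<forall>i. b i < s"
        then have "\<And>i. c i < 0" by (simp add: c_def)
        then have "0 < (\<Sum>i\<in>UNIV. - c i * (cmod (v $ i))\<^sup>2)"
          using i0 by (intro sum_pos2[of _ i0]) (auto simp: mult_le_0_iff less_imp_le mult_neg_pos)
        then show ?thesis by (simp add: q_def sum_negf)
      qed
    qed
    have "cin v (A *v v) + z k * cin v (dg c *v v) = 0"
      using v(1) by (simp add: Pv cin_add_right[symmetric] cin_scale_right[symmetric]) (simp add: cin_def)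
    then have "z k = - cin v (A *v v) / complex_of_real q"
      using q0 unfolding cq by (simp add: field_simps add_eq_0_iff2)
    then show ?thesis using hermitian_cin_real[OF A, of v] by (metis Reals_divide Reals_minus_iff Reals_of_real)
  qed
  with AE show ?thesis by blast
qed

text \<open>The function \<open>g(c,s)\<close> of the overview is
  \<open>excess (A + dg (\<lambda>_. - c)) b s\<close>. Where the integrand fails to be integrable
  the Bochner integral is 0, a value consistent with both sign statements that follow.\<close>

definition excess :: "complex^'n^'n \<Rightarrow> ('n \<Rightarrow> real) \<Rightarrow> real \<Rightarrow> real" where
  "excess A b s = (LINT x|lborel. log_excess A b x s)"

lemma excess_nonneg:
  fixes A :: "complex^'n^'n"
  assumes "hermitian_mat A" "s \<notin> range b"
  shows "excess A b s \<ge> 0"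
proof (cases "integrable lborel (\<lambda>x. log_excess A b x s)")
  case True
  obtain z :: "'n \<Rightarrow> complex" and d :: "'n \<Rightarrow> real" where
    "AE x in lborel. log_excess A b x s = (\<Sum>i\<in>UNIV. ln (cmod (complex_of_real x - z i))) - (\<Sum>i\<in>UNIV. ln \<bar>x - d i\<bar>)"
    using log_excess_factor[OF assms] by blast
  from ln_roots_integral_nonneg(1)[OF True this] show ?thesis by (simp add: excess_def)
qed (simp add: excess_def not_integrable_integral_eq)

lemma excess_eq_0:
  fixes A :: "complex^'n^'n"
  assumes "hermitian_mat A" and def: "(\<forall>i. s < b i) \<or> (\<forall>i. b i < s)"
  shows "excess A b s = 0"
proof (cases "integrable lborel (\<lambda>x. log_excess A b x s)")
  case True
  have "s \<notin> range b" using def by force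
  from log_excess_factor[OF assms(1) this] def
  obtain z :: "'n \<Rightarrow> complex" and d :: "'n \<Rightarrow> real" where
    *: "AE x in lborel. log_excess A b x s = (\<Sum>i\<in>UNIV. ln (cmod (complex_of_real x - z i))) - (\<Sum>i\<in>UNIV. ln \<bar>x - d i\<bar>)"
    "\<And>i. z i \<in> \<real>"
    by blast
  from ln_roots_integral_nonneg(2)[OF True *] show ?thesis by (simp add: excess_def)
qed (simp add: excess_def not_integrable_integral_eq)

section \<open>Perturbation of eigenvalues\<close>

lemma spectral_sum_sq:
  assumes "spectral_decomp M U l"
  shows "(\<Sum>i\<in>UNIV. (l i)\<^sup>2) = (norm M)\<^sup>2"
proof -
  have U: "unitary_mat U" using assms by (simp add: spectral_decomp_def)
  have 1: "unitary_mat (mat 1)" by (simp add: unitary_mat_def)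
  from overlap_cost[OF assms spectral_decomp_dg[of "\<lambda>_. 0"]]
  have "(\<Sum>i\<in>UNIV. \<Sum>j\<in>UNIV. overlap U (mat 1) i j * (l i)\<^sup>2) = (norm M)\<^sup>2" by simp
  then show ?thesis by (simp add: overlap_sum_right[OF U 1] flip: sum_distrib_right)
qed

lemma spectral_abs_le_norm:
  assumes "spectral_decomp M U l"
  shows "\<bar>l i\<bar> \<le> norm M"
proof -
  have "(l i)\<^sup>2 \<le> (\<Sum>i\<in>UNIV. (l i)\<^sup>2)" by (rule member_le_sum) auto
  then have "\<bar>l i\<bar>\<^sup>2 \<le> (norm M)\<^sup>2" by (simp add: spectral_sum_sq[OF assms])
  then show ?thesis by (rule power2_le_imp_le) simp
qed

lemma spectral_sum:
  assumes "spectral_decomp M U l"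
  shows "(\<Sum>i\<in>UNIV. l i) = (\<Sum>i\<in>UNIV. Re (M $ i $ i))"
proof -
  have U: "unitary_mat U" "unitary_mat (mat 1)" using assms by (auto simp: spectral_decomp_def unitary_mat_def)
  have "(\<Sum>j\<in>UNIV. Re (M $ j $ j)) = (\<Sum>j\<in>UNIV. \<Sum>i\<in>UNIV. overlap U (mat 1) i j * l i)"
    by (simp add: overlap_diag[OF assms])
  also have "\<dots> = (\<Sum>i\<in>UNIV. \<Sum>j\<in>UNIV. overlap U (mat 1) i j * l i)" by (rule sum.swap)
  also have "\<dots> = (\<Sum>i\<in>UNIV. l i)" by (simp add: overlap_sum_right[OF U] flip: sum_distrib_right)
  finally show ?thesis ..
qed

text \<open>Rows and columns of the overlaps sum to 1, so they couple the two spectra; eigenvalues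
  need not be ordered or matched.\<close>

lemma overlap_transport:
  assumes "unitary_mat U" "unitary_mat V"
  shows "(\<Sum>i\<in>UNIV. f i) - (\<Sum>j\<in>UNIV. g j) = (\<Sum>i\<in>UNIV. \<Sum>j\<in>UNIV. overlap U V i j * (f i - g j))"
proof -
  have "(\<Sum>i\<in>UNIV. \<Sum>j\<in>UNIV. overlap U V i j * g j) = (\<Sum>j\<in>UNIV. \<Sum>i\<in>UNIV. overlap U V i j * g j)"
    by (rule sum.swap)
  then have "(\<Sum>i\<in>UNIV. \<Sum>j\<in>UNIV. overlap U V i j * g j) = (\<Sum>j\<in>UNIV. g j)"
    by (simp add: overlap_sum_left[OF assms] flip: sum_distrib_right)
  moreover have "(\<Sum>i\<in>UNIV. \<Sum>j\<in>UNIV. overlap U V i j * f i) = (\<Sum>i\<in>UNIV. f i)"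
    by (simp add: overlap_sum_right[OF assms] flip: sum_distrib_right)
  ultimately show ?thesis by (simp add: right_diff_distrib sum_subtractf)
qed

text \<open>By \<open>overlap_diag\<close> the linear Taylor term averages to 0 around each diagonal
  entry, and the quadratic term is the transport cost. The bound sees only the off-diagonal part of
  \<open>M\<close> and no spectral gap.\<close>

lemma lnavg_trace_diag:
  assumes M: "spectral_decomp M U l" and "norm M \<le> 1/2"
  shows "\<bar>(\<Sum>i\<in>UNIV. lnavg (l i)) - (\<Sum>j\<in>UNIV. lnavg (Re (M $ j $ j)))\<bar>
     \<le> 4 * (norm (M - dg (\<lambda>j. Re (M $ j $ j))))\<^sup>2"
proof -
  have U: "unitary_mat U" "unitary_mat (mat 1)" using M by (auto simp: spectral_decomp_def unitary_mat_def)
  define m where "m = (\<lambda>j. Re (M $ j $ j))"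
  define D where "D = (\<lambda>j. ln (1 + m j) - ln (1 - m j))"
  let ?p = "overlap U (mat 1)"
  have l: "\<bar>l i\<bar> \<le> 1/2" for i using spectral_abs_le_norm[OF M, of i] assms(2) by linarith
  have mj: "\<bar>m j\<bar> \<le> 1/2" for j
    unfolding m_def using abs_Re_le_cmod[of "M $ j $ j"] Finite_Cartesian_Product.norm_nth_le[of "M $ j" j] Finite_Cartesian_Product.norm_nth_le[of M j] assms(2) by linarith
  have "(\<Sum>i\<in>UNIV. \<Sum>j\<in>UNIV. ?p i j * (D j * (l i - m j))) = (\<Sum>j\<in>UNIV. \<Sum>i\<in>UNIV. ?p i j * (D j * (l i - m j)))"
    by (rule sum.swap)
  also have "\<dots> = (\<Sum>j\<in>UNIV. D j * ((\<Sum>i\<in>UNIV. ?p i j * l i) - m j * (\<Sum>i\<in>UNIV. ?p i j)))"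
    by (simp add: sum_distrib_left sum_subtractf algebra_simps)
  also have "\<dots> = 0" by (simp add: overlap_diag[OF M] overlap_sum_left[OF U] m_def)
  finally have "(\<Sum>i\<in>UNIV. lnavg (l i)) - (\<Sum>j\<in>UNIV. lnavg (m j)) =
      (\<Sum>i\<in>UNIV. \<Sum>j\<in>UNIV. ?p i j * (lnavg (l i) - lnavg (m j))) - (\<Sum>i\<in>UNIV. \<Sum>j\<in>UNIV. ?p i j * (D j * (l i - m j)))"
    using overlap_transport[OF U, of "\<lambda>i. lnavg (l i)" "\<lambda>j. lnavg (m j)"] by simp
  also have "\<dots> = (\<Sum>i\<in>UNIV. \<Sum>j\<in>UNIV. ?p i j * (lnavg (l i) - lnavg (m j) - D j * (l i - m j)))"
    unfolding sum_subtractf[symmetric] right_diff_distrib[symmetric] ..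
  finally have "\<bar>(\<Sum>i\<in>UNIV. lnavg (l i)) - (\<Sum>j\<in>UNIV. lnavg (m j))\<bar> \<le>
      (\<Sum>i\<in>UNIV. \<Sum>j\<in>UNIV. \<bar>?p i j * (lnavg (l i) - lnavg (m j) - D j * (l i - m j))\<bar>)"
    by (simp only:) (intro order_trans[OF sum_abs] sum_mono sum_abs)
  also have "\<dots> \<le> (\<Sum>i\<in>UNIV. \<Sum>j\<in>UNIV. ?p i j * (4 * (l i - m j)\<^sup>2))"
    unfolding abs_mult using lnavg_taylor[OF l mj] by (intro sum_mono mult_mono) (auto simp: D_def)
  also have "\<dots> = 4 * (\<Sum>i\<in>UNIV. \<Sum>j\<in>UNIV. ?p i j * (l i - m j)\<^sup>2)"
    by (simp add: sum_distrib_left algebra_simps)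
  also have "\<dots> = 4 * (norm (M - dg m))\<^sup>2" by (simp add: overlap_cost[OF M spectral_decomp_dg])
  finally show ?thesis by (simp add: m_def)
qed

text \<open>On a compact interval \<open>\<bar>f x - f y\<bar>\<close> is at most a small constant
  plus a multiple of \<open>(x - y)\<^sup>2\<close>. Averaging with the overlaps turns the square
  into the Frobenius distance.\<close>

lemma trace_fun_continuous:
  fixes M :: "nat \<Rightarrow> complex^'n^'n"
  assumes f: "continuous_on UNIV (f :: real \<Rightarrow> real)"
    and M: "\<And>k. spectral_decomp (M k) (U k) (l k)" and N: "spectral_decomp N V m"
    and lim: "M \<longlonglongrightarrow> N"
  shows "(\<lambda>k. \<Sum>i\<in>UNIV. f (l k i)) \<longlonglongrightarrow> (\<Sum>i\<in>UNIV. f (m i))"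
proof (rule LIMSEQ_I)
  fix e :: real assume e: "e > 0"
  have UV: "unitary_mat (U k)" "unitary_mat V" for k using M N by (auto simp: spectral_decomp_def)
  have "Bseq M" using lim convergent_def convergent_imp_Bseq by blast
  then obtain R0 where R0: "\<And>k. norm (M k) \<le> R0" by (auto simp: Bseq_def)
  define R where "R = max R0 (norm N)"
  have lR: "l k i \<in> {-R..R}" for k i using spectral_abs_le_norm[OF M, of k i] R0[of k] by (auto simp: R_def abs_le_iff)
  have mR: "m i \<in> {-R..R}" for i using spectral_abs_le_norm[OF N, of i] by (auto simp: R_def abs_le_iff)
  have fc: "continuous_on {-R..R} f" using f continuous_on_subset by blast
  define n where "n = real CARD('n)"
  have n0: "n > 0" by (simp add: n_def)
  have "uniformly_continuous_on {-R..R} f" using fc compact_uniformly_continuous by blast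
  then obtain d where d: "d > 0" "\<And>x y. x \<in> {-R..R} \<Longrightarrow> y \<in> {-R..R} \<Longrightarrow> dist y x < d \<Longrightarrow> dist (f y) (f x) < e / (2 * n)"
    using e n0 unfolding uniformly_continuous_on_def by (metis divide_pos_pos mult_pos_pos zero_less_numeral)
  have "bounded (f ` {-R..R})" using compact_continuous_image[OF fc] compact_imp_bounded by blast
  then obtain K where K: "\<forall>x\<in>{-R..R}. \<bar>f x\<bar> \<le> K" by (auto simp: bounded_iff)
  \<comment> \<open>Beyond distance \<open>d\<close> the quadratic term must exceed the oscillation
    \<open>2 * \<bar>K\<bar>\<close> of \<open>f\<close>; the summand 1 keeps \<open>C\<close>
    positive.\<close>
  define C where "C = 2 * \<bar>K\<bar> / d\<^sup>2 + 1"
  have C0: "C > 0" using d by (auto simp: C_def intro!: add_nonneg_pos)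
  have fb: "\<bar>f x - f y\<bar> \<le> e / (2 * n) + C * (x - y)\<^sup>2" if "x \<in> {-R..R}" "y \<in> {-R..R}" for x y
  proof (cases "dist x y < d")
    case True
    then have "\<bar>f x - f y\<bar> \<le> e / (2 * n)" using d(2)[OF that(2,1)] by (simp add: dist_real_def)
    moreover have "0 \<le> C * (x - y)\<^sup>2" using C0 by simp
    ultimately show ?thesis by linarith
  next
    case False
    then have "d\<^sup>2 \<le> \<bar>x - y\<bar>\<^sup>2" using d by (intro power_mono) (auto simp: dist_real_def)
    then have "2 * \<bar>K\<bar> / d\<^sup>2 * d\<^sup>2 \<le> C * (x - y)\<^sup>2"
      unfolding C_def by (intro mult_mono) auto
    then have "2 * \<bar>K\<bar> \<le> C * (x - y)\<^sup>2" using d by simp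
    moreover have "\<bar>f x - f y\<bar> \<le> 2 * \<bar>K\<bar>" using K[rule_format, OF that(1)] K[rule_format, OF that(2)] by linarith
    moreover have "0 \<le> e / (2 * n)" using e n0 by simp
    ultimately show ?thesis by linarith
  qed
  have bound: "\<bar>(\<Sum>i\<in>UNIV. f (l k i)) - (\<Sum>i\<in>UNIV. f (m i))\<bar> \<le> e / 2 + C * (norm (M k - N))\<^sup>2" for k
  proof -
    let ?p = "overlap (U k) V"
    have "\<bar>(\<Sum>i\<in>UNIV. f (l k i)) - (\<Sum>i\<in>UNIV. f (m i))\<bar> \<le> (\<Sum>i\<in>UNIV. \<Sum>j\<in>UNIV. \<bar>?p i j * (f (l k i) - f (m j))\<bar>)"
      unfolding overlap_transport[OF UV(1)[of k] UV(2), of "\<lambda>i. f (l k i)" "\<lambda>i. f (m i)"] by (intro order_trans[OF sum_abs] sum_mono sum_abs)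
    also have "\<dots> \<le> (\<Sum>i\<in>UNIV. \<Sum>j\<in>UNIV. ?p i j * (e / (2 * n) + C * (l k i - m j)\<^sup>2))"
      unfolding abs_mult using fb[OF lR mR] by (intro sum_mono mult_mono) auto
    also have "\<dots> = (\<Sum>i\<in>UNIV. (e / (2 * n)) * (\<Sum>j\<in>UNIV. ?p i j)) + C * (\<Sum>i\<in>UNIV. \<Sum>j\<in>UNIV. ?p i j * (l k i - m j)\<^sup>2)"
      by (simp add: sum_distrib_left distrib_left sum.distrib sum_divide_distrib mult_ac)
    also have "\<dots> = e / 2 + C * (norm (M k - N))\<^sup>2"
      using n0 by (simp add: overlap_sum_right[OF UV] overlap_cost[OF M N] n_def)
    finally show ?thesis .
  qed
  have "(\<lambda>k. C * (norm (M k - N))\<^sup>2) \<longlonglongrightarrow> C * (norm (N - N))\<^sup>2" by (intro tendsto_intros lim)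
  then have "(\<lambda>k. C * (norm (M k - N))\<^sup>2) \<longlonglongrightarrow> 0" by simp
  from LIMSEQ_D[OF this, of "e/2"] e obtain k0 where k0: "\<And>k. k \<ge> k0 \<Longrightarrow> \<bar>C * (norm (M k - N))\<^sup>2\<bar> < e / 2" by auto
  show "\<exists>no. \<forall>k\<ge>no. norm ((\<Sum>i\<in>UNIV. f (l k i)) - (\<Sum>i\<in>UNIV. f (m i))) < e"
  proof (intro exI[of _ k0] allI impI)
    fix k assume "k \<ge> k0"
    from k0[OF this] bound[of k] show "norm ((\<Sum>i\<in>UNIV. f (l k i)) - (\<Sum>i\<in>UNIV. f (m i))) < e"
      unfolding real_norm_def by linarith
  qed
qed

lemma spectral_decomp_scaleR:
  assumes "spectral_decomp M U l"
  shows "spectral_decomp (r *\<^sub>R M) U (\<lambda>i. r * l i)"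
proof -
  have "r *\<^sub>R (U ** dg l ** adj U) = U ** dg (\<lambda>i. r * l i) ** adj U"
    by (simp add: vec_eq_iff spectral_nth scaleR_sum_right) (simp add: scaleR_conv_of_real mult_ac)
  then show ?thesis using assms by (simp add: spectral_decomp_def)
qed

lemma hermitian_add: "hermitian_mat A \<Longrightarrow> hermitian_mat B \<Longrightarrow> hermitian_mat (A + B)"
  unfolding hermitian_mat_iff_adj by (simp add: vec_eq_iff)

lemma hermitian_scaleR: "hermitian_mat A \<Longrightarrow> hermitian_mat (r *\<^sub>R A)"
  unfolding hermitian_mat_iff_adj by (simp add: vec_eq_iff)

lemma hermitian_dg: "hermitian_mat (dg r)"
  by (simp add: hermitian_mat_iff_adj)

text \<open>Factoring \<open>y\<close> out of the pencil leaves \<open>A/y + e - s\<close>, whose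
  zeros in \<open>s\<close> are the eigenvalues of a Hermitian matrix. The terms
  \<open>ln \<bar>y\<bar>\<close> occur equally often in both sums and cancel.\<close>

lemma log_excess_spectral:
  fixes A :: "complex^'n^'n"
  assumes M: "spectral_decomp ((1 / y) *\<^sub>R A + dg e) U l" and y: "y \<noteq> 0"
    and s: "\<And>i. s \<noteq> l i" "\<And>i. s \<noteq> e i + Re (A $ i $ i) / y"
  shows "log_excess A e y s = (\<Sum>i\<in>UNIV. ln \<bar>s - l i\<bar> - ln \<bar>s - (e i + Re (A $ i $ i) / y)\<bar>)"
proof -
  have "y *\<^sub>R ((1 / y) *\<^sub>R A + dg e + dg (\<lambda>_. - s)) = A + dg (\<lambda>i. y * (e i - s))"
    using y by (simp add: vec_eq_iff dg_nth) (simp add: scaleR_conv_of_real algebra_simps)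
  with spectral_decomp_scaleR[OF spectral_decomp_shift[OF M, of "-s"], of y]
  have "spectral_decomp (A + dg (\<lambda>i. y * (e i - s))) U (\<lambda>i. y * (l i + - s))" by simp
  from det_spectral_decomp[OF this]
  have "cmod (det (A + dg (\<lambda>i. y * (e i - s)))) = (\<Prod>i\<in>UNIV. \<bar>y\<bar> * \<bar>s - l i\<bar>)"
    by (simp only: prod_norm[symmetric] norm_of_real abs_mult) (simp add: abs_minus_commute)
  then have 1: "ln (cmod (det (A + dg (\<lambda>i. y * (e i - s))))) = (\<Sum>i\<in>UNIV. ln \<bar>y\<bar> + ln \<bar>s - l i\<bar>)"
    using y s(1) by (simp add: ln_prod ln_mult)
  have "Re (A $ i $ i) + y * (e i - s) = - y * (s - (e i + Re (A $ i $ i) / y))" for i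
    using y by (simp add: field_simps)
  then have "ln \<bar>Re (A $ i $ i) + y * (e i - s)\<bar> = ln \<bar>y\<bar> + ln \<bar>s - (e i + Re (A $ i $ i) / y)\<bar>" for i
    using y s(2)[of i] by (simp only: abs_mult) (simp add: ln_mult)
  with 1 show ?thesis unfolding log_excess_def by (simp add: sum.distrib sum_subtractf)
qed

text \<open>The vectors \<open>e\<^sub>j + u w\<^sub>j\<close> of first-order perturbation theory are eigenvectors up to an error
  \<open>O(u\<^sup>2)\<close>, and the gaps of \<open>e\<close> make the resulting assignment of eigenvalues injective.\<close>

lemma second_order_eigenvalues:
  fixes A :: "complex^'n^'n"
  assumes A: "hermitian_mat A" and e: "inj e"
  shows "\<exists>C u0. u0 > 0 \<and> (\<forall>u U l. \<bar>u\<bar> < u0 \<longrightarrow> spectral_decomp (u *\<^sub>R A + dg e) U l \<longrightarrow>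
     (\<exists>h. bij h \<and> (\<forall>j. \<bar>l (h j) - (e j + u * Re (A $ j $ j))\<bar> \<le> C * u\<^sup>2)))"
proof -
  define w :: "'n \<Rightarrow> complex^'n" where
    "w = (\<lambda>j. \<chi> i. if i = j then 0 else - (A $ i $ j) / complex_of_real (e i - e j))"
  define R where "R = (\<lambda>j. A *v w j - complex_of_real (Re (A $ j $ j)) *s w j)"
  define C where "C = (\<Sum>j\<in>UNIV. norm (R j))"
  have C0: "C \<ge> 0" by (auto simp: C_def intro: sum_nonneg)
  have CR: "norm (R j) \<le> C" for j unfolding C_def by (rule member_le_sum) auto
  define a where "a = (\<Sum>j\<in>UNIV. \<bar>Re (A $ j $ j)\<bar>)"
  have a0: "a \<ge> 0" by (auto simp: a_def intro: sum_nonneg)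
  have aj: "\<bar>Re (A $ j $ j)\<bar> \<le> a" for j unfolding a_def by (rule member_le_sum) auto
  \<comment> \<open>The element 1 keeps the set nonempty for a one-element index type, which has no
    pair of distinct indices.\<close>
  define g where "g = Min (insert 1 ((\<lambda>(i, j). \<bar>e i - e j\<bar>) ` {(i, j). i \<noteq> j}))"
  have g0: "g > 0" unfolding g_def using e by (subst Min_gr_iff) (auto dest: injD)
  have g: "g \<le> \<bar>e i - e j\<bar>" if "i \<noteq> j" for i j unfolding g_def using that by (intro Min_le) auto
  \<comment> \<open>Two approximate eigenvalues drift together by at most
    \<open>2 * \<bar>u\<bar> * (a + C)\<close>, which must stay below the gap \<open>g\<close>; the
    bound 1 gives \<open>u\<^sup>2 \<le> \<bar>u\<bar>\<close>.\<close>
  define u0 where "u0 = min 1 (g / (2 * (a + C + 1)))"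
  have u00: "u0 > 0" using g0 a0 C0 by (simp add: u0_def)
  have main: "\<exists>h. bij h \<and> (\<forall>j. \<bar>l (h j) - (e j + u * Re (A $ j $ j))\<bar> \<le> C * u\<^sup>2)"
    if u: "\<bar>u\<bar> < u0" and M: "spectral_decomp (u *\<^sub>R A + dg e) U l" for u U l
  proof -
    define t where "t = (\<lambda>j. e j + u * Re (A $ j $ j))"
    have "\<exists>i. \<bar>l i - t j\<bar> \<le> C * u\<^sup>2" for j
    proof -
      define v where "v = axis j 1 + u *\<^sub>R w j"
      have "v $ j = 1" by (simp add: v_def w_def axis_def)
      then have v1: "norm v \<ge> 1" using Finite_Cartesian_Product.norm_nth_le[of v j] by simp
      have Av: "A *v v = (\<chi> i. A $ i $ j) + u *\<^sub>R (A *v w j)"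
        by (simp add: v_def vec_eq_iff matrix_vector_mult_def axis_def distrib_left sum.distrib
            mult_delta_right scaleR_sum_right)
      have "((u *\<^sub>R A + dg e) *v v - complex_of_real (t j) *s v) $ i = (u\<^sup>2 *\<^sub>R R j) $ i" for i
      proof -
        have "((u *\<^sub>R A + dg e) *v v) $ i = complex_of_real u * (A *v v) $ i + complex_of_real (e i) * v $ i"
          by (simp add: matrix_vector_mult_def dg_nth distrib_right sum.distrib mult_delta_left sum_distrib_left)
             (simp add: scaleR_conv_of_real mult_ac)
        also have "(A *v v) $ i = A $ i $ j + complex_of_real u * (A *v w j) $ i"
          unfolding Av by simp (simp add: scaleR_conv_of_real)
        finally have 1: "((u *\<^sub>R A + dg e) *v v - complex_of_real (t j) *s v) $ i
          = complex_of_real u * (A $ i $ j + complex_of_real u * (A *v w j) $ i) + complex_of_real (e i - t j) * v $ i"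
          by (simp add: algebra_simps)
        have Rj: "(u\<^sup>2 *\<^sub>R R j) $ i = complex_of_real (u\<^sup>2) * ((A *v w j) $ i - complex_of_real (Re (A $ j $ j)) * w j $ i)"
          by (simp add: R_def) (simp add: scaleR_conv_of_real)
        show ?thesis
        proof (cases "i = j")
          case True
          have "v $ j = 1" "w j $ j = 0" by (simp_all add: v_def w_def axis_def)
          then show ?thesis unfolding 1 Rj using True hermitian_mat_diag[OF A, of j]
            by (simp add: t_def algebra_simps power2_eq_square)
        next
          case False
          have vi: "v $ i = complex_of_real u * w j $ i" using False by (simp add: v_def axis_def) (simp add: scaleR_conv_of_real)
          have "e i - e j \<noteq> 0" using False e by (auto dest: injD)
          then have "complex_of_real (e i - e j) * w j $ i = - A $ i $ j"
            using False by (simp add: w_def)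
          then have Aij: "A $ i $ j = - (complex_of_real (e i - e j) * w j $ i)" by simp
          show ?thesis unfolding 1 Rj vi Aij
            by (simp add: t_def algebra_simps power2_eq_square)
        qed
      qed
      then have "(u *\<^sub>R A + dg e) *v v - complex_of_real (t j) *s v = u\<^sup>2 *\<^sub>R R j" by (simp add: vec_eq_iff)
      with spectral_residual[OF M, of "t j" v] obtain i where "\<bar>l i - t j\<bar> * norm v \<le> u\<^sup>2 * norm (R j)" by auto
      moreover have "\<bar>l i - t j\<bar> * 1 \<le> \<bar>l i - t j\<bar> * norm v" using v1 by (intro mult_left_mono) auto
      moreover have "u\<^sup>2 * norm (R j) \<le> u\<^sup>2 * C" using CR by (intro mult_left_mono) auto
      ultimately have "\<bar>l i - t j\<bar> \<le> C * u\<^sup>2" by (simp add: mult.commute)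
      then show ?thesis ..
    qed
    then obtain h where h: "\<And>j. \<bar>l (h j) - t j\<bar> \<le> C * u\<^sup>2" by metis
    have "inj h"
    proof (rule injI, rule ccontr)
      fix i j assume ij: "h i = h j" "i \<noteq> j"
      have u1: "\<bar>u\<bar> \<le> 1" and ug: "\<bar>u\<bar> < g / (2 * (a + C + 1))" using u by (auto simp: u0_def)
      have "u\<^sup>2 \<le> \<bar>u\<bar>" using u1 by (metis abs_ge_zero mult_left_le_one_le power2_abs power2_eq_square)
      then have Cu: "C * u\<^sup>2 \<le> C * \<bar>u\<bar>" using C0 by (intro mult_left_mono)
      have "\<bar>t i - t j\<bar> \<le> 2 * (C * u\<^sup>2)" using h[of i, unfolded ij(1)] h[of j] by linarith
      moreover have "\<bar>u * Re (A $ i $ i)\<bar> \<le> \<bar>u\<bar> * a" for i using aj[of i] by (simp add: abs_mult mult_left_mono)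
      from this[of i] this[of j] have "\<bar>e i - e j\<bar> \<le> \<bar>t i - t j\<bar> + 2 * (\<bar>u\<bar> * a)"
        unfolding t_def by linarith
      ultimately have "g \<le> 2 * (C * \<bar>u\<bar>) + 2 * (\<bar>u\<bar> * a)" using g[OF ij(2)] Cu by linarith
      also have "\<dots> \<le> \<bar>u\<bar> * (2 * (a + C + 1))" by (simp add: algebra_simps)
      also have "\<dots> < g" using ug a0 C0 by (simp add: pos_less_divide_eq)
      finally show False by simp
    qed
    then have "bij h" by (simp add: bij_def finite_UNIV_inj_surj)
    with h show ?thesis by (auto simp: t_def)
  qed
  show ?thesis using u00 main by blast
qed

section \<open>Total mass of the excess\<close>

lemma norm_dg_nth: "\<bar>r i\<bar> \<le> norm (dg r)"
  using spectral_abs_le_norm[OF spectral_decomp_dg] .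

lemma log_excess_AE_spectral:
  assumes M: "spectral_decomp ((1 / y) *\<^sub>R A + dg e) U l" and y: "y \<noteq> 0"
  shows "AE s in lborel. log_excess A e y s = (\<Sum>i\<in>UNIV. ln \<bar>s - l i\<bar> - ln \<bar>s - (e i + Re (A $ i $ i) / y)\<bar>)"
proof -
  have "AE s in lborel. (\<forall>i. s \<noteq> l i) \<and> (\<forall>i. s \<noteq> e i + Re (A $ i $ i) / y)"
    by (simp add: AE_all_countable AE_lborel_singleton)
  then show ?thesis by eventually_elim (rule log_excess_spectral[OF M y]; blast)
qed

text \<open>The logarithms of the eigenvalue factors enter as a symmetric sum, so in the absolute
  estimate any bijection \<open>h\<close> may decide which eigenvalue is compared with which
  diagonal entry.\<close>

lemma log_excess_set_integral:
  assumes M: "spectral_decomp ((1 / y) *\<^sub>R A + dg e) U l" and y: "y \<noteq> 0"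
  shows "set_integrable lborel {-1..1} (log_excess A e y)"
    and "(LINT s:{-1..1}|lborel. log_excess A e y s) = (\<Sum>i\<in>UNIV. lnavg (l i)) - (\<Sum>i\<in>UNIV. lnavg (e i + Re (A $ i $ i) / y))"
    and "bij h \<Longrightarrow> (LINT s:{-1..1}|lborel. \<bar>log_excess A e y s\<bar>) \<le>
      (\<Sum>i\<in>UNIV. LINT s:{-1..1}|lborel. \<bar>ln \<bar>s - l (h i)\<bar> - ln \<bar>s - (e i + Re (A $ i $ i) / y)\<bar>\<bar>)"
proof -
  define t where "t i = e i + Re (A $ i $ i) / y" for i
  have [measurable]: "log_excess A e y \<in> borel_measurable lborel"
    using log_excess_measurable'[of "\<lambda>_. y" lborel "\<lambda>s. s" A e] by simp
  have i: "set_integrable lborel {-1..1} (\<lambda>s. \<Sum>i\<in>UNIV. ln \<bar>s - l (g i)\<bar> - ln \<bar>s - t i\<bar>)" for g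
    by (intro set_integrable_finite_sum set_integral_diff ln_abs_set_integrable)
  have AE: "AE s in lborel. log_excess A e y s = (\<Sum>i\<in>UNIV. ln \<bar>s - l i\<bar> - ln \<bar>s - t i\<bar>)"
    using log_excess_AE_spectral[OF M y] by (simp add: t_def)
  show pi: "set_integrable lborel {-1..1} (log_excess A e y)"
  proof -
    have "set_integrable lborel {-1..1} (log_excess A e y) = set_integrable lborel {-1..1} (\<lambda>s. \<Sum>i\<in>UNIV. ln \<bar>s - l i\<bar> - ln \<bar>s - t i\<bar>)"
      by (rule set_integrable_cong_AE) (use AE in \<open>auto elim!: eventually_mono\<close>)
    then show ?thesis using i[of "\<lambda>i. i"] by simp
  qed
  have "(LINT s:{-1..1}|lborel. log_excess A e y s) = (LINT s:{-1..1}|lborel. \<Sum>i\<in>UNIV. ln \<bar>s - l i\<bar> - ln \<bar>s - t i\<bar>)"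
    by (rule set_lebesgue_integral_cong_AE) (use AE in \<open>auto elim!: eventually_mono\<close>)
  also have "\<dots> = (\<Sum>i\<in>UNIV. LINT s:{-1..1}|lborel. ln \<bar>s - l i\<bar> - ln \<bar>s - t i\<bar>)"
    by (intro set_integral_finite_sum set_integral_diff ln_abs_set_integrable)
  also have "\<dots> = (\<Sum>i\<in>UNIV. lnavg (l i) - lnavg (t i))"
    by (intro sum.cong refl) (simp add: set_integral_diff(2)[OF ln_abs_set_integrable ln_abs_set_integrable] lnavg_integral)
  finally show "(LINT s:{-1..1}|lborel. log_excess A e y s) = (\<Sum>i\<in>UNIV. lnavg (l i)) - (\<Sum>i\<in>UNIV. lnavg (e i + Re (A $ i $ i) / y))"
    by (simp add: sum_subtractf t_def)
  assume h: "bij h"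
  have re: "(\<Sum>i\<in>UNIV. ln \<bar>s - l i\<bar> - ln \<bar>s - t i\<bar>) = (\<Sum>i\<in>UNIV. ln \<bar>s - l (h i)\<bar> - ln \<bar>s - t i\<bar>)" for s
    using sum.reindex_bij_betw[OF h, of "\<lambda>i. ln \<bar>s - l i\<bar>"] by (simp add: sum_subtractf)
  have ai: "set_integrable lborel {-1..1} (\<lambda>s. \<bar>ln \<bar>s - l (h i)\<bar> - ln \<bar>s - t i\<bar>\<bar>)" for i
    by (intro set_integrable_abs set_integral_diff ln_abs_set_integrable)
  have "(LINT s:{-1..1}|lborel. \<bar>log_excess A e y s\<bar>) \<le> (LINT s:{-1..1}|lborel. \<Sum>i\<in>UNIV. \<bar>ln \<bar>s - l (h i)\<bar> - ln \<bar>s - t i\<bar>\<bar>)"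
  proof (rule set_integral_mono_AE)
    show "set_integrable lborel {-1..1} (\<lambda>s. \<bar>log_excess A e y s\<bar>)" using set_integrable_abs[OF pi] .
    show "set_integrable lborel {-1..1} (\<lambda>s. \<Sum>i\<in>UNIV. \<bar>ln \<bar>s - l (h i)\<bar> - ln \<bar>s - t i\<bar>\<bar>)"
      by (intro set_integrable_finite_sum ai)
    show "AE s\<in>{-1..1} in lborel. \<bar>log_excess A e y s\<bar> \<le> (\<Sum>i\<in>UNIV. \<bar>ln \<bar>s - l (h i)\<bar> - ln \<bar>s - t i\<bar>\<bar>)"
      using AE
    proof eventually_elim
      case (elim s)
      then show ?case by (simp only: re) simp
    qed
  qed
  also have "\<dots> = (\<Sum>i\<in>UNIV. LINT s:{-1..1}|lborel. \<bar>ln \<bar>s - l (h i)\<bar> - ln \<bar>s - t i\<bar>\<bar>)"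
    by (intro set_integral_finite_sum ai)
  finally show "(LINT s:{-1..1}|lborel. \<bar>log_excess A e y s\<bar>) \<le>
      (\<Sum>i\<in>UNIV. LINT s:{-1..1}|lborel. \<bar>ln \<bar>s - l (h i)\<bar> - ln \<bar>s - (e i + Re (A $ i $ i) / y)\<bar>\<bar>)"
    by (simp add: t_def)
qed

lemma log_excess_spectral_exists:
  assumes "hermitian_mat A"
  shows "\<exists>U l. spectral_decomp ((1 / y) *\<^sub>R A + dg e) U l"
  by (intro hermitian_spectral_decomp hermitian_add hermitian_scaleR hermitian_dg assms)

lemma pencil_norm_le:
  "norm ((1 / y) *\<^sub>R A + dg e) \<le> norm A / \<bar>y\<bar> + norm (dg e)"
  using norm_triangle_ineq[of "(1 / y) *\<^sub>R A" "dg e"] by (simp add: divide_inverse mult.commute)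

lemma pencil_diag_le:
  "\<bar>e i + Re (A $ i $ i) / y\<bar> \<le> norm ((1 / y) *\<^sub>R A + dg e)"
proof -
  let ?M = "(1 / y) *\<^sub>R A + dg e"
  have "e i + Re (A $ i $ i) / y = Re (?M $ i $ i)" by (simp add: dg_nth)
  also have "\<bar>\<dots>\<bar> \<le> cmod (?M $ i $ i)" by (rule abs_Re_le_cmod)
  also have "\<dots> \<le> norm ?M"
    using Finite_Cartesian_Product.norm_nth_le[of "?M $ i" i] Finite_Cartesian_Product.norm_nth_le[of ?M i] by linarith
  finally show ?thesis .
qed

text \<open>For small \<open>y\<close> the pencil has norm of order
  \<open>norm A / \<bar>y\<bar>\<close>, so the logarithm of any quantity bounded by this norm is
  dominated by \<open>1 / sqrt \<bar>y\<bar>\<close>.\<close>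

lemma ln_bound_small:
  fixes A :: "complex^'n^'n"
  assumes "norm (dg e :: complex^'n^'n) \<le> 1/4" "y \<noteq> 0" "\<bar>r\<bar> \<le> norm ((1 / y) *\<^sub>R A + dg e)"
  shows "2 + 4 * ln (2 + \<bar>r\<bar>) \<le> 20 * (1 + sqrt (norm A)) * (1 + 1 / sqrt \<bar>y\<bar>)"
proof -
  have "\<bar>r\<bar> \<le> norm A / \<bar>y\<bar> + 1" using assms pencil_norm_le[of y A e] by linarith
  then have "sqrt \<bar>r\<bar> \<le> sqrt (norm A / \<bar>y\<bar> + 1)" by simp
  also have "\<dots> \<le> sqrt (norm A / \<bar>y\<bar>) + sqrt 1" by (rule sqrt_add_le_add_sqrt) auto
  also have "\<dots> = sqrt (norm A) * (1 / sqrt \<bar>y\<bar>) + 1" by (simp add: real_sqrt_divide)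
  finally have 1: "sqrt \<bar>r\<bar> \<le> sqrt (norm A) * (1 / sqrt \<bar>y\<bar>) + 1" .
  define p q where "p = sqrt (norm A)" and "q = 1 / sqrt \<bar>y\<bar>"
  have pq: "p \<ge> 0" "q \<ge> 0" by (auto simp: p_def q_def)
  have "2 + 4 * ln (2 + \<bar>r\<bar>) \<le> 10 * (1 + sqrt \<bar>r\<bar>)" by (rule ln_le_sqrt) simp
  also have "\<dots> \<le> 10 * (1 + (p * q + 1))" using 1 by (simp add: p_def q_def)
  also have "\<dots> \<le> 20 * (1 + p) * (1 + q)" using pq by (simp add: algebra_simps)
  finally show ?thesis by (simp add: p_def q_def)
qed

text \<open>The off-diagonal part of the pencil is that of \<open>A/y\<close>, from which
  \<open>e\<close> has dropped out; \<open>lnavg_trace_diag\<close> thus gives one constant for all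
  small \<open>e\<close>. This uniformity supplies the dominating function when \<open>e\<close>
  shrinks to 0.\<close>

lemma log_excess_integral_uniform_bound:
  fixes A :: "complex^'n^'n"
  assumes A: "hermitian_mat A"
  shows "\<exists>C\<ge>0. \<forall>e y. norm (dg e :: complex^'n^'n) \<le> 1/4 \<longrightarrow> y \<noteq> 0 \<longrightarrow>
    \<bar>LINT s:{-1..1}|lborel. log_excess A e y s\<bar> \<le> C * tailweight y"
proof -
  define n where "n = real CARD('n)"
  define K where "K = 2 * n * (20 * (1 + sqrt (norm A))) + 4 * (norm (A - dg (\<lambda>j. Re (A $ j $ j))))\<^sup>2"
  \<comment> \<open>For \<open>\<bar>y\<bar> \<ge> Y\<close> the part \<open>A/y\<close> has norm at
    most \<open>1/4\<close>, so the pencil stays within the radius \<open>1/2\<close> of the Taylor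
    estimate.\<close>
  define Y where "Y = 1 + 4 * norm A"
  have Y1: "Y \<ge> 1" by (simp add: Y_def)
  have K1: "2 * n * (20 * (1 + sqrt (norm A))) \<le> K" "4 * (norm (A - dg (\<lambda>j. Re (A $ j $ j))))\<^sup>2 \<le> K" "K \<ge> 0"
    by (auto simp: K_def n_def)
  have "\<bar>LINT s:{-1..1}|lborel. log_excess A e y s\<bar> \<le> 2 * K * Y\<^sup>2 * tailweight y"
    if e: "norm (dg e :: complex^'n^'n) \<le> 1/4" and y: "y \<noteq> 0" for e y
  proof (rule le_tailweight)
    obtain U l where M: "spectral_decomp ((1 / y) *\<^sub>R A + dg e) U l" using log_excess_spectral_exists[OF A] by blast
    note eq = log_excess_set_integral(2)[OF M y]
    let ?M = "(1 / y) *\<^sub>R A + dg e"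
    define t where "t i = e i + Re (A $ i $ i) / y" for i
    show "\<bar>LINT s:{-1..1}|lborel. log_excess A e y s\<bar> \<le> K * (1 + 1 / sqrt \<bar>y\<bar>)"
    proof -
      define B where "B = 20 * (1 + sqrt (norm A)) * (1 + 1 / sqrt \<bar>y\<bar>)"
      have "\<bar>lnavg (l i)\<bar> \<le> B" for i
        using abs_lnavg_le[of "l i"] ln_bound_small[OF e y spectral_abs_le_norm[OF M, of i]]
        unfolding B_def by linarith
      then have 1: "(\<Sum>i\<in>UNIV. \<bar>lnavg (l i)\<bar>) \<le> (\<Sum>i\<in>(UNIV::'n set). B)" by (intro sum_mono) simp
      have "\<bar>lnavg (t i)\<bar> \<le> B" for i
        using abs_lnavg_le[of "t i"] ln_bound_small[OF e y pencil_diag_le[of e i A y]]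
        unfolding t_def B_def by linarith
      then have 2: "(\<Sum>i\<in>UNIV. \<bar>lnavg (t i)\<bar>) \<le> (\<Sum>i\<in>(UNIV::'n set). B)" by (intro sum_mono) simp
      have "\<bar>\<Sum>i\<in>UNIV. lnavg (l i)\<bar> \<le> n * B" "\<bar>\<Sum>i\<in>UNIV. lnavg (t i)\<bar> \<le> n * B"
        using order_trans[OF sum_abs 1] order_trans[OF sum_abs 2] by (simp_all add: n_def)
      then have "\<bar>LINT s:{-1..1}|lborel. log_excess A e y s\<bar> \<le> 2 * (n * B)"
        unfolding eq[folded t_def] by linarith
      also have "\<dots> = (2 * n * (20 * (1 + sqrt (norm A)))) * (1 + 1 / sqrt \<bar>y\<bar>)" by (simp add: B_def)
      also have "\<dots> \<le> K * (1 + 1 / sqrt \<bar>y\<bar>)" using K1(1) by (intro mult_right_mono) auto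
      finally show ?thesis .
    qed
    show "\<bar>LINT s:{-1..1}|lborel. log_excess A e y s\<bar> \<le> K * \<bar>y\<bar> powr (-3/2)" if yY: "\<bar>y\<bar> \<ge> Y"
    proof -
      have "norm A / \<bar>y\<bar> \<le> 1/4" using yY y by (simp add: Y_def field_simps)
      then have nM: "norm ?M \<le> 1/2" using pencil_norm_le[of y A e] e by linarith
      have ti: "Re (?M $ i $ i) = t i" for i by (simp add: t_def dg_nth)
      have "?M - dg (\<lambda>j. Re (?M $ j $ j)) = (1 / y) *\<^sub>R (A - dg (\<lambda>j. Re (A $ j $ j)))"
        unfolding ti by (simp add: vec_eq_iff dg_nth t_def) (simp add: scaleR_conv_of_real algebra_simps)
      then have "norm (?M - dg (\<lambda>j. Re (?M $ j $ j))) = norm (A - dg (\<lambda>j. Re (A $ j $ j))) / \<bar>y\<bar>"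
        by (simp add: divide_inverse mult.commute)
      with lnavg_trace_diag[OF M nM]
      have "\<bar>LINT s:{-1..1}|lborel. log_excess A e y s\<bar> \<le> 4 * (norm (A - dg (\<lambda>j. Re (A $ j $ j))) / \<bar>y\<bar>)\<^sup>2"
        unfolding eq t_def[symmetric] ti by (simp add: t_def)
      also have "\<dots> = (4 * (norm (A - dg (\<lambda>j. Re (A $ j $ j))))\<^sup>2) * \<bar>y\<bar> powr (-2)"
        using y by (simp add: power_mult_distrib powr_minus divide_inverse power_inverse)
      also have "\<dots> \<le> K * \<bar>y\<bar> powr (-3/2)"
        using K1 yY Y1 by (intro mult_mono powr_mono) auto
      finally show ?thesis .
    qed
  qed (use Y1 K1 y in auto)
  then show ?thesis using K1(3) Y1 by (intro exI[of _ "2 * K * Y\<^sup>2"]) auto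
qed

text \<open>The absolute integral required by Fubini. Cancellation between eigenvalues is lost here,
  so each must lie within \<open>C / y\<^sup>2\<close> of its own diagonal entry; \<open>C\<close>
  and \<open>u0\<close> come from second-order perturbation theory for the fixed
  \<open>e\<close>.\<close>

lemma log_excess_L1_bound:
  fixes A :: "complex^'n^'n"
  assumes A: "hermitian_mat A" and inj: "inj e" and e: "norm (dg e :: complex^'n^'n) \<le> 1/4"
  shows "\<exists>C\<ge>0. \<forall>y. y \<noteq> 0 \<longrightarrow> (LINT s:{-1..1}|lborel. \<bar>log_excess A e y s\<bar>) \<le> C * tailweight y"
proof -
  obtain C u0 where C: "u0 > 0" "\<And>u U l. \<bar>u\<bar> < u0 \<Longrightarrow> spectral_decomp (u *\<^sub>R A + dg e) U l \<Longrightarrow>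
     (\<exists>h. bij h \<and> (\<forall>j. \<bar>l (h j) - (e j + u * Re (A $ j $ j))\<bar> \<le> C * u\<^sup>2))"
    using second_order_eigenvalues[OF A inj] by metis
  define n where "n = real CARD('n)"
  define K where "K = 2 * n * (20 * (1 + sqrt (norm A))) + n * (20 * \<bar>C\<bar> powr (3/4))"
  define Y where "Y = 1 + 4 * norm A + 1 / u0"
  have Y1: "Y \<ge> 1" using C by (simp add: Y_def)
  have K1: "2 * n * (20 * (1 + sqrt (norm A))) \<le> K" "n * (20 * \<bar>C\<bar> powr (3/4)) \<le> K" "K \<ge> 0"
    by (auto simp: K_def n_def)
  have "(LINT s:{-1..1}|lborel. \<bar>log_excess A e y s\<bar>) \<le> 2 * K * Y\<^sup>2 * tailweight y"
    if y: "y \<noteq> 0" for y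
  proof (rule le_tailweight)
    obtain U l where M: "spectral_decomp ((1 / y) *\<^sub>R A + dg e) U l" using log_excess_spectral_exists[OF A] by blast
    let ?M = "(1 / y) *\<^sub>R A + dg e"
    define t where "t i = e i + Re (A $ i $ i) / y" for i
    note le = log_excess_set_integral(3)[OF M y, folded t_def]
    show "(LINT s:{-1..1}|lborel. \<bar>log_excess A e y s\<bar>) \<le> K * (1 + 1 / sqrt \<bar>y\<bar>)"
    proof -
      define B where "B = 20 * (1 + sqrt (norm A)) * (1 + 1 / sqrt \<bar>y\<bar>)"
      have "(LINT s:{-1..1}|lborel. \<bar>ln \<bar>s - l i\<bar> - ln \<bar>s - t i\<bar>\<bar>) \<le> B + B" for i
      proof -
        have ai: "set_integrable lborel {-1..1} (\<lambda>s. \<bar>ln \<bar>s - r\<bar>\<bar>)" for r :: real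
          using set_integrable_abs[OF ln_abs_set_integrable[of "-1" 1 r]] .
        have "(LINT s:{-1..1}|lborel. \<bar>ln \<bar>s - l i\<bar> - ln \<bar>s - t i\<bar>\<bar>) \<le> (LINT s:{-1..1}|lborel. \<bar>ln \<bar>s - l i\<bar>\<bar> + \<bar>ln \<bar>s - t i\<bar>\<bar>)"
          by (rule set_integral_mono)
             (auto intro!: set_integrable_abs set_integral_diff set_integral_add ln_abs_set_integrable ai)
        also have "\<dots> = (LINT s:{-1..1}|lborel. \<bar>ln \<bar>s - l i\<bar>\<bar>) + (LINT s:{-1..1}|lborel. \<bar>ln \<bar>s - t i\<bar>\<bar>)"
          by (rule set_integral_add(2)[OF ai ai])
        also have "\<dots> \<le> B + B"
          using ln_abs_L1_bound[of "l i"] ln_bound_small[OF e y spectral_abs_le_norm[OF M, of i]]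
            ln_abs_L1_bound[of "t i"] ln_bound_small[OF e y pencil_diag_le[of e i A y]]
          unfolding t_def B_def by linarith
        finally show ?thesis .
      qed
      then have "(\<Sum>i\<in>UNIV. LINT s:{-1..1}|lborel. \<bar>ln \<bar>s - l i\<bar> - ln \<bar>s - t i\<bar>\<bar>) \<le> (\<Sum>i\<in>(UNIV::'n set). B + B)"
        by (intro sum_mono)
      with le[OF bij_id[unfolded id_def]] have "(LINT s:{-1..1}|lborel. \<bar>log_excess A e y s\<bar>) \<le> n * (B + B)" by (simp add: n_def)
      also have "\<dots> = (2 * n * (20 * (1 + sqrt (norm A)))) * (1 + 1 / sqrt \<bar>y\<bar>)" by (simp add: B_def)
      also have "\<dots> \<le> K * (1 + 1 / sqrt \<bar>y\<bar>)" using K1(1) by (intro mult_right_mono) auto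
      finally show ?thesis .
    qed
    show "(LINT s:{-1..1}|lborel. \<bar>log_excess A e y s\<bar>) \<le> K * \<bar>y\<bar> powr (-3/2)" if yY: "\<bar>y\<bar> \<ge> Y"
    proof -
      have "1 / u0 > 0" using C(1) by simp
      then have "4 * norm A \<le> \<bar>y\<bar>" using yY unfolding Y_def by linarith
      then have "norm A / \<bar>y\<bar> \<le> 1/4" using y by (simp add: field_simps)
      then have nM: "norm ?M \<le> 1/2" using pencil_norm_le[of y A e] e by linarith
      have "\<bar>y\<bar> > 1 / u0" using yY by (simp add: Y_def) (smt (verit) norm_ge_zero)
      then have "\<bar>1 / y\<bar> < u0" using y C(1) by (simp add: field_simps abs_divide)
      from C(2)[OF this M] obtain h where h: "bij h" "\<And>j. \<bar>l (h j) - t j\<bar> \<le> C * (1 / y)\<^sup>2"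
        by (auto simp: t_def)
      have lt: "\<bar>l i\<bar> \<le> 1/2" "\<bar>t i\<bar> \<le> 1/2" for i
        using spectral_abs_le_norm[OF M, of i] pencil_diag_le[of e i A y] nM by (auto simp: t_def)
      have "(LINT s:{-1..1}|lborel. \<bar>ln \<bar>s - l (h i)\<bar> - ln \<bar>s - t i\<bar>\<bar>) \<le> 20 * \<bar>C\<bar> powr (3/4) * \<bar>y\<bar> powr (-3/2)" for i
      proof -
        have "(LINT s:{-1..1}|lborel. \<bar>ln \<bar>s - l (h i)\<bar> - ln \<bar>s - t i\<bar>\<bar>) \<le> 20 * \<bar>l (h i) - t i\<bar> powr (3/4)"
          by (rule ln_abs_diff_L1_bound[OF lt(1) lt(2)])
        also have "\<bar>l (h i) - t i\<bar> powr (3/4) \<le> (\<bar>C\<bar> * \<bar>y\<bar> powr (-2)) powr (3/4)"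
        proof (rule powr_mono2)
          have "C * (1 / y)\<^sup>2 \<le> \<bar>C\<bar> * (1 / y)\<^sup>2" by (intro mult_right_mono) auto
          with h(2)[of i] have "\<bar>l (h i) - t i\<bar> \<le> \<bar>C\<bar> * (1 / y)\<^sup>2" by linarith
          also have "(1 / y)\<^sup>2 = \<bar>y\<bar> powr (-2)" using y by (simp add: powr_minus power_divide divide_inverse power_inverse)
          finally show "\<bar>l (h i) - t i\<bar> \<le> \<bar>C\<bar> * \<bar>y\<bar> powr (-2)" .
        qed auto
        also have "(\<bar>C\<bar> * \<bar>y\<bar> powr (-2)) powr (3/4) = \<bar>C\<bar> powr (3/4) * \<bar>y\<bar> powr (-3/2)"
          by (simp add: powr_mult powr_powr)
        finally show ?thesis by simp
      qed
      then have "(\<Sum>i\<in>UNIV. LINT s:{-1..1}|lborel. \<bar>ln \<bar>s - l (h i)\<bar> - ln \<bar>s - t i\<bar>\<bar>) \<le> (\<Sum>i\<in>(UNIV::'n set). 20 * \<bar>C\<bar> powr (3/4) * \<bar>y\<bar> powr (-3/2))"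
        by (intro sum_mono)
      with le[OF h(1)] have "(LINT s:{-1..1}|lborel. \<bar>log_excess A e y s\<bar>) \<le> n * (20 * \<bar>C\<bar> powr (3/4)) * \<bar>y\<bar> powr (-3/2)" by (simp add: n_def)
      also have "\<dots> \<le> K * \<bar>y\<bar> powr (-3/2)" using K1 by (intro mult_right_mono) auto
      finally show ?thesis .
    qed
  qed (use Y1 K1 y in auto)
  then show ?thesis using K1(3) Y1 by (intro exI[of _ "2 * K * Y\<^sup>2"]) auto
qed

lemma excess_measurable [measurable]: "excess A b \<in> borel_measurable borel"
proof -
  have "(\<lambda>p. log_excess A b (snd p) (fst p)) \<in> borel_measurable (borel \<Otimes>\<^sub>M lborel)"
    by (rule log_excess_measurable') measurable
  then have "(\<lambda>s. LINT x|lborel. log_excess A b x s) \<in> borel_measurable borel"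
    by (intro lborel.borel_measurable_lebesgue_integral) (simp add: split_beta')
  then show ?thesis by (simp add: excess_def[abs_def])
qed

lemma AE_not_in_range:
  fixes b :: "'n::finite \<Rightarrow> real" shows "AE s in lborel. s \<notin> range b"
proof -
  have "AE s in lborel. \<forall>i. s \<noteq> b i" by (simp add: AE_all_countable AE_lborel_singleton)
  then show ?thesis by eventually_elim auto
qed

text \<open>The window makes the pair integral finite and costs nothing: for \<open>s\<close>
  outside \<open>{-1..1}\<close> all \<open>e i - s\<close> have the same sign, and the integral
  over \<open>y\<close> is already 0.\<close>

lemma log_excess_fubini:
  fixes A :: "complex^'n^'n"
  assumes A: "hermitian_mat A" and inj: "inj e" and e: "norm (dg e :: complex^'n^'n) \<le> 1/4"
  shows "integrable lborel (\<lambda>y. LINT s:{-1..1}|lborel. log_excess A e y s)"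
    and "(\<integral>\<^sup>+s. ennreal (excess A e s) \<partial>lborel) = ennreal (LINT y|lborel. (LINT s:{-1..1}|lborel. log_excess A e y s))"
proof -
  obtain C where C: "C \<ge> 0" "\<And>y. y \<noteq> 0 \<Longrightarrow> (LINT s:{-1..1}|lborel. \<bar>log_excess A e y s\<bar>) \<le> C * tailweight y"
    using log_excess_L1_bound[OF assms] by blast
  define F where "F = (\<lambda>y s. indicat_real {-1..1} s * log_excess A e y s)"
  have Fm [measurable]: "case_prod F \<in> borel_measurable (lborel \<Otimes>\<^sub>M lborel)"
  proof -
    have [measurable]: "(\<lambda>p. log_excess A e (fst p) (snd p)) \<in> borel_measurable (lborel \<Otimes>\<^sub>M lborel)"
      by (rule log_excess_measurable') measurable
    show ?thesis unfolding F_def split_beta' by measurable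
  qed
  have F: "integrable (lborel \<Otimes>\<^sub>M lborel) (case_prod F)"
  proof (rule lborel_pair.Fubini_integrable[OF Fm])
    have eq: "(LINT s|lborel. norm (case_prod F (y, s))) = (LINT s:{-1..1}|lborel. \<bar>log_excess A e y s\<bar>)" for y
      by (simp add: F_def set_lebesgue_integral_def abs_mult)
    show "integrable lborel (\<lambda>y. LINT s|lborel. norm (case_prod F (y, s)))"
    proof (rule Bochner_Integration.integrable_bound[OF integrable_mult_right[OF tailweight_integrable, of C]])
      show "(\<lambda>y. LINT s|lborel. norm (case_prod F (y, s))) \<in> borel_measurable lborel"
        by (intro lborel.borel_measurable_lebesgue_integral) measurable
      have "norm (LINT s:{-1..1}|lborel. \<bar>log_excess A e y s\<bar>) \<le> norm (C * tailweight y)" if "y \<noteq> 0" for y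
      proof -
        have "0 \<le> (LINT s:{-1..1}|lborel. \<bar>log_excess A e y s\<bar>)"
          unfolding set_lebesgue_integral_def by (intro integral_nonneg_AE) auto
        then show ?thesis using C(2)[OF that] C(1) by simp
      qed
      then show "AE y in lborel. norm (LINT s|lborel. norm (case_prod F (y, s))) \<le> norm (C * tailweight y)"
        unfolding eq using AE_lborel_singleton[of 0] by (auto elim!: eventually_mono)
    qed
    have "integrable lborel (\<lambda>s. case_prod F (y, s))" if y: "y \<noteq> 0" for y
    proof -
      obtain U l where M: "spectral_decomp ((1 / y) *\<^sub>R A + dg e) U l" using log_excess_spectral_exists[OF A] by blast
      from log_excess_set_integral(1)[OF M y] show ?thesis by (simp add: set_integrable_def F_def)
    qed
    then show "AE y in lborel. integrable lborel (\<lambda>s. case_prod F (y, s))"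
      using AE_lborel_singleton[of 0] by (auto elim!: eventually_mono)
  qed
  have Fs: "(LINT s|lborel. F y s) = (LINT s:{-1..1}|lborel. log_excess A e y s)" for y
    by (simp add: F_def set_lebesgue_integral_def)
  have Fy: "(LINT y|lborel. F y s) = indicator {-1..1} s * excess A e s" for s
    by (simp add: F_def excess_def)
  show "integrable lborel (\<lambda>y. LINT s:{-1..1}|lborel. log_excess A e y s)"
    using lborel_pair.integrable_fst'[OF F] by (simp add: Fs)
  have int: "integrable lborel (\<lambda>s. indicator {-1..1} s * excess A e s)"
    using lborel_pair.integrable_snd[OF F] by (simp add: Fy)
  have eb: "\<bar>e i\<bar> < 1" for i using norm_dg_nth[of e i] e by linarith
  have AE: "AE s in lborel. excess A e s = indicator {-1..1} s * excess A e s \<and> 0 \<le> excess A e s"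
    using AE_not_in_range[of e]
  proof eventually_elim
    case (elim s)
    have "excess A e s = 0" if "s \<notin> {-1..1}"
    proof (rule excess_eq_0[OF A])
      have "s < -1 \<or> s > 1" using that by auto
      then show "(\<forall>i. s < e i) \<or> (\<forall>i. e i < s)" using eb by (smt (verit))
    qed
    then show ?case using excess_nonneg[OF A elim] by (auto simp: indicator_def)
  qed
  have "(\<integral>\<^sup>+s. ennreal (excess A e s) \<partial>lborel) = (\<integral>\<^sup>+s. ennreal (indicator {-1..1} s * excess A e s) \<partial>lborel)"
    using AE by (intro nn_integral_cong_AE) (auto elim!: eventually_mono)
  also have "\<dots> = ennreal (LINT s|lborel. indicator {-1..1} s * excess A e s)"
  proof (intro nn_integral_eq_integral int)
    show "AE s in lborel. 0 \<le> indicator {-1..1} s * excess A e s"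
      using AE by eventually_elim simp
  qed
  also have "(LINT s|lborel. indicator {-1..1} s * excess A e s) = (LINT y|lborel. (LINT s:{-1..1}|lborel. log_excess A e y s))"
    using lborel_pair.Fubini_integral[OF F] by (simp add: Fs Fy)
  finally show "(\<integral>\<^sup>+s. ennreal (excess A e s) \<partial>lborel) = ennreal (LINT y|lborel. (LINT s:{-1..1}|lborel. log_excess A e y s))" .
qed

text \<open>Dividing \<open>b\<close> and \<open>s\<close> by \<open>S\<close> is undone by
  multiplying the integration variable by \<open>S\<close>, whose Jacobian is the factor
  \<open>1 / S\<close>.\<close>

lemma excess_scale:
  assumes "S > 0"
  shows "excess A b s = (1 / S) * excess A (\<lambda>i. b i / S) (s / S)"
proof -
  have "log_excess A b x s = log_excess A (\<lambda>i. b i / S) (0 + S * x) (s / S)" for x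
    using assms by (simp add: log_excess_def right_diff_distrib)
  then have "excess A b s = (LINT x|lborel. log_excess A (\<lambda>i. b i / S) (0 + S * x) (s / S))" by (simp add: excess_def)
  then show ?thesis
    using lborel_integral_real_affine[of S "\<lambda>x. log_excess A (\<lambda>i. b i / S) x (s / S)" 0] assms
    by (simp add: excess_def)
qed

lemma excess_nn_integral_scale:
  assumes "S > 0"
  shows "(\<integral>\<^sup>+s. ennreal (excess A b s) \<partial>lborel) = (\<integral>\<^sup>+s. ennreal (excess A (\<lambda>i. b i / S) s) \<partial>lborel)"
proof -
  have "(\<integral>\<^sup>+s. ennreal (excess A (\<lambda>i. b i / S) s) \<partial>lborel) = \<bar>1 / S\<bar> * (\<integral>\<^sup>+s. ennreal (excess A (\<lambda>i. b i / S) (0 + 1 / S * s)) \<partial>lborel)"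
    using assms by (intro nn_integral_real_affine) auto
  also have "\<dots> = (\<integral>\<^sup>+s. \<bar>1 / S\<bar> * ennreal (excess A (\<lambda>i. b i / S) (0 + 1 / S * s)) \<partial>lborel)"
    by (intro nn_integral_cmult[symmetric]) measurable
  also have "\<dots> = (\<integral>\<^sup>+s. ennreal (excess A b s) \<partial>lborel)"
    unfolding excess_scale[OF assms, of A b]
    using assms by (intro nn_integral_cong) (simp add: ennreal_mult'[symmetric])
  finally show ?thesis ..
qed

text \<open>By scale invariance \<open>b\<close> may be replaced by \<open>b / S\<close>. As \<open>S\<close> tends to infinity the pencil becomes
  \<open>A - y s\<close>, whose contribution splits over the eigenvalues of \<open>A\<close> and is homogeneous in each.\<close>

theorem excess_nn_integral:
  fixes A :: "complex^'n^'n"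
  assumes A: "hermitian_mat A" and inj: "inj b" and UA: "spectral_decomp A U a"
  shows "(\<integral>\<^sup>+s. ennreal (excess A b s) \<partial>lborel) =
     ennreal (kappa * ((\<Sum>i\<in>UNIV. \<bar>a i\<bar>) - (\<Sum>i\<in>UNIV. \<bar>Re (A $ i $ i)\<bar>)))"
proof -
  \<comment> \<open>The term \<open>4 * norm (dg b)\<close> brings the scaled diagonal below
    \<open>1/4\<close>, and \<open>real k\<close> sends it to 0.\<close>
  define S where "S k = 1 + 4 * norm (dg b :: complex^'n^'n) + real k" for k
  have S0: "S k > 0" for k by (auto simp: S_def intro!: add_pos_nonneg)
  define e where "e k = (\<lambda>i. b i / S k)" for k
  have dge: "dg (e k) = (1 / S k) *\<^sub>R dg b" for k
    by (simp add: vec_eq_iff dg_nth e_def) (simp add: scaleR_conv_of_real)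
  have Slim: "(\<lambda>k. 1 / S k) \<longlonglongrightarrow> 0"
  proof -
    have "(\<lambda>k. 1 / (1 + 4 * c + real k)) \<longlonglongrightarrow> 0" for c :: real by real_asymp
    then show ?thesis by (simp add: S_def)
  qed
  have elim: "(\<lambda>k. dg (e k) :: complex^'n^'n) \<longlonglongrightarrow> 0"
    unfolding dge using tendsto_scaleR[OF Slim tendsto_const] by simp
  have e_lim: "(\<lambda>k. e k i) \<longlonglongrightarrow> 0" for i
    unfolding e_def using tendsto_mult[OF tendsto_const Slim, of "b i"] by simp
  have en: "norm (dg (e k) :: complex^'n^'n) \<le> 1/4" for k
    unfolding dge using S0[of k] by (simp add: field_simps) (simp add: S_def)
  have einj: "inj (e k)" for k using inj S0[of k] by (simp add: inj_def e_def)
  obtain C where C: "C \<ge> 0" "\<And>e y. norm (dg e :: complex^'n^'n) \<le> 1/4 \<Longrightarrow> y \<noteq> 0 \<Longrightarrow>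
      \<bar>LINT s:{-1..1}|lborel. log_excess A e y s\<bar> \<le> C * tailweight y"
    using log_excess_integral_uniform_bound[OF A] by blast
  define H where "H k y = (LINT s:{-1..1}|lborel. log_excess A (e k) y s)" for k y
  define H0 where "H0 y = (\<Sum>i\<in>UNIV. lnavg (a i / y)) - (\<Sum>i\<in>UNIV. lnavg (Re (A $ i $ i) / y))" for y
  have lim: "(\<lambda>k. LINT y|lborel. H k y) \<longlonglongrightarrow> (LINT y|lborel. H0 y)"
  proof (rule integral_dominated_convergence[OF _ _ integrable_mult_right[OF tailweight_integrable, of C]])
    show "H0 \<in> borel_measurable lborel" unfolding H0_def by measurable
    show "H k \<in> borel_measurable lborel" for k
      using log_excess_fubini(1)[OF A einj en] by (auto simp: H_def[abs_def])
    have "(\<lambda>k. H k y) \<longlonglongrightarrow> H0 y" if y: "y \<noteq> 0" for y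
    proof -
      have "\<forall>k. \<exists>U l. spectral_decomp ((1 / y) *\<^sub>R A + dg (e k)) U l"
        using log_excess_spectral_exists[OF A] by blast
      then obtain U' l where M: "\<And>k. spectral_decomp ((1 / y) *\<^sub>R A + dg (e k)) (U' k) (l k)"
        unfolding choice_iff by blast
      have N: "spectral_decomp ((1 / y) *\<^sub>R A) U (\<lambda>i. (1 / y) * a i)" by (rule spectral_decomp_scaleR[OF UA])
      have 1: "(\<lambda>k. (1 / y) *\<^sub>R A + dg (e k)) \<longlonglongrightarrow> (1 / y) *\<^sub>R A"
        using tendsto_add[OF tendsto_const elim] by simp
      have "(\<lambda>k. \<Sum>i\<in>UNIV. lnavg (l k i)) \<longlonglongrightarrow> (\<Sum>i\<in>UNIV. lnavg ((1 / y) * a i))"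
        by (rule trace_fun_continuous[OF _ M N 1]) (intro continuous_intros)
      moreover have "(\<lambda>k. \<Sum>i\<in>UNIV. lnavg (e k i + Re (A $ i $ i) / y)) \<longlonglongrightarrow> (\<Sum>i\<in>UNIV. lnavg (Re (A $ i $ i) / y))"
      proof (rule tendsto_sum)
        fix i
        have "isCont lnavg (Re (A $ i $ i) / y)"
          using continuous_lnavg[OF continuous_on_id, of UNIV] by (simp add: continuous_on_eq_continuous_at)
        moreover have "(\<lambda>k. e k i + Re (A $ i $ i) / y) \<longlonglongrightarrow> Re (A $ i $ i) / y"
          using tendsto_add[OF e_lim tendsto_const] by simp
        ultimately show "(\<lambda>k. lnavg (e k i + Re (A $ i $ i) / y)) \<longlonglongrightarrow> lnavg (Re (A $ i $ i) / y)"
          by (rule isCont_tendsto_compose)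
      qed
      ultimately have "(\<lambda>k. (\<Sum>i\<in>UNIV. lnavg (l k i)) - (\<Sum>i\<in>UNIV. lnavg (e k i + Re (A $ i $ i) / y))) \<longlonglongrightarrow>
          (\<Sum>i\<in>UNIV. lnavg ((1 / y) * a i)) - (\<Sum>i\<in>UNIV. lnavg (Re (A $ i $ i) / y))" by (rule tendsto_diff)
      then show ?thesis by (simp add: H_def H0_def log_excess_set_integral(2)[OF M y])
    qed
    then show "AE y in lborel. (\<lambda>k. H k y) \<longlonglongrightarrow> H0 y"
      using AE_lborel_singleton[of 0] by (auto elim!: eventually_mono)
    show "AE y in lborel. norm (H k y) \<le> C * tailweight y" for k
      using AE_lborel_singleton[of 0] C(2)[OF en] by (auto elim!: eventually_mono simp: H_def)
  qed
  \<comment> \<open>Both sums have equally many terms, so a 2 can be added to each; this makes every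
    summand integrable on its own.\<close>
  have "H0 y = (\<Sum>i\<in>UNIV. lnavg (a i / y) + 2) - (\<Sum>i\<in>UNIV. lnavg (Re (A $ i $ i) / y) + 2)" for y
    by (simp add: H0_def sum.distrib)
  then have "(LINT y|lborel. H0 y) = (\<Sum>i\<in>UNIV. \<bar>a i\<bar> * kappa) - (\<Sum>i\<in>UNIV. \<bar>Re (A $ i $ i)\<bar> * kappa)"
    by (simp add: lnavg_scaled)
  also have "\<dots> = kappa * ((\<Sum>i\<in>UNIV. \<bar>a i\<bar>) - (\<Sum>i\<in>UNIV. \<bar>Re (A $ i $ i)\<bar>))"
    by (simp add: sum_distrib_left algebra_simps)
  finally have "(\<lambda>k. ennreal (LINT y|lborel. H k y)) \<longlonglongrightarrow> ennreal (kappa * ((\<Sum>i\<in>UNIV. \<bar>a i\<bar>) - (\<Sum>i\<in>UNIV. \<bar>Re (A $ i $ i)\<bar>)))"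
    using tendsto_ennrealI[OF lim] by simp
  moreover have "ennreal (LINT y|lborel. H k y) = (\<integral>\<^sup>+s. ennreal (excess A b s) \<partial>lborel)" for k
    using log_excess_fubini(2)[OF A einj en, of k] excess_nn_integral_scale[OF S0, of A b k] by (simp add: H_def e_def)
  ultimately show ?thesis using LIMSEQ_unique[OF tendsto_const] by simp
qed

section \<open>The representing measure\<close>

text \<open>Diagonal entries are weighted means of eigenvalues, so this is the triangle inequality
  followed by exchanging the sums.\<close>

lemma sum_abs_diag_le:
  assumes M: "spectral_decomp M U l"
  shows "(\<Sum>j\<in>UNIV. \<bar>Re (M $ j $ j)\<bar>) \<le> (\<Sum>i\<in>UNIV. \<bar>l i\<bar>)"
proof -
  have U: "unitary_mat U" "unitary_mat (mat 1)" using M by (auto simp: spectral_decomp_def unitary_mat_def)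
  have "(\<Sum>j\<in>UNIV. \<bar>Re (M $ j $ j)\<bar>) \<le> (\<Sum>j\<in>UNIV. \<Sum>i\<in>UNIV. overlap U (mat 1) i j * \<bar>l i\<bar>)"
    unfolding overlap_diag[OF M, symmetric] by (intro sum_mono order_trans[OF sum_abs]) (simp add: abs_mult)
  also have "\<dots> = (\<Sum>i\<in>UNIV. \<Sum>j\<in>UNIV. overlap U (mat 1) i j * \<bar>l i\<bar>)" by (rule sum.swap)
  also have "\<dots> = (\<Sum>i\<in>UNIV. \<bar>l i\<bar>)" by (simp add: overlap_sum_right[OF U] flip: sum_distrib_right)
  finally show ?thesis .
qed

lemma excess_shift_measurable:
  assumes [measurable]: "f \<in> borel_measurable M" "h \<in> borel_measurable M"
  shows "(\<lambda>p. excess (A + dg (\<lambda>_. f p)) b (h p)) \<in> borel_measurable M"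
proof -
  have "(\<lambda>q. log_excess (A + dg (\<lambda>_. f (fst q))) b (snd q) (h (fst q))) \<in> borel_measurable (M \<Otimes>\<^sub>M lborel)"
    by (rule log_excess_measurable) measurable
  then have "(\<lambda>p. LINT x|lborel. log_excess (A + dg (\<lambda>_. f p)) b x (h p)) \<in> borel_measurable M"
    by (intro lborel.borel_measurable_lebesgue_integral) (simp add: split_beta')
  then show ?thesis by (simp add: excess_def[abs_def])
qed

lemma excess_exp_integral:
  fixes A :: "complex^'n^'n"
  assumes A: "hermitian_mat A" and inj: "inj b" and UA: "spectral_decomp A U a"
  shows "(\<integral>\<^sup>+s. \<integral>\<^sup>+c. ennreal (exp c) * ennreal (excess (A + dg (\<lambda>_. - c)) b s) \<partial>lborel \<partial>lborel) =
      ennreal (2 * kappa * ((\<Sum>i\<in>UNIV. exp (a i)) - (\<Sum>i\<in>UNIV. exp (Re (A $ i $ i)))))" (is "?L = _")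
    and "(\<Sum>i\<in>UNIV. exp (Re (A $ i $ i))) \<le> (\<Sum>i\<in>UNIV. exp (a i))"
proof -
  define d where "d i = Re (A $ i $ i)" for i
  define D where "D c = (\<Sum>i\<in>UNIV. \<bar>a i - c\<bar>) - (\<Sum>i\<in>UNIV. \<bar>d i - c\<bar>)" for c
  define R where "R = norm A"
  have aR: "\<bar>a i\<bar> \<le> R" for i using spectral_abs_le_norm[OF UA] by (simp add: R_def)
  have dR: "\<bar>d i\<bar> \<le> R" for i
    using abs_Re_le_cmod[of "A $ i $ i"] Finite_Cartesian_Product.norm_nth_le[of "A $ i" i]
      Finite_Cartesian_Product.norm_nth_le[of A i] by (simp add: R_def d_def)
  have ad: "(\<Sum>i\<in>UNIV. a i) = (\<Sum>i\<in>UNIV. d i)" using spectral_sum[OF UA] by (simp add: d_def)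
  have sh: "spectral_decomp (A + dg (\<lambda>_. - c)) U (\<lambda>i. a i - c)" for c
    using spectral_decomp_shift[OF UA, of "-c"] by simp
  have re: "Re ((A + dg (\<lambda>_. - c)) $ i $ i) = d i - c" for c i by (simp add: d_def dg_nth)
  have D0: "D c \<ge> 0" for c using sum_abs_diag_le[OF sh[of c]] unfolding re D_def by simp
  \<comment> \<open>Outside \<open>{-R..R}\<close> all absolute values open with the same sign, and
    equality of the two traces cancels everything.\<close>
  have Dz: "D c = 0" if "c \<notin> {-R..R}" for c
  proof (cases "c > R")
    case True
    have "\<bar>a i - c\<bar> = c - a i" "\<bar>d i - c\<bar> = c - d i" for i using aR[of i] dR[of i] True by auto
    then show ?thesis using ad by (simp add: D_def sum_subtractf)
  next
    case False
    then have c: "c < - R" using that by auto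
    have "\<bar>a i - c\<bar> = a i - c" "\<bar>d i - c\<bar> = d i - c" for i using aR[of i] dR[of i] c by auto
    then show ?thesis using ad by (simp add: D_def sum_subtractf)
  qed
  have "((\<lambda>c. exp c * D c) has_integral (2 * ((\<Sum>i\<in>UNIV. exp (a i)) - (\<Sum>i\<in>UNIV. exp (d i))))) {-R..R}"
    unfolding D_def by (rule exp_abs_sum_has_integral[OF aR dR ad])
  then have hi: "((\<lambda>c. exp c * D c) has_integral (2 * ((\<Sum>i\<in>UNIV. exp (a i)) - (\<Sum>i\<in>UNIV. exp (d i))))) UNIV"
    by (rule has_integral_on_superset) (auto simp: Dz)
  have "0 \<le> 2 * ((\<Sum>i\<in>UNIV. exp (a i)) - (\<Sum>i\<in>UNIV. exp (d i)))"
    by (rule has_integral_nonneg[OF hi]) (simp add: D0)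
  then show "(\<Sum>i\<in>UNIV. exp (Re (A $ i $ i))) \<le> (\<Sum>i\<in>UNIV. exp (a i))" by (simp add: d_def)
  have [measurable]: "(\<lambda>p. excess (A + dg (\<lambda>_. - fst p)) b (snd p)) \<in> borel_measurable (lborel \<Otimes>\<^sub>M lborel)"
    by (rule excess_shift_measurable) measurable
  have m1: "(\<lambda>(c, s). ennreal (exp c) * ennreal (excess (A + dg (\<lambda>_. - c)) b s)) \<in> borel_measurable (lborel \<Otimes>\<^sub>M lborel)"
    unfolding split_beta' by measurable
  have "?L = (\<integral>\<^sup>+c. \<integral>\<^sup>+s. ennreal (exp c) * ennreal (excess (A + dg (\<lambda>_. - c)) b s) \<partial>lborel \<partial>lborel)"
    by (rule lborel_pair.Fubini'[OF m1])
  also have "\<dots> = (\<integral>\<^sup>+c. ennreal (kappa * (exp c * D c)) \<partial>lborel)"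
  proof (rule nn_integral_cong)
    fix c :: real
    have "(\<integral>\<^sup>+s. ennreal (exp c) * ennreal (excess (A + dg (\<lambda>_. - c)) b s) \<partial>lborel)
        = ennreal (exp c) * (\<integral>\<^sup>+s. ennreal (excess (A + dg (\<lambda>_. - c)) b s) \<partial>lborel)"
      by (intro nn_integral_cmult) measurable
    also have "(\<integral>\<^sup>+s. ennreal (excess (A + dg (\<lambda>_. - c)) b s) \<partial>lborel) = ennreal (kappa * D c)"
      using excess_nn_integral[OF hermitian_add[OF A hermitian_dg] inj sh, of c] by (simp only: re D_def)
    finally show "(\<integral>\<^sup>+s. ennreal (exp c) * ennreal (excess (A + dg (\<lambda>_. - c)) b s) \<partial>lborel) = ennreal (kappa * (exp c * D c))"
      by (simp add: ennreal_mult'[symmetric] mult_ac)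
  qed
  also have "\<dots> = ennreal (kappa * (2 * ((\<Sum>i\<in>UNIV. exp (a i)) - (\<Sum>i\<in>UNIV. exp (d i)))))"
  proof (rule nn_integral_has_integral_lborel)
    show "(\<lambda>c. kappa * (exp c * D c)) \<in> borel_measurable borel" unfolding D_def by measurable
    show "0 \<le> kappa * (exp c * D c)" for c using D0[of c] kappa_pos by simp
    show "((\<lambda>c. kappa * (exp c * D c)) has_integral kappa * (2 * ((\<Sum>i\<in>UNIV. exp (a i)) - (\<Sum>i\<in>UNIV. exp (d i))))) UNIV"
      by (rule has_integral_mult_right[OF hi])
  qed
  finally show "?L = ennreal (2 * kappa * ((\<Sum>i\<in>UNIV. exp (a i)) - (\<Sum>i\<in>UNIV. exp (Re (A $ i $ i)))))"
    by (simp add: d_def mult_ac)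
qed

text \<open>The substitution \<open>x \<mapsto> x - t\<close>, from the identity
  \<open>- t b - c + x (b - s) = - (t s + c) + (x - t) (b - s)\<close>.\<close>

lemma excess_shear:
  "excess (A + dg (\<lambda>i. - t * b i) + dg (\<lambda>_. - c)) b s = excess (A + dg (\<lambda>_. - (t * s + c))) b s"
proof -
  have 1: "A + dg (\<lambda>i. - t * b i) + dg (\<lambda>_. - c) + dg (\<lambda>i. x * (b i - s)) =
     A + dg (\<lambda>_. - (t * s + c)) + dg (\<lambda>i. (- t + 1 * x) * (b i - s))" for x
    unfolding add.assoc dg_add by (simp add: algebra_simps)
  have 2: "Re ((A + dg (\<lambda>i. - t * b i) + dg (\<lambda>_. - c)) $ i $ i) + x * (b i - s) =
     Re ((A + dg (\<lambda>_. - (t * s + c))) $ i $ i) + (- t + 1 * x) * (b i - s)" for x i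
    by (simp add: dg_nth algebra_simps)
  have "log_excess (A + dg (\<lambda>i. - t * b i) + dg (\<lambda>_. - c)) b x s = log_excess (A + dg (\<lambda>_. - (t * s + c))) b (- t + 1 * x) s" for x
    unfolding log_excess_def 1 2 ..
  then show ?thesis
    using lborel_integral_real_affine[of 1 "\<lambda>x. log_excess (A + dg (\<lambda>_. - (t * s + c))) b x s" "-t"]
    unfolding excess_def by simp
qed

text \<open>The atom at \<open>b i\<close> is the image of a weighted unit interval under a constant map.\<close>

lemma atoms_plus_density:
  fixes b m :: "'n::finite \<Rightarrow> real" and w :: "real \<Rightarrow> ennreal"
  assumes [measurable]: "w \<in> borel_measurable borel"
  shows "\<exists>\<mu> :: real measure. sets \<mu> = sets borel \<and> (\<forall>f\<in>borel_measurable borel.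
    (\<integral>\<^sup>+s. f s \<partial>\<mu>) = (\<integral>\<^sup>+s. w s * f s \<partial>lborel) + (\<Sum>i\<in>UNIV. ennreal (m i) * f (b i)))"
proof -
  let ?C = "count_space (UNIV :: 'n option set)"
  define F :: "'n option \<times> real \<Rightarrow> ennreal" where
    "F = (\<lambda>(q, s). case q of None \<Rightarrow> w s | Some i \<Rightarrow> ennreal (m i) * indicator {0..1} s)"
  define T :: "'n option \<times> real \<Rightarrow> real" where "T = (\<lambda>(q, s). case q of None \<Rightarrow> s | Some i \<Rightarrow> b i)"
  have Fm [measurable]: "F \<in> borel_measurable (?C \<Otimes>\<^sub>M lborel)"
  proof (rule measurable_pair_measure_countable1)
    show "(\<lambda>s. F (q, s)) \<in> borel_measurable lborel" for q by (cases q) (simp_all add: F_def)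
  qed simp
  have Tm [measurable]: "T \<in> measurable (?C \<Otimes>\<^sub>M lborel) borel"
  proof (rule measurable_pair_measure_countable1)
    show "(\<lambda>s. T (q, s)) \<in> borel_measurable lborel" for q by (cases q) (simp_all add: T_def)
  qed simp
  define \<mu> where "\<mu> = distr (density (?C \<Otimes>\<^sub>M lborel) F) borel T"
  have "(\<integral>\<^sup>+s. f s \<partial>\<mu>) = (\<integral>\<^sup>+s. w s * f s \<partial>lborel) + (\<Sum>i\<in>UNIV. ennreal (m i) * f (b i))"
    if f [measurable]: "f \<in> borel_measurable borel" for f
  proof -
    have "(\<integral>\<^sup>+s. f s \<partial>\<mu>) = (\<integral>\<^sup>+p. F p * f (T p) \<partial>(?C \<Otimes>\<^sub>M lborel))"
      unfolding \<mu>_def by (simp add: nn_integral_distr nn_integral_density)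
    also have "\<dots> = (\<integral>\<^sup>+q. \<integral>\<^sup>+s. F (q, s) * f (T (q, s)) \<partial>lborel \<partial>?C)"
      by (rule lborel.nn_integral_fst[symmetric]) measurable
    also have "\<dots> = (\<Sum>q\<in>UNIV. \<integral>\<^sup>+s. F (q, s) * f (T (q, s)) \<partial>lborel)"
      by (simp add: nn_integral_count_space_finite)
    also have "\<dots> = (\<integral>\<^sup>+s. F (None, s) * f (T (None, s)) \<partial>lborel) + (\<Sum>i\<in>UNIV. \<integral>\<^sup>+s. F (Some i, s) * f (T (Some i, s)) \<partial>lborel)"
      by (simp add: UNIV_option_conv sum.reindex)
    also have "(\<integral>\<^sup>+s. F (None, s) * f (T (None, s)) \<partial>lborel) = (\<integral>\<^sup>+s. w s * f s \<partial>lborel)"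
      by (simp add: F_def T_def)
    also have "(\<Sum>i\<in>UNIV. \<integral>\<^sup>+s. F (Some i, s) * f (T (Some i, s)) \<partial>lborel) = (\<Sum>i\<in>UNIV. ennreal (m i) * f (b i))"
    proof (rule sum.cong[OF refl])
      fix i
      have "(\<integral>\<^sup>+s. F (Some i, s) * f (T (Some i, s)) \<partial>lborel) = (\<integral>\<^sup>+s. (ennreal (m i) * f (b i)) * indicator {0..1::real} s \<partial>lborel)"
        by (intro nn_integral_cong) (simp add: F_def T_def mult_ac)
      then show "(\<integral>\<^sup>+s. F (Some i, s) * f (T (Some i, s)) \<partial>lborel) = ennreal (m i) * f (b i)"
        by (simp add: nn_integral_cmult_indicator)
    qed
    finally show ?thesis .
  qed
  then show ?thesis by (intro exI[of _ \<mu>]) (simp add: \<mu>_def)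
qed

theorem laplace_measure_simple_spectrum:
  fixes A :: "complex^'n^'n"
  assumes A: "hermitian_mat A" and inj: "inj b"
  shows "\<exists>\<mu> :: real measure. sets \<mu> = sets borel \<and>
     emeasure \<mu> {s. (\<forall>i. s < b i) \<or> (\<forall>i. b i < s)} = 0 \<and>
     (\<forall>t U l. spectral_decomp (A + dg (\<lambda>i. - t * b i)) U l \<longrightarrow>
        (\<integral>\<^sup>+s. ennreal (exp (- t * s)) \<partial>\<mu>) = ennreal (\<Sum>i\<in>UNIV. exp (l i)))"
proof -
  define d where "d i = Re (A $ i $ i)" for i
  define K where "K = ennreal (1 / (2 * kappa))"
  define w where "w s = K * (\<integral>\<^sup>+c. ennreal (exp c) * ennreal (excess (A + dg (\<lambda>_. - c)) b s) \<partial>lborel)" for s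
  have pm: "(\<lambda>p. excess (A + dg (\<lambda>_. - snd p)) b (fst p)) \<in> borel_measurable (borel \<Otimes>\<^sub>M lborel)"
    by (rule excess_shift_measurable) measurable
  have wm [measurable]: "w \<in> borel_measurable borel"
  proof -
    note [measurable] = pm
    have "(\<lambda>s. \<integral>\<^sup>+c. ennreal (exp c) * ennreal (excess (A + dg (\<lambda>_. - c)) b s) \<partial>lborel) \<in> borel_measurable borel"
      by (intro lborel.borel_measurable_nn_integral) (simp add: split_beta')
    then show ?thesis unfolding w_def[abs_def] by measurable
  qed
  obtain \<mu> :: "real measure" where \<mu>: "sets \<mu> = sets borel"
    "\<And>f. f \<in> borel_measurable borel \<Longrightarrow> (\<integral>\<^sup>+s. f s \<partial>\<mu>) = (\<integral>\<^sup>+s. w s * f s \<partial>lborel) + (\<Sum>i\<in>UNIV. ennreal (exp (d i)) * f (b i))"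
    using atoms_plus_density[OF wm, of "\<lambda>i. exp (d i)" b] by blast
  \<comment> \<open>The complement of the interval spanned by the \<open>b i\<close>. That it is
    null later gives both tightness and support in the nonnegative reals.\<close>
  define N where "N = {s. (\<forall>i. s < b i) \<or> (\<forall>i. b i < s)}"
  have Nm [measurable]: "N \<in> sets borel"
  proof -
    have "N = (\<Inter>i\<in>UNIV. {..<b i}) \<union> (\<Inter>i\<in>UNIV. {b i<..})" by (auto simp: N_def)
    moreover have "open ((\<Inter>i\<in>UNIV. {..<b i}) \<union> (\<Inter>i\<in>UNIV. {b i<..}))"
      by (intro open_Un open_INT) auto
    ultimately show ?thesis by simp
  qed
  have "emeasure \<mu> N = (\<integral>\<^sup>+s. indicator N s \<partial>\<mu>)" using Nm by (simp add: \<mu>(1))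
  also have "\<dots> = (\<integral>\<^sup>+s. w s * indicator N s \<partial>lborel) + (\<Sum>i\<in>UNIV. ennreal (exp (d i)) * indicator N (b i))"
    by (rule \<mu>(2)) measurable
  also have "\<dots> = 0"
  proof -
    have "b i \<notin> N" for i by (auto simp: N_def)
    moreover have "w s = 0" if "s \<in> N" for s
    proof -
      have "excess (A + dg (\<lambda>_. - c)) b s = 0" for c
        using that by (intro excess_eq_0 hermitian_add A hermitian_dg) (auto simp: N_def)
      then show ?thesis by (simp add: w_def)
    qed
    then have z: "w s * indicator N s = 0" for s by (cases "s \<in> N") auto
    ultimately show ?thesis unfolding z by simp
  qed
  finally have null: "emeasure \<mu> N = 0" .
  have "(\<integral>\<^sup>+s. ennreal (exp (- t * s)) \<partial>\<mu>) = ennreal (\<Sum>i\<in>UNIV. exp (l i))"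
    if UA: "spectral_decomp (A + dg (\<lambda>i. - t * b i)) U l" for t U l
  proof -
    let ?A = "A + dg (\<lambda>i. - t * b i)"
    have hA: "hermitian_mat ?A" by (intro hermitian_add A hermitian_dg)
    have dt: "Re (?A $ i $ i) = d i - t * b i" for i by (simp add: d_def dg_nth)
    have "w s * ennreal (exp (- t * s)) = K * (\<integral>\<^sup>+c. ennreal (exp c) * ennreal (excess (?A + dg (\<lambda>_. - c)) b s) \<partial>lborel)" for s
    proof -
      have [measurable]: "(\<lambda>c. excess (A + dg (\<lambda>_. - c)) b s) \<in> borel_measurable borel"
        by (rule excess_shift_measurable) measurable
      have "w s * ennreal (exp (- t * s)) = K * ((\<integral>\<^sup>+c. ennreal (exp c) * ennreal (excess (A + dg (\<lambda>_. - c)) b s) \<partial>lborel) * ennreal (exp (- t * s)))"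
        by (simp add: w_def mult.assoc)
      also have "(\<integral>\<^sup>+c. ennreal (exp c) * ennreal (excess (A + dg (\<lambda>_. - c)) b s) \<partial>lborel) * ennreal (exp (- t * s))
         = (\<integral>\<^sup>+c. ennreal (exp c) * ennreal (excess (A + dg (\<lambda>_. - c)) b s) * ennreal (exp (- t * s)) \<partial>lborel)"
        by (rule nn_integral_multc[symmetric]) measurable
      \<comment> \<open>Shifting \<open>c\<close> by \<open>t * s\<close> releases a factor
        \<open>exp (t * s)\<close> that cancels the Laplace kernel, and leaves exactly the sheared
        \<open>excess\<close>.\<close>
      also have "\<dots> = ennreal \<bar>1\<bar> * (\<integral>\<^sup>+c. ennreal (exp (t * s + 1 * c)) * ennreal (excess (A + dg (\<lambda>_. - (t * s + 1 * c))) b s) * ennreal (exp (- t * s)) \<partial>lborel)"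
        by (rule nn_integral_real_affine) auto
      also have "\<dots> = (\<integral>\<^sup>+c. ennreal (exp c) * ennreal (excess (?A + dg (\<lambda>_. - c)) b s) \<partial>lborel)"
      proof -
        have "ennreal (exp (t * s + 1 * c)) * ennreal (excess (A + dg (\<lambda>_. - (t * s + 1 * c))) b s) * ennreal (exp (- t * s))
          = ennreal (exp c) * ennreal (excess (?A + dg (\<lambda>_. - c)) b s)" for c
        proof -
          have "ennreal (exp (t * s + c)) * ennreal (exp (- t * s)) = ennreal (exp c)"
            by (simp add: ennreal_mult'[symmetric] exp_add[symmetric])
          moreover have "x * p * z = y * p" if "x * z = y" for x y z p :: ennreal
            using that by (metis mult.assoc mult.commute)
          ultimately show ?thesis unfolding excess_shear mult_1 by blast
        qed
        then show ?thesis by simp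
      qed
      finally show ?thesis .
    qed
    then have "(\<integral>\<^sup>+s. w s * ennreal (exp (- t * s)) \<partial>lborel) = (\<integral>\<^sup>+s. K * (\<integral>\<^sup>+c. ennreal (exp c) * ennreal (excess (?A + dg (\<lambda>_. - c)) b s) \<partial>lborel) \<partial>lborel)"
      by simp
    also have "\<dots> = K * (\<integral>\<^sup>+s. \<integral>\<^sup>+c. ennreal (exp c) * ennreal (excess (?A + dg (\<lambda>_. - c)) b s) \<partial>lborel \<partial>lborel)"
    proof (rule nn_integral_cmult)
      have [measurable]: "(\<lambda>p. excess (?A + dg (\<lambda>_. - snd p)) b (fst p)) \<in> borel_measurable (lborel \<Otimes>\<^sub>M lborel)"
        by (rule excess_shift_measurable) measurable
      show "(\<lambda>s. \<integral>\<^sup>+c. ennreal (exp c) * ennreal (excess (?A + dg (\<lambda>_. - c)) b s) \<partial>lborel) \<in> borel_measurable lborel"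
        by (intro lborel.borel_measurable_nn_integral, unfold split_beta') measurable
    qed
    also have "\<dots> = ennreal ((\<Sum>i\<in>UNIV. exp (l i)) - (\<Sum>i\<in>UNIV. exp (d i - t * b i)))"
      unfolding excess_exp_integral(1)[OF hA inj UA] dt K_def
      using kappa_pos by (simp add: ennreal_mult'[symmetric])
    finally have 1: "(\<integral>\<^sup>+s. w s * ennreal (exp (- t * s)) \<partial>lborel) = ennreal ((\<Sum>i\<in>UNIV. exp (l i)) - (\<Sum>i\<in>UNIV. exp (d i - t * b i)))" .
    have "(\<Sum>i\<in>UNIV. ennreal (exp (d i)) * ennreal (exp (- t * b i))) = (\<Sum>i\<in>UNIV. ennreal (exp (d i - t * b i)))"
      by (intro sum.cong refl) (simp add: ennreal_mult'[symmetric] exp_add[symmetric])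
    also have "\<dots> = ennreal (\<Sum>i\<in>UNIV. exp (d i - t * b i))" by simp
    finally have 2: "(\<Sum>i\<in>UNIV. ennreal (exp (d i)) * ennreal (exp (- t * b i))) = ennreal (\<Sum>i\<in>UNIV. exp (d i - t * b i))" .
    have "(\<integral>\<^sup>+s. ennreal (exp (- t * s)) \<partial>\<mu>) = (\<integral>\<^sup>+s. w s * ennreal (exp (- t * s)) \<partial>lborel) + (\<Sum>i\<in>UNIV. ennreal (exp (d i)) * ennreal (exp (- t * b i)))"
      by (rule \<mu>(2)) measurable
    \<comment> \<open>Splitting \<open>ennreal\<close> over the sum requires the density part to be
      nonnegative, which is the trace inequality \<open>excess_exp_integral(2)\<close>.\<close>
    also have "\<dots> = ennreal (((\<Sum>i\<in>UNIV. exp (l i)) - (\<Sum>i\<in>UNIV. exp (d i - t * b i))) + (\<Sum>i\<in>UNIV. exp (d i - t * b i)))"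
      unfolding 1 2 using excess_exp_integral(2)[OF hA inj UA] unfolding dt
      by (intro ennreal_plus[symmetric]) (auto intro: sum_nonneg)
    finally show ?thesis by simp
  qed
  with \<mu>(1) null show ?thesis by (auto simp: N_def)
qed

section \<open>Uniqueness of the representing measure\<close>

lemma laplace_unique:
  fixes \<mu> \<nu> :: "real measure"
  assumes \<mu>: "sets \<mu> = sets borel" "emeasure \<mu> {..<0} = 0"
    and \<nu>: "sets \<nu> = sets borel" "emeasure \<nu> {..<0} = 0"
    and i\<mu>: "\<And>t. t \<ge> 0 \<Longrightarrow> integrable \<mu> (\<lambda>s. exp (- t * s))"
    and i\<nu>: "\<And>t. t \<ge> 0 \<Longrightarrow> integrable \<nu> (\<lambda>s. exp (- t * s))"
    and eq: "\<And>t. t \<ge> 0 \<Longrightarrow> (\<integral>s. exp (- t * s) \<partial>\<mu>) = (\<integral>s. exp (- t * s) \<partial>\<nu>)"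
  shows "\<mu> = \<nu>"
proof (rule cdf_unique')
  have fin: "finite_measure M" if "integrable M (\<lambda>s. exp (- 0 * s) :: real)" for M :: "real measure"
    using that by (intro finite_measureI) (simp add: integrable_iff_bounded)
  interpret \<mu>: finite_measure \<mu> using fin i\<mu>[of 0] by simp
  interpret \<nu>: finite_measure \<nu> using fin i\<nu>[of 0] by simp
  show "finite_borel_measure \<mu>" "finite_borel_measure \<nu>" using \<mu> \<nu>
    by (auto simp: finite_borel_measure_def finite_borel_measure_axioms_def intro: \<mu>.finite_measure_axioms \<nu>.finite_measure_axioms)
  have [measurable_cong, simp]: "sets \<mu> = sets borel" "sets \<nu> = sets borel" using \<mu> \<nu> by auto
  have sp: "space \<mu> = UNIV" "space \<nu> = UNIV"
    using sets_eq_imp_space_eq[OF \<mu>(1)] sets_eq_imp_space_eq[OF \<nu>(1)] by simp_all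
  have AE: "AE s in \<mu>. 0 \<le> s" "AE s in \<nu>. 0 \<le> s"
    using \<mu> \<nu> by (auto intro!: AE_I[where N = "{..<0}"] simp: sp)
  \<comment> \<open>Powers of \<open>exp (- s)\<close> are the Laplace kernels at nonnegative
    integers \<open>t\<close>, where the two transforms agree.\<close>
  have poly: "(\<integral>s. (\<Sum>i\<le>n. a i * exp (- s) ^ i) \<partial>\<mu>) = (\<integral>s. (\<Sum>i\<le>n. a i * exp (- s) ^ i) \<partial>\<nu>)"
    "integrable \<mu> (\<lambda>s. \<Sum>i\<le>n. a i * exp (- s) ^ i)" "integrable \<nu> (\<lambda>s. \<Sum>i\<le>n. a i * exp (- s) ^ i)" for a :: "nat \<Rightarrow> real" and n
  proof -
    have e: "exp (- s) ^ i = exp (- real i * s)" for s :: real and i by (simp add: exp_of_nat_mult[symmetric])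
    show "integrable \<mu> (\<lambda>s. \<Sum>i\<le>n. a i * exp (- s) ^ i)" "integrable \<nu> (\<lambda>s. \<Sum>i\<le>n. a i * exp (- s) ^ i)"
      unfolding e using i\<mu> i\<nu> by (auto intro!: Bochner_Integration.integrable_sum integrable_mult_right)
    have "(\<integral>s. (\<Sum>i\<le>n. a i * exp (- s) ^ i) \<partial>\<mu>) = (\<Sum>i\<le>n. a i * (\<integral>s. exp (- real i * s) \<partial>\<mu>))"
      unfolding e using i\<mu> by (subst Bochner_Integration.integral_sum) auto
    also have "\<dots> = (\<Sum>i\<le>n. a i * (\<integral>s. exp (- real i * s) \<partial>\<nu>))" using eq by simp
    also have "\<dots> = (\<integral>s. (\<Sum>i\<le>n. a i * exp (- s) ^ i) \<partial>\<nu>)"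
      unfolding e using i\<nu> by (subst Bochner_Integration.integral_sum) auto
    finally show "(\<integral>s. (\<Sum>i\<le>n. a i * exp (- s) ^ i) \<partial>\<mu>) = (\<integral>s. (\<Sum>i\<le>n. a i * exp (- s) ^ i) \<partial>\<nu>)" .
  qed
  have cont: "(\<integral>s. f (exp (- s)) \<partial>\<mu>) = (\<integral>s. f (exp (- s)) \<partial>\<nu>)"
    if f: "continuous_on UNIV f" "\<And>x. \<bar>f x\<bar> \<le> 1" for f :: "real \<Rightarrow> real"
  proof -
    have [measurable]: "f \<in> borel_measurable borel" using f(1) by (rule borel_measurable_continuous_onI)
    have int: "integrable \<mu> (\<lambda>s. f (exp (- s)))" "integrable \<nu> (\<lambda>s. f (exp (- s)))"
      using f(2) by (auto intro!: \<mu>.integrable_const_bound[where B = 1] \<nu>.integrable_const_bound[where B = 1])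
    define m where "m = measure \<mu> UNIV + measure \<nu> UNIV"
    have bound: "\<bar>(\<integral>s. f (exp (- s)) \<partial>\<mu>) - (\<integral>s. f (exp (- s)) \<partial>\<nu>)\<bar> \<le> e * m" if e: "e > 0" for e
    proof -
      \<comment> \<open>Approximation on \<open>{0..1}\<close> is enough, because
        \<open>exp (- s)\<close> lies there for almost every \<open>s\<close> under both
        measures.\<close>
      obtain g where g: "real_polynomial_function g" "\<And>x. x \<in> {0..1} \<Longrightarrow> \<bar>f x - g x\<bar> < e"
        using Stone_Weierstrass_real_polynomial_function[of "{0..1}" f e] f(1) e continuous_on_subset by blast
      then obtain a n where gp: "g = (\<lambda>x. \<Sum>i\<le>n. a i * x ^ i)" unfolding real_polynomial_function_iff_sum by blast
      have *: "\<bar>(\<integral>s. f (exp (- s)) \<partial>M) - (\<integral>s. g (exp (- s)) \<partial>M)\<bar> \<le> e * measure M UNIV"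
        if "finite_measure M" "AE s in M. 0 \<le> s" "integrable M (\<lambda>s. f (exp (- s)))" "integrable M (\<lambda>s. g (exp (- s)))" "space M = UNIV" for M
      proof -
        interpret finite_measure M by fact
        have "\<bar>(\<integral>s. f (exp (- s)) \<partial>M) - (\<integral>s. g (exp (- s)) \<partial>M)\<bar> = norm (\<integral>s. f (exp (- s)) - g (exp (- s)) \<partial>M)"
          using that by simp
        also have "\<dots> \<le> (\<integral>s. norm (f (exp (- s)) - g (exp (- s))) \<partial>M)" by (rule integral_norm_bound)
        also have "\<dots> \<le> (\<integral>s. e \<partial>M)"
        proof (rule integral_mono_AE)
          show "AE s in M. norm (f (exp (- s)) - g (exp (- s))) \<le> e"
            using that(2) by eventually_elim (use g(2) in \<open>auto intro!: less_imp_le\<close>)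
        qed (use that in auto)
        finally show ?thesis using that(5) by (simp add: mult.commute)
      qed
      have "\<bar>(\<integral>s. f (exp (- s)) \<partial>\<mu>) - (\<integral>s. g (exp (- s)) \<partial>\<mu>)\<bar> \<le> e * measure \<mu> UNIV"
        using poly(2) by (intro * \<mu>.finite_measure_axioms AE int sp) (simp add: gp)
      moreover have "\<bar>(\<integral>s. f (exp (- s)) \<partial>\<nu>) - (\<integral>s. g (exp (- s)) \<partial>\<nu>)\<bar> \<le> e * measure \<nu> UNIV"
        using poly(3) by (intro * \<nu>.finite_measure_axioms AE int sp) (simp add: gp)
      moreover have "(\<integral>s. g (exp (- s)) \<partial>\<mu>) = (\<integral>s. g (exp (- s)) \<partial>\<nu>)" unfolding gp by (rule poly(1))
      ultimately show ?thesis unfolding m_def distrib_left by linarith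
    qed
    have m0: "m \<ge> 0" by (simp add: m_def)
    have "\<bar>(\<integral>s. f (exp (- s)) \<partial>\<mu>) - (\<integral>s. f (exp (- s)) \<partial>\<nu>)\<bar> \<le> 0"
    proof (rule field_le_epsilon)
      fix e :: real assume e: "e > 0"
      have "\<bar>(\<integral>s. f (exp (- s)) \<partial>\<mu>) - (\<integral>s. f (exp (- s)) \<partial>\<nu>)\<bar> \<le> (e / (m + 1)) * m"
        using e m0 by (intro bound) auto
      also have "\<dots> \<le> e" using e m0 by (simp add: field_simps)
      finally show "\<bar>(\<integral>s. f (exp (- s)) \<partial>\<mu>) - (\<integral>s. f (exp (- s)) \<partial>\<nu>)\<bar> \<le> 0 + e" by simp
    qed
    then show ?thesis by simp
  qed
  show "cdf \<mu> = cdf \<nu>"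
  proof
    fix x :: real
    \<comment> \<open>In the variable \<open>exp (- s)\<close> the ramp lies to the left of
      \<open>exp (- x)\<close>, so the value at \<open>s = x\<close> is 1 and the limit is the
      indicator of the closed half-line used by \<open>cdf\<close>.\<close>
    define f where "f k = (\<lambda>y. max 0 (min 1 (1 + real k * (y - exp (- x)))))" for k :: nat
    have fb: "\<bar>f k y\<bar> \<le> 1" for k y by (auto simp: f_def)
    have fm [measurable]: "f k \<in> borel_measurable borel" for k unfolding f_def by measurable
    have fl: "(\<lambda>k. f k (exp (- s))) \<longlonglongrightarrow> indicator {..x} s" for s
    proof (cases "s \<le> x")
      case True
      then have "f k (exp (- s)) = 1" for k by (simp add: f_def)
      then show ?thesis using True by simp
    next
      case False
      then have d: "exp (- x) - exp (- s) > 0" by simp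
      obtain k0 :: nat where k0: "real k0 > 1 / (exp (- x) - exp (- s))" using reals_Archimedean2 by blast
      have "f k (exp (- s)) = 0" if "k \<ge> k0" for k
      proof -
        have "real k > 1 / (exp (- x) - exp (- s))" using that k0 by linarith
        then have "real k * (exp (- x) - exp (- s)) > 1" using d by (simp add: field_simps)
        then have "1 + real k * (exp (- s) - exp (- x)) < 0" by (simp add: algebra_simps)
        then show ?thesis by (simp add: f_def)
      qed
      then have "\<forall>\<^sub>F k in sequentially. f k (exp (- s)) = 0" by (auto simp: eventually_sequentially)
      then show ?thesis using False by (simp add: tendsto_eventually)
    qed
    have lim: "(\<lambda>k. \<integral>s. f k (exp (- s)) \<partial>M) \<longlonglongrightarrow> measure M {..x}"
      if "finite_measure M" and [measurable_cong]: "sets M = sets borel" for M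
    proof -
      interpret finite_measure M by fact
      have "(\<lambda>k. \<integral>s. f k (exp (- s)) \<partial>M) \<longlonglongrightarrow> (\<integral>s. indicator {..x} s \<partial>M)"
        by (rule integral_dominated_convergence[where w = "\<lambda>_. 1"]) (auto simp: fl fb)
      moreover have "space M = UNIV" using that(2) by (auto dest: sets_eq_imp_space_eq)
      ultimately show ?thesis by simp
    qed
    have "(\<integral>s. f k (exp (- s)) \<partial>\<mu>) = (\<integral>s. f k (exp (- s)) \<partial>\<nu>)" for k
      by (rule cont) (auto simp: fb f_def intro!: continuous_intros)
    then show "cdf \<mu> x = cdf \<nu> x" unfolding cdf_def
      using LIMSEQ_unique[OF lim[OF \<mu>.finite_measure_axioms \<mu>(1)]] lim[OF \<nu>.finite_measure_axioms \<nu>(1)] by simp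
  qed
qed

section \<open>Passage to repeated eigenvalues of the diagonal matrix\<close>

lemma perturb_to_inj:
  fixes \<beta> :: "'n::finite \<Rightarrow> real"
  assumes "\<delta> > 0"
  shows "\<exists>b. inj b \<and> (\<forall>i. \<beta> i \<le> b i \<and> b i \<le> \<beta> i + \<delta>)"
proof -
  obtain h :: "'n \<Rightarrow> nat" where h: "inj h"
    using finite_imp_inj_to_nat_seg[of "UNIV :: 'n set"] by auto
  define H where "H = 1 + real (\<Sum>i\<in>UNIV. h i)"
  have hH: "real (h i) \<le> H" for i
  proof -
    have "h i \<le> (\<Sum>i\<in>UNIV. h i)" by (rule member_le_sum) auto
    then show ?thesis unfolding H_def by linarith
  qed
  have H0: "H > 0" using of_nat_0_le_iff[of "\<Sum>i\<in>UNIV. h i"] unfolding H_def by linarith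
  \<comment> \<open>The values of \<epsilon> at which two of the shifted numbers
    \<open>\<beta> i + \<epsilon> * real (h i)\<close> collide: finitely many, hence
    avoidable.\<close>
  define bad where "bad = (\<lambda>(i, j). (\<beta> i - \<beta> j) / (real (h j) - real (h i))) ` (UNIV :: ('n \<times> 'n) set)"
  have "finite bad" by (simp add: bad_def)
  moreover have "infinite {0<..<\<delta> / H}" using assms H0 by simp
  ultimately obtain \<epsilon> where \<epsilon>: "\<epsilon> \<in> {0<..<\<delta> / H}" "\<epsilon> \<notin> bad" by (meson finite_subset subsetI)
  have "inj (\<lambda>i. \<beta> i + \<epsilon> * real (h i))"
  proof (rule injI, rule ccontr)
    fix i j assume ij: "\<beta> i + \<epsilon> * real (h i) = \<beta> j + \<epsilon> * real (h j)" "i \<noteq> j"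
    have "real (h j) - real (h i) \<noteq> 0" using h ij(2) by (auto dest: injD)
    then have "\<epsilon> = (\<beta> i - \<beta> j) / (real (h j) - real (h i))" using ij(1) by (simp add: field_simps)
    then show False using \<epsilon>(2) by (auto simp: bad_def)
  qed
  moreover have "\<beta> i \<le> \<beta> i + \<epsilon> * real (h i) \<and> \<beta> i + \<epsilon> * real (h i) \<le> \<beta> i + \<delta>" for i
  proof -
    have "\<epsilon> * real (h i) \<le> (\<delta> / H) * H" using \<epsilon>(1) hH[of i] assms H0 by (intro mult_mono) auto
    then show ?thesis using \<epsilon>(1) H0 by auto
  qed
  ultimately show ?thesis by blast
qed

lemma exp_nn_integral_max:
  assumes "AE s in M. 0 \<le> (s :: real)"
  shows "(\<integral>\<^sup>+s. ennreal (exp (- t * s)) \<partial>M) = (\<integral>\<^sup>+s. ennreal (exp (- t * max s 0)) \<partial>M)"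
proof (rule nn_integral_cong_AE)
  show "AE s in M. ennreal (exp (- t * s)) = ennreal (exp (- t * max s 0))"
    using assms by eventually_elim simp
qed

theorem laplace_measure_diagonal:
  fixes A :: "complex^'n^'n"
  assumes A: "hermitian_mat A" and \<beta>0: "\<And>i. \<beta> i \<ge> 0"
  shows "\<exists>\<mu> :: real measure. sets \<mu> = sets borel \<and> emeasure \<mu> {..<0} = 0 \<and>
     (\<forall>t U l. t \<ge> 0 \<longrightarrow> spectral_decomp (A + dg (\<lambda>i. - t * \<beta> i)) U l \<longrightarrow>
        (\<integral>\<^sup>+s. ennreal (exp (- t * s)) \<partial>\<mu>) = ennreal (\<Sum>i\<in>UNIV. exp (l i)))"
proof -
  \<comment> \<open>The perturbation goes upwards only, so all \<open>b k i\<close> remain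
    nonnegative and no mass appears below 0.\<close>
  have "\<forall>k::nat. \<exists>b. inj b \<and> (\<forall>i. \<beta> i \<le> b i \<and> b i \<le> \<beta> i + 1 / (1 + real k))"
    by (intro allI perturb_to_inj) simp
  then obtain b where binj: "\<And>k::nat. inj (b k)" and b1: "\<And>k i. \<beta> i \<le> b k i" and b2: "\<And>k i. b k i \<le> \<beta> i + 1 / (1 + real k)"
    by metis
  have blim: "(\<lambda>k. b k i) \<longlonglongrightarrow> \<beta> i" for i
  proof (rule tendsto_sandwich[of "\<lambda>_. \<beta> i" _ _ "\<lambda>k. \<beta> i + 1 / (1 + real k)"])
    show "(\<lambda>k. \<beta> i + 1 / (1 + real k)) \<longlonglongrightarrow> \<beta> i" by real_asymp
  qed (use b1 b2 in auto)
  define R where "R = 1 + (\<Sum>i\<in>UNIV. \<beta> i)"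
  have bR: "0 \<le> b k i" "b k i \<le> R" for k i
  proof -
    show "0 \<le> b k i" using \<beta>0[of i] b1[of i k] by linarith
    have "1 / (1 + real k) \<le> 1" by simp
    moreover have "\<beta> i \<le> (\<Sum>i\<in>UNIV. \<beta> i)" using \<beta>0 by (intro member_le_sum) auto
    ultimately show "b k i \<le> R" using b2[of k i] unfolding R_def by linarith
  qed
  have R0: "R > 0" using \<beta>0 by (auto simp: R_def intro!: add_pos_nonneg sum_nonneg)
  have "\<forall>k. \<exists>\<mu> :: real measure. sets \<mu> = sets borel \<and>
     emeasure \<mu> {s. (\<forall>i. s < b k i) \<or> (\<forall>i. b k i < s)} = 0 \<and>
     (\<forall>t U l. spectral_decomp (A + dg (\<lambda>i. - t * b k i)) U l \<longrightarrow>
        (\<integral>\<^sup>+s. ennreal (exp (- t * s)) \<partial>\<mu>) = ennreal (\<Sum>i\<in>UNIV. exp (l i)))"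
    using laplace_measure_simple_spectrum[OF A binj] by blast
  then obtain \<mu> :: "nat \<Rightarrow> real measure" where \<mu>: "\<And>k. sets (\<mu> k) = sets borel"
     "\<And>k. emeasure (\<mu> k) {s. (\<forall>i. s < b k i) \<or> (\<forall>i. b k i < s)} = 0"
     "\<And>k t U l. spectral_decomp (A + dg (\<lambda>i. - t * b k i)) U l \<Longrightarrow>
        (\<integral>\<^sup>+s. ennreal (exp (- t * s)) \<partial>\<mu> k) = ennreal (\<Sum>i\<in>UNIV. exp (l i))"
    unfolding choice_iff by blast
  obtain UA a where UA: "spectral_decomp A UA a" using hermitian_spectral_decomp[OF A] by blast
  \<comment> \<open>The mass at \<open>t = 0\<close> is the trace of \<open>exp A\<close> for every
    \<open>k\<close>; dividing by it gives probability measures, as the selection theorem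
    expects.\<close>
  define T where "T = (\<Sum>i\<in>UNIV. exp (a i))"
  have T0: "T > 0" by (auto simp: T_def intro: sum_pos)
  define \<nu> where "\<nu> k = density (\<mu> k) (\<lambda>_. ennreal (1 / T))" for k
  have s\<nu> [measurable_cong, simp]: "sets (\<nu> k) = sets borel" for k by (simp add: \<nu>_def \<mu>(1))
  have nn\<nu>: "(\<integral>\<^sup>+s. f s \<partial>\<nu> k) = ennreal (1 / T) * (\<integral>\<^sup>+s. f s \<partial>\<mu> k)" if [measurable]: "f \<in> borel_measurable borel" for f k
  proof -
    have [measurable_cong]: "sets (\<mu> k) = sets borel" by (rule \<mu>(1))
    show ?thesis unfolding \<nu>_def by (simp add: nn_integral_density nn_integral_cmult)
  qed
  have mass: "emeasure (\<nu> k) (space (\<nu> k)) = 1" for k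
  proof -
    have "emeasure (\<nu> k) (space (\<nu> k)) = (\<integral>\<^sup>+s. ennreal (exp (- 0 * s)) \<partial>\<nu> k)" by simp
    also have "\<dots> = ennreal (1 / T) * (\<integral>\<^sup>+s. ennreal (exp (- 0 * s)) \<partial>\<mu> k)" by (rule nn\<nu>) measurable
    also have "(\<integral>\<^sup>+s. ennreal (exp (- 0 * s)) \<partial>\<mu> k) = ennreal T"
      unfolding T_def using UA by (intro \<mu>(3)[where U = UA]) simp
    finally show ?thesis using T0 by (simp add: ennreal_mult'[symmetric])
  qed
  have rd: "real_distribution (\<nu> k)" for k
    by (intro real_distribution.intro prob_spaceI real_distribution_axioms.intro mass) simp
  have AE\<nu>: "AE s in \<nu> k. 0 \<le> s \<and> s \<le> R" for k
  proof -
    let ?N = "{s. (\<forall>i. s < b k i) \<or> (\<forall>i. b k i < s)}"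
    have "?N = (\<Inter>i\<in>UNIV. {..<b k i}) \<union> (\<Inter>i\<in>UNIV. {b k i<..})" by auto
    moreover have "open ((\<Inter>i\<in>UNIV. {..<b k i}) \<union> (\<Inter>i\<in>UNIV. {b k i<..}))" by (intro open_Un open_INT) auto
    ultimately have "?N \<in> sets (\<mu> k)" by (simp add: \<mu>(1))
    then have "AE s in \<mu> k. s \<notin> ?N" using \<mu>(2)[of k] by (intro AE_not_in) auto
    then have "AE s in \<mu> k. 0 \<le> s \<and> s \<le> R"
    proof eventually_elim
      case (elim s)
      then obtain i j where "b k i \<le> s" "s \<le> b k j" by (auto simp: not_less)
      then show ?case using bR(1)[of k i] bR(2)[of k j] by linarith
    qed
    then show ?thesis unfolding \<nu>_def by (subst AE_density) (auto elim!: eventually_mono)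
  qed
  have "tight \<nu>"
    unfolding tight_def
  proof (intro conjI allI impI rd)
    fix e :: real assume "e > 0"
    \<comment> \<open>Tightness is stated with half-open intervals; a left end below 0 keeps a
      possible atom at 0.\<close>
    have "measure (\<nu> n) {-1<..R} = 1" for n
    proof -
      interpret real_distribution "\<nu> n" by (rule rd)
      show ?thesis using AE\<nu>[of n] by (subst prob_eq_1) (auto elim!: eventually_mono)
    qed
    then show "\<exists>a b. a < b \<and> (\<forall>n. 1 - e < measure (\<nu> n) {a<..b})"
      using \<open>e > 0\<close> R0 by (intro exI[of _ "-1"] exI[of _ R]) auto
  qed
  from tight_imp_convergent_subsubsequence[OF this strict_mono_id]
  obtain r M where r: "strict_mono r" and M: "real_distribution M" and wc: "weak_conv_m (\<lambda>k. \<nu> (r k)) M"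
    by (auto simp: o_def id_def)
  interpret M: real_distribution M by (rule M)
  have conv: "(\<lambda>k. \<integral>s. f s \<partial>\<nu> (r k)) \<longlonglongrightarrow> (\<integral>s. f s \<partial>M)" if "\<And>x. isCont f x" "\<And>x. \<bar>f x\<bar> \<le> 1" for f :: "real \<Rightarrow> real"
    using weak_conv_imp_integral_bdd_continuous_conv[OF rd M wc, of f 1] that by simp
  have AEM: "AE s in M. 0 \<le> s"
  proof -
    \<comment> \<open>A bounded continuous function that vanishes exactly on the nonnegative reals,
      so that weak convergence transfers the support condition to the limit.\<close>
    define f where "f s = min 1 (max 0 (- s))" for s :: real
    have fc: "isCont f x" for x unfolding f_def by (intro continuous_intros)
    have [measurable]: "f \<in> borel_measurable borel" unfolding f_def by measurable
    have "(\<integral>s. f s \<partial>\<nu> k) = 0" for k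
      using AE\<nu>[of k] by (intro integral_eq_zero_AE) (auto elim!: eventually_mono simp: f_def)
    with conv[OF fc] have "(\<lambda>k. 0) \<longlonglongrightarrow> (\<integral>s. f s \<partial>M)" by (simp add: f_def)
    then have "(\<integral>s. f s \<partial>M) = 0" using LIMSEQ_unique tendsto_const by blast
    moreover have "integrable M f" by (rule M.integrable_const_bound[where B = 1]) (auto simp: f_def)
    ultimately have "AE s in M. f s = 0" by (subst (asm) integral_nonneg_eq_0_iff_AE) (auto simp: f_def)
    then show ?thesis by eventually_elim (auto simp: f_def min_def max_def split: if_splits)
  qed
  define \<rho> where "\<rho> = density M (\<lambda>_. ennreal T)"
  have "(\<integral>\<^sup>+s. ennreal (exp (- t * s)) \<partial>\<rho>) = ennreal (\<Sum>i\<in>UNIV. exp (l i))"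
    if t: "t \<ge> 0" and U: "spectral_decomp (A + dg (\<lambda>i. - t * \<beta> i)) U l" for t U l
  proof -
    \<comment> \<open>The kernel is unbounded on negative \<open>s\<close> when
      \<open>t > 0\<close>; the truncated version is a legitimate test function and agrees with it
      almost everywhere.\<close>
    define f where "f s = exp (- t * max s 0)" for s :: real
    have fc: "isCont f x" for x unfolding f_def by (intro continuous_intros)
    have fm [measurable]: "f \<in> borel_measurable borel" unfolding f_def by measurable
    have f1: "\<bar>f x\<bar> \<le> 1" for x using t by (simp add: f_def)
    have "\<forall>k. \<exists>U l. spectral_decomp (A + dg (\<lambda>i. - t * b (r k) i)) U l"
      by (intro allI hermitian_spectral_decomp hermitian_add A hermitian_dg)
    then obtain U' l' where U': "\<And>k. spectral_decomp (A + dg (\<lambda>i. - t * b (r k) i)) (U' k) (l' k)"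
      unfolding choice_iff by blast
    have "(\<lambda>k. A + dg (\<lambda>i. - t * b (r k) i)) \<longlonglongrightarrow> A + dg (\<lambda>i. - t * \<beta> i)"
    proof (intro tendsto_add tendsto_const vec_tendstoI)
      fix i j
      have "(\<lambda>k. - t * b (r k) i) \<longlonglongrightarrow> - t * \<beta> i"
        by (intro tendsto_intros LIMSEQ_subseq_LIMSEQ[OF blim r, unfolded o_def])
      then show "(\<lambda>k. dg (\<lambda>i. - t * b (r k) i) $ i $ j) \<longlonglongrightarrow> dg (\<lambda>i. - t * \<beta> i) $ i $ j"
        unfolding dg_nth by (cases "i = j") (simp_all only: if_True if_False refl tendsto_of_real tendsto_const simp_thms)
    qed
    then have "(\<lambda>k. \<Sum>i\<in>UNIV. exp (l' k i)) \<longlonglongrightarrow> (\<Sum>i\<in>UNIV. exp (l i))"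
      by (intro trace_fun_continuous[OF _ U' U]) (intro continuous_intros)
    then have lim: "(\<lambda>k. (1 / T) * (\<Sum>i\<in>UNIV. exp (l' k i))) \<longlonglongrightarrow> (1 / T) * (\<Sum>i\<in>UNIV. exp (l i))"
      by (rule tendsto_mult_left)
    have "(\<integral>s. f s \<partial>\<nu> (r k)) = (1 / T) * (\<Sum>i\<in>UNIV. exp (l' k i))" for k
    proof -
      have "(\<integral>\<^sup>+s. ennreal (f s) \<partial>\<nu> (r k)) = (\<integral>\<^sup>+s. ennreal (exp (- t * s)) \<partial>\<nu> (r k))"
        unfolding f_def using AE\<nu>[of "r k"] by (intro exp_nn_integral_max[symmetric]) (auto elim!: eventually_mono)
      also have "\<dots> = ennreal (1 / T) * ennreal (\<Sum>i\<in>UNIV. exp (l' k i))"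
        by (subst nn\<nu>) (auto simp only: \<mu>(3)[OF U'], measurable)
      also have "\<dots> = ennreal ((1 / T) * (\<Sum>i\<in>UNIV. exp (l' k i)))"
        using T0 by (intro ennreal_mult'[symmetric]) auto
      finally have "has_bochner_integral (\<nu> (r k)) f ((1 / T) * (\<Sum>i\<in>UNIV. exp (l' k i)))"
        using T0 by (intro has_bochner_integral_nn_integral) (auto simp: f_def intro!: sum_nonneg divide_nonneg_pos)
      then show ?thesis by (rule has_bochner_integral_integral_eq)
    qed
    with conv[OF fc f1] lim have Mf: "(\<integral>s. f s \<partial>M) = (1 / T) * (\<Sum>i\<in>UNIV. exp (l i))"
      using LIMSEQ_unique by simp
    have "(\<integral>\<^sup>+s. ennreal (exp (- t * s)) \<partial>\<rho>) = (\<integral>\<^sup>+s. ennreal T * ennreal (exp (- t * s)) \<partial>M)"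
      unfolding \<rho>_def by (intro nn_integral_density) measurable
    also have "\<dots> = ennreal T * (\<integral>\<^sup>+s. ennreal (exp (- t * s)) \<partial>M)" by (intro nn_integral_cmult) measurable
    also have "(\<integral>\<^sup>+s. ennreal (exp (- t * s)) \<partial>M) = (\<integral>\<^sup>+s. ennreal (f s) \<partial>M)"
      unfolding f_def by (rule exp_nn_integral_max[OF AEM])
    also have "\<dots> = ennreal (\<integral>s. f s \<partial>M)"
    proof (rule nn_integral_eq_integral)
      show "integrable M f" by (rule M.integrable_const_bound[where B = 1]) (auto simp: f1)
    qed (simp add: f_def)
    also have "ennreal T * \<dots> = ennreal (\<Sum>i\<in>UNIV. exp (l i))"
      unfolding Mf using T0 by (simp add: ennreal_mult'[symmetric])
    finally show ?thesis .
  qed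
  moreover have "emeasure \<rho> {..<0} = 0"
  proof -
    have "AE s in \<rho>. 0 \<le> s" unfolding \<rho>_def using AEM by (subst AE_density) (auto elim!: eventually_mono)
    then show ?thesis by (subst (asm) AE_iff_measurable[of "{..<0}"]) (auto simp: \<rho>_def)
  qed
  moreover have "sets \<rho> = sets borel" by (simp add: \<rho>_def)
  ultimately show ?thesis by blast
qed

theorem theorem1:
  fixes A B :: "complex ^'n ^'n"
  assumes "hermitian_mat A" and "psd_mat B"
  shows "\<exists>!\<mu> :: real measure.
           sets \<mu> = sets borel \<and>
           emeasure \<mu> {..<0} = 0 \<and>
           (\<forall>t::real. t \<ge> 0 \<longrightarrow>
              integrable \<mu> (\<lambda>s. exp (- t * s :: real)) \<and>
              mat_trace (mat_exp (A - t *\<^sub>R B)) =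
                complex_of_real (\<integral>s. exp (- t * s :: real) \<partial>\<mu>))"
proof (rule ex_ex1I)
  have B: "hermitian_mat B" using assms(2) by (simp add: psd_mat_def)
  obtain V \<beta> where V: "spectral_decomp B V \<beta>" using hermitian_spectral_decomp[OF B] by blast
  have uV: "unitary_mat V" and BV: "B = V ** dg \<beta> ** adj V" using V by (auto simp: spectral_decomp_def)
  have VV: "adj V ** V = mat 1" "V ** adj V = mat 1" using uV unitary_mat_right by (auto simp: unitary_mat_def)
  have \<beta>0: "\<beta> i \<ge> 0" for i
  proof -
    \<comment> \<open>Column \<open>i\<close> of \<open>V\<close> is a unit eigenvector of
      \<open>B\<close>, so the quadratic form there equals \<open>\<beta> i\<close>.\<close>
    define x where "x = (\<chi> k. V $ k $ i)"
    have "adj V *v x = axis i 1"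
      using VV(1) by (simp add: vec_eq_iff matrix_vector_mult_def matrix_matrix_mult_def mat_def x_def axis_def)
    then have y: "dg \<beta> *v (adj V *v x) = axis i (complex_of_real (\<beta> i))"
      by (simp add: vec_eq_iff matrix_vector_mult_def dg_nth axis_def mult_delta_right)
    have "(\<Sum>i\<in>UNIV. \<Sum>j\<in>UNIV. cnj (x $ i) * B $ i $ j * x $ j) = cin x (B *v x)"
      by (simp add: cin_def matrix_vector_mult_def sum_distrib_left mult_ac)
    also have "\<dots> = cin x (V *v (dg \<beta> *v (adj V *v x)))"
      by (simp add: BV matrix_vector_mul_assoc matrix_mul_assoc)
    also have "\<dots> = cin (adj V *v x) (dg \<beta> *v (adj V *v x))" by (rule cin_mult_right)
    also have "\<dots> = complex_of_real (\<beta> i)"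
      unfolding y unfolding \<open>adj V *v x = axis i 1\<close> by (simp add: cin_def axis_def mult_delta_left mult_delta_right)
    finally have "Re (\<Sum>i\<in>UNIV. \<Sum>j\<in>UNIV. cnj (x $ i) * B $ i $ j * x $ j) = \<beta> i" by (simp only: Re_complex_of_real)
    moreover have "0 \<le> Re (\<Sum>i\<in>UNIV. \<Sum>j\<in>UNIV. cnj (x $ i) * B $ i $ j * x $ j)"
      using assms(2) unfolding psd_mat_def by blast
    ultimately show ?thesis by simp
  qed
  \<comment> \<open>Conjugation by \<open>V\<close> diagonalises \<open>B\<close> and preserves the
    spectrum of the whole pencil, hence the trace of its exponential.\<close>
  define A' where "A' = adj V ** A ** V"
  have A': "hermitian_mat A'"
    using assms(1) by (simp add: hermitian_mat_iff_adj A'_def adj_mult matrix_mul_assoc)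
  have trans: "spectral_decomp (A - t *\<^sub>R B) (V ** U) l" if U: "spectral_decomp (A' + dg (\<lambda>i. - t * \<beta> i)) U l" for t U l
  proof -
    have "A = V ** A' ** adj V"
      unfolding A'_def by (metis VV(2) matrix_mul_assoc matrix_mul_lid matrix_mul_rid)
    moreover have "V ** (A' + dg (\<lambda>i. - t * \<beta> i)) ** adj V = V ** A' ** adj V + V ** dg (\<lambda>i. - t * \<beta> i) ** adj V"
      by (simp add: vec_eq_iff matrix_matrix_mult_def distrib_left distrib_right sum.distrib)
    moreover have "V ** dg (\<lambda>i. - t * \<beta> i) ** adj V = - (t *\<^sub>R B)"
      using spectral_decomp_scaleR[OF V, of "-t"] by (simp add: spectral_decomp_def)
    ultimately have "A - t *\<^sub>R B = V ** (U ** dg l ** adj U) ** adj V"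
      using U by (simp add: spectral_decomp_def)
    moreover have "unitary_mat (V ** U)"
    proof -
      have "adj (V ** U) ** (V ** U) = adj U ** (adj V ** V) ** U" by (simp add: adj_mult matrix_mul_assoc)
      also have "\<dots> = mat 1" using U by (simp add: VV spectral_decomp_def unitary_mat_def)
      finally show ?thesis by (simp add: unitary_mat_def)
    qed
    ultimately show ?thesis by (simp add: spectral_decomp_def adj_mult matrix_mul_assoc)
  qed
  obtain \<mu> :: "real measure" where \<mu>: "sets \<mu> = sets borel" "emeasure \<mu> {..<0} = 0"
    "\<And>t U l. t \<ge> 0 \<Longrightarrow> spectral_decomp (A' + dg (\<lambda>i. - t * \<beta> i)) U l \<Longrightarrow>
        (\<integral>\<^sup>+s. ennreal (exp (- t * s)) \<partial>\<mu>) = ennreal (\<Sum>i\<in>UNIV. exp (l i))"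
    using laplace_measure_diagonal[OF A', of \<beta>, OF \<beta>0] by metis
  have "integrable \<mu> (\<lambda>s. exp (- t * s :: real)) \<and>
        mat_trace (mat_exp (A - t *\<^sub>R B)) = complex_of_real (\<integral>s. exp (- t * s :: real) \<partial>\<mu>)" if t: "t \<ge> 0" for t :: real
  proof -
    note [measurable_cong] = \<mu>(1)
    obtain U l where U: "spectral_decomp (A' + dg (\<lambda>i. - t * \<beta> i)) U l"
      using hermitian_spectral_decomp[OF hermitian_add[OF A' hermitian_dg]] by blast
    have "has_bochner_integral \<mu> (\<lambda>s. exp (- t * s)) (\<Sum>i\<in>UNIV. exp (l i))"
      by (rule has_bochner_integral_nn_integral) (auto simp only: \<mu>(3)[OF t U], auto intro: sum_nonneg)
    then show ?thesis
      using mat_trace_exp_spectral_decomp[OF trans[OF U]] by (simp add: has_bochner_integral_iff)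
  qed
  with \<mu>(1,2) show "\<exists>\<mu> :: real measure.
           sets \<mu> = sets borel \<and>
           emeasure \<mu> {..<0} = 0 \<and>
           (\<forall>t::real. t \<ge> 0 \<longrightarrow>
              integrable \<mu> (\<lambda>s. exp (- t * s :: real)) \<and>
              mat_trace (mat_exp (A - t *\<^sub>R B)) =
                complex_of_real (\<integral>s. exp (- t * s :: real) \<partial>\<mu>))" by blast
next
  fix \<mu> \<nu> :: "real measure"
  assume h1: "sets \<mu> = sets borel \<and> emeasure \<mu> {..<0} = 0 \<and>
           (\<forall>t::real. t \<ge> 0 \<longrightarrow> integrable \<mu> (\<lambda>s. exp (- t * s :: real)) \<and>
              mat_trace (mat_exp (A - t *\<^sub>R B)) = complex_of_real (\<integral>s. exp (- t * s :: real) \<partial>\<mu>))"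
    and h2: "sets \<nu> = sets borel \<and> emeasure \<nu> {..<0} = 0 \<and>
           (\<forall>t::real. t \<ge> 0 \<longrightarrow> integrable \<nu> (\<lambda>s. exp (- t * s :: real)) \<and>
              mat_trace (mat_exp (A - t *\<^sub>R B)) = complex_of_real (\<integral>s. exp (- t * s :: real) \<partial>\<nu>))"
  have "(\<integral>s. exp (- t * s) \<partial>\<mu>) = (\<integral>s. exp (- t * s) \<partial>\<nu>)" if "t \<ge> 0" for t :: real
  proof -
    have "complex_of_real (\<integral>s. exp (- t * s) \<partial>\<mu>) = complex_of_real (\<integral>s. exp (- t * s) \<partial>\<nu>)"
      using h1 h2 that by metis
    then show ?thesis by (simp only: of_real_eq_iff)
  qed
  with h1 h2 show "\<mu> = \<nu>" by (intro laplace_unique) auto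
qed

end
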